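(* Let $A,B,C$ be finite sets, $\theta=\{1,\dots,T\}$, and let $\mathfrak{W}=\{(W_t,V_t):t\in\theta\}$ be a compound wiretap channel with $W_t:A\to\mathcal{P}(B)$ and $V_t:A\to\mathcal{P}(C)$. The secrecy capacity of $\mathfrak{W}$ with channel state information (CSI) at the transmitter is $$C_{S,CSI}(\mathfrak{W})=\min_{t\in\theta}\ \max_{U_t\to X_t\to (Y_t,Z_t)}\big(I(U_t;Y_t)-I(U_t;Z_t)\big),$$ where for each $t\in\theta$ the maximum is over all random variables $U_t,X_t$ with values in $A$ and $Y_t,Z_t$ with values in $B,C$ such that $U_t\to X_t\to (Y_t,Z_t)$ is a Markov chain, $Y_t$ is the output of $W_t$ on input $X_t$, and $Z_t$ is the output of $V_t$ on input $X_t$.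
   Context: $\mathcal{P}(B)$ is the set of probability distributions on the finite set $B$; a channel $W:A\to\mathcal{P}(B)$ is a stochastic matrix; $W^{\otimes n}$ is its $n$-th memoryless extension, $W^{\otimes n}(y^n|x^n)=\prod_i W(y_i|x_i)$. Logarithms (also in mutual information) are to base 2. Compound wiretap channel: a finite family $\mathfrak{W}=\{(W_t,V_t):t\in\theta\}$, $\theta=\{1,\dots,T\}$, with $W_t:A\to\mathcal{P}(B)$ (to the legitimate receiver) and $V_t:A\to\mathcal{P}(C)$ (to the eavesdropper). An $(n,J_n)$ code with CSI at the transmitter consists of stochastic encoders $E_t:\mathcal{J}_n\to\mathcal{P}(A^n)$, $t\in\theta$, with $\mathcal{J}_n=\{1,\dots,J_n\}$, and mutually disjoint decoding sets $\{D_j\subset B^n:j\in\mathcal{J}_n\}$ that do not depend on $t$. Its maximum error probability is $$e_{\mathrm{CSI}}(\mathcal{C}_n)=\max_{t\in\theta}\max_{j\in\mathcal{J}_n}\sum_{x^n\in A^n}E_t(x^n|j)W_t^{\otimes n}(D_j^c|x^n).$$ A number $R\ge 0$ is an achievable secrecy rate with CSI if there is a sequence of such $(n,J_n)$ codes $\mathcal{C}_n$ with $\lim_n e_{\mathrm{CSI}}(\mathcal{C}_n)=0$, $\liminf_n\frac1n\log J_n\ge R$, and $\lim_{n}\max_{t\in\theta}I(J;Z_t^n)=0$, where $J$ is uniformly distributed on $\mathcal{J}_n$ and $Z_t^n$ is the resulting output of the eavesdropper's channel $V_t^{\otimes n}$, i.e. $\Pr(J=j,Z_t^n=z^n)=\frac1{J_n}\sum_{x^n}E_t(x^n|j)V_t^{\otimes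 n}(z^n|x^n)$. $C_{S,CSI}(\mathfrak{W})$ is the largest (supremum) achievable secrecy rate with CSI. *)

theory Defs
  imports "HOL-Probability.Probability"
begin

section \<open>Words and memoryless channels\<close>

text \<open>
  A channel is a function \<open>'a \<Rightarrow> 'b pmf\<close>, with finite types as alphabets.
\<close>

definition words :: "nat \<Rightarrow> 'a list set" where
  "words n = {xs. length xs = n}"

primrec memoryless :: "('a \<Rightarrow> 'b pmf) \<Rightarrow> 'a list \<Rightarrow> 'b list pmf" where
  "memoryless W [] = return_pmf []"
| "memoryless W (x # xs) = do {y \<leftarrow> W x; ys \<leftarrow> memoryless W xs; return_pmf (y # ys)}"

lemma set_pmf_memoryless: "set_pmf (memoryless W xs) \<subseteq> words (length xs)"
  by (induction xs) (auto simp: words_def)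

lemma pmf_memoryless:
  assumes "length ys = length xs"
  shows "pmf (memoryless W xs) ys = (\<Prod>i<length xs. pmf (W (xs ! i)) (ys ! i))"
  using assms
proof (induction xs arbitrary: ys)
  case Nil
  then show ?case by simp
next
  case (Cons x xs)
  then obtain y ys' where ys: "ys = y # ys'" and len: "length ys' = length xs"
    by (cases ys) auto
  have "memoryless W (x # xs) = map_pmf (\<lambda>(a, b). a # b) (pair_pmf (W x) (memoryless W xs))"
    by (simp add: pair_pmf_def map_bind_pmf)
  moreover have "inj (\<lambda>(a, b). a # b)"
    by (auto simp: inj_def)
  ultimately have "pmf (memoryless W (x # xs)) ys = pmf (W x) y * pmf (memoryless W xs) ys'"
    using pmf_map_inj'[of "\<lambda>(a, b). a # b" "pair_pmf (W x) (memoryless W xs)" "(y, ys')"]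
    by (simp add: ys pmf_pair)
  then show ?case
    by (simp add: ys Cons.IH[OF len] prod.lessThan_Suc_shift del: memoryless.simps prod.lessThan_Suc)
qed


section \<open>Mutual information\<close>

text \<open>
  Mutual information in bits of two discrete random variables on the probability
  space given by a pmf.  Countable value types are needed for the product of the two
  counting \<open>\<sigma>\<close>-algebras to be discrete; words over a finite type are not a finite type.
\<close>

definition mutual_info :: "'w pmf \<Rightarrow> ('w \<Rightarrow> 'x::countable) \<Rightarrow> ('w \<Rightarrow> 'y::countable) \<Rightarrow> real" where
  "mutual_info P X Y =
     prob_space.mutual_information (measure_pmf P) 2 (count_space UNIV) (count_space UNIV) X Y"

lemma mutual_info_eq_sum:
  fixes X :: "'w \<Rightarrow> 'x::countable" and Y :: "'w \<Rightarrow> 'y::countable"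
  assumes fin: "finite (set_pmf (map_pmf (\<lambda>w. (X w, Y w)) P))"
  shows "mutual_info P X Y =
    (\<Sum>(x, y) \<in> set_pmf (map_pmf (\<lambda>w. (X w, Y w)) P).
       pmf (map_pmf (\<lambda>w. (X w, Y w)) P) (x, y) *
       log 2 (pmf (map_pmf (\<lambda>w. (X w, Y w)) P) (x, y) / (pmf (map_pmf X P) x * pmf (map_pmf Y P) y)))"
proof -
  interpret information_space "measure_pmf P" 2
    by unfold_locales simp
  let ?Q = "map_pmf (\<lambda>w. (X w, Y w)) P"
  have C: "(count_space UNIV :: 'x measure) \<Otimes>\<^sub>M (count_space UNIV :: 'y measure) = count_space UNIV"
    by (simp add: pair_measure_countable)
  have D: "distributed (measure_pmf P) (count_space UNIV) F (\<lambda>x. ennreal (pmf (map_pmf F P) x))"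
    for F :: "'w \<Rightarrow> 'z"
    unfolding distributed_def
    by (simp add: map_pmf_rep_eq[symmetric] measure_pmf_eq_density[symmetric])
  have "mutual_info P X Y = integral\<^sup>L (count_space UNIV \<Otimes>\<^sub>M count_space UNIV)
      (\<lambda>z. pmf ?Q z * log 2 (pmf ?Q z / (pmf (map_pmf X P) (fst z) * pmf (map_pmf Y P) (snd z))))"
    unfolding mutual_info_def
    by (rule mutual_information_distr)
       (auto intro!: D sigma_finite_measure_count_space_countable simp: C)
  also have "\<dots> = (\<Sum>z\<in>set_pmf ?Q. pmf ?Q z *
      log 2 (pmf ?Q z / (pmf (map_pmf X P) (fst z) * pmf (map_pmf Y P) (snd z))))"
    unfolding C
    by (subst lebesgue_integral_count_space_finite_support)
       (auto intro!: sum.mono_neutral_left fin finite_subset[OF _ fin] simp: pmf_eq_0_set_pmf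
             simp del: set_map_pmf)
  finally show ?thesis
    by (simp add: case_prod_unfold)
qed


section \<open>Codes with CSI at the transmitter\<close>

text \<open>
  Throughout, \<open>T\<close> is the number of channel states; \<open>E t j\<close> is the distribution of the
  channel input for message \<open>j\<close> in state \<open>t\<close>, and \<open>D j\<close> is the decoding set of \<open>j\<close>.
\<close>

definition csi_code ::
  "nat \<Rightarrow> nat \<Rightarrow> nat \<Rightarrow> (nat \<Rightarrow> nat \<Rightarrow> 'a list pmf) \<Rightarrow> (nat \<Rightarrow> 'b list set) \<Rightarrow> bool" where
  "csi_code T n J E D \<longleftrightarrow>
     J \<ge> 1 \<and>
     (\<forall>t\<in>{1..T}. \<forall>j\<in>{1..J}. set_pmf (E t j) \<subseteq> words n) \<and>
     (\<forall>j\<in>{1..J}. D j \<subseteq> words n) \<and>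
     disjoint_family_on D {1..J}"

definition csi_error ::
  "nat \<Rightarrow> (nat \<Rightarrow> 'a::finite \<Rightarrow> 'b::finite pmf) \<Rightarrow> nat \<Rightarrow> nat \<Rightarrow>
   (nat \<Rightarrow> nat \<Rightarrow> 'a list pmf) \<Rightarrow> (nat \<Rightarrow> 'b list set) \<Rightarrow> real" where
  "csi_error T W n J E D =
     (MAX t\<in>{1..T}. MAX j\<in>{1..J}.
        \<Sum>x\<in>words n. pmf (E t j) x * measure_pmf.prob (memoryless (W t) x) (words n - D j))"

definition message_output ::
  "('a \<Rightarrow> 'c pmf) \<Rightarrow> nat \<Rightarrow> (nat \<Rightarrow> 'a list pmf) \<Rightarrow> (nat \<times> 'c list) pmf" where
  "message_output V J E =
     do {j \<leftarrow> pmf_of_set {1..J}; x \<leftarrow> E j; z \<leftarrow> memoryless V x; return_pmf (j, z)}"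

definition csi_leakage ::
  "nat \<Rightarrow> (nat \<Rightarrow> 'a::finite \<Rightarrow> 'c::finite pmf) \<Rightarrow> nat \<Rightarrow> (nat \<Rightarrow> nat \<Rightarrow> 'a list pmf) \<Rightarrow> real" where
  "csi_leakage T V J E = (MAX t\<in>{1..T}. mutual_info (message_output (V t) J (E t)) fst snd)"

definition csi_achievable ::
  "nat \<Rightarrow> (nat \<Rightarrow> 'a::finite \<Rightarrow> 'b::finite pmf) \<Rightarrow> (nat \<Rightarrow> 'a \<Rightarrow> 'c::finite pmf) \<Rightarrow> real \<Rightarrow> bool" where
  "csi_achievable T W V R \<longleftrightarrow>
     R \<ge> 0 \<and>
     (\<exists>(J :: nat \<Rightarrow> nat) (E :: nat \<Rightarrow> nat \<Rightarrow> nat \<Rightarrow> 'a list pmf) (D :: nat \<Rightarrow> nat \<Rightarrow> 'b list set).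
        (\<forall>n. csi_code T n (J n) (E n) (D n)) \<and>
        (\<lambda>n. csi_error T W n (J n) (E n) (D n)) \<longlonglongrightarrow> 0 \<and>
        liminf (\<lambda>n. ereal (log 2 (real (J n)) / real n)) \<ge> ereal R \<and>
        (\<lambda>n. csi_leakage T V (J n) (E n)) \<longlonglongrightarrow> 0)"

text \<open>Extended reals, so that the supremum is meaningful without a prior bound on the rates.\<close>

definition csi_secrecy_capacity ::
  "nat \<Rightarrow> (nat \<Rightarrow> 'a::finite \<Rightarrow> 'b::finite pmf) \<Rightarrow> (nat \<Rightarrow> 'a \<Rightarrow> 'c::finite pmf) \<Rightarrow> ereal" where
  "csi_secrecy_capacity T W V = (SUP R \<in> {R. csi_achievable T W V R}. ereal R)"


section \<open>The single-letter expression\<close>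

text \<open>
  The joint law \<open>P\<close> of \<open>(A, B, C)\<close> makes \<open>A \<rightarrow> B \<rightarrow> C\<close> a Markov chain:
  \<open>P(a,b,c) P(b) = P(a,b) P(b,c)\<close>.
\<close>

definition markov_chain :: "('u \<times> 'x \<times> 'y) pmf \<Rightarrow> bool" where
  "markov_chain P \<longleftrightarrow>
     (\<forall>a b c. pmf P (a, b, c) * pmf (map_pmf (\<lambda>(a, b, c). b) P) b =
        pmf (map_pmf (\<lambda>(a, b, c). (a, b)) P) (a, b) * pmf (map_pmf (\<lambda>(a, b, c). (b, c)) P) (b, c))"

definition channel_output :: "('x \<times> 'y) pmf \<Rightarrow> ('x \<Rightarrow> 'y pmf) \<Rightarrow> bool" where
  "channel_output Q W \<longleftrightarrow> (\<forall>x y. pmf Q (x, y) = pmf (map_pmf fst Q) x * pmf (W x) y)"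

text \<open>
  Laws of \<open>(U, X, Y, Z)\<close> with \<open>U \<rightarrow> X \<rightarrow> (Y, Z)\<close>.  The coupling of \<open>Y\<close> and \<open>Z\<close> given \<open>X\<close>
  is left free; only its two marginals are prescribed.
\<close>

definition wiretap_laws ::
  "('a \<Rightarrow> 'b pmf) \<Rightarrow> ('a \<Rightarrow> 'c pmf) \<Rightarrow> ('a \<times> 'a \<times> 'b \<times> 'c) pmf set" where
  "wiretap_laws W V =
     {P. markov_chain P \<and>
         channel_output (map_pmf (\<lambda>(u, x, y, z). (x, y)) P) W \<and>
         channel_output (map_pmf (\<lambda>(u, x, y, z). (x, z)) P) V}"

definition secrecy_values :: "('a::finite \<Rightarrow> 'b::finite pmf) \<Rightarrow> ('a \<Rightarrow> 'c::finite pmf) \<Rightarrow> real set" where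
  "secrecy_values W V =
     {mutual_info P (\<lambda>(u, x, y, z). u) (\<lambda>(u, x, y, z). y)
        - mutual_info P (\<lambda>(u, x, y, z). u) (\<lambda>(u, x, y, z). z) | P. P \<in> wiretap_laws W V}"

end

theory Submission
  imports Defs "HOL-Real_Asymp.Real_Asymp"
begin

text \<open>
  Let \<open>F(\<mu>) = H(Z) - H(Y)\<close> for an input measure \<open>\<mu>\<close>.  Then \<open>I(M;Y) - I(M;Z)\<close> is the gap
  \<open>\<Sum>\<^sub>m F(\<mu>\<^sub>m) - F(\<Sum>\<^sub>m \<mu>\<^sub>m)\<close>.  With entropies extended homogeneously to unnormalised
  measures, no conditional distributions occur, and switching the coordinates of the output one
  by one from the eavesdropper's to the receiver's channel writes the \<open>n\<close>-letter \<open>F\<close> as a sum of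
  single-letter ones, so the gap of a code is at most \<open>n\<close> times the single-letter maximum.
  Together with Fano's inequality this is the converse.

  For achievability, take in each state an i.i.d. codebook with \<open>L\<^sub>t\<close> codewords per message,
  \<open>L\<^sub>t\<close> slightly above \<open>exp (n I(U\<^sub>t;Z\<^sub>t))\<close>, and send a random codeword of the message.  Soft
  covering makes the eavesdropper's output almost independent of the message.  The receiver
  does not know the state and tests all codewords of all states against state dependent
  thresholds for the information density; an independent codeword passes its test with
  probability at most the reciprocal of the threshold, whatever the actual channel output is.
  Discarding the worse half of the messages turns averages into maxima.
\<close>

section \<open>Entropy differences\<close>

text \<open>In the single-letter maximum \<open>U\<close> has only \<open>CARD('a)\<close> values,
  whereas a code gives one measure per message. Hence the bound is stated for arbitrary finite
  families. The gap depends on the total measure, a vector with \<open>CARD('a)\<close> coordinates,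
  and on a sum of homogeneous terms, so a family can be thinned out to \<open>CARD('a)\<close>
  members without lowering it. The coordinatewise switch is Csiszar's sum identity: conditioning on
  past outputs of one channel and future outputs of the other is hidden in the unnormalised
  measures.

  For achievability, the number of codewords of a state, about exp (n (R ln 2 + I(U;Z))), has to
  stay below a threshold exp (n a) with a < I(U;Y). A Chernoff argument makes the lower tail of the
  density at the receiver and the upper tail at the eavesdropper geometric in n, so finitely many
  states cost only a finite sum. Secrecy is measured by relative entropy to the i.i.d. output law, a
  reference that does not depend on the codebook. Logarithms are natural inside the proof; factors
  ln 2 appear where rates in bits enter.\<close>

definition eta :: "real \<Rightarrow> real" where
  "eta t = - t * ln t"

lemma eta_0 [simp]: "eta 0 = 0"
  by (simp add: eta_def)

text \<open>Scaling costs a term linear in \<open>t\<close>. Summed over an output alphabet it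
  depends only on the total mass, which lets it cancel between two channels.\<close>

lemma eta_mult:
  assumes "c \<ge> 0" "t \<ge> 0"
  shows "eta (c * t) = c * eta t - t * (c * ln c)"
  using assms by (cases "c = 0 \<or> t = 0") (auto simp: eta_def ln_mult algebra_simps)

text \<open>Only the point 0 needs an argument. It cannot be left out, since a maximising joint law
  may have vanishing entries.\<close>

lemma continuous_on_eta: "continuous_on {0..} eta"
proof -
  have "\<forall>x\<in>{0..}. continuous (at x within {0..}) eta"
  proof
    fix x :: real assume "x \<in> {0..}"
    show "continuous (at x within {0..}) eta"
    proof (cases "x = 0")
      case True
      have "((\<lambda>t::real. - t * ln t) \<longlongrightarrow> 0) (at_right 0)" by real_asymp
      moreover have "at (0::real) within {0..} = at_right 0"
        by (rule at_within_Ici_at_right)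
      ultimately show ?thesis using True
        by (simp add: continuous_within eta_def[abs_def])
    next
      case False
      then have "x > 0" using \<open>x \<in> {0..}\<close> by simp
      then show ?thesis unfolding eta_def
        by (intro continuous_intros) auto
    qed
  qed
  then show ?thesis by (simp add: continuous_on_eq_continuous_within)
qed

text \<open>For an unnormalised input measure \<open>\<mu>\<close> on \<open>A\<close>, this is \<open>H(Z) - H(Y)\<close> scaled by the
  mass of \<open>\<mu>\<close>: the normalising terms cancel, since both outputs have the mass of \<open>\<mu>\<close>.\<close>

definition ediff :: "'x set \<Rightarrow> 'y set \<Rightarrow> 'z set \<Rightarrow> ('x \<Rightarrow> 'y pmf) \<Rightarrow> ('x \<Rightarrow> 'z pmf) \<Rightarrow> ('x \<Rightarrow> real) \<Rightarrow> real" where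
  "ediff A B C W V \<mu> =
     (\<Sum>z\<in>C. eta (\<Sum>x\<in>A. \<mu> x * pmf (V x) z)) - (\<Sum>y\<in>B. eta (\<Sum>x\<in>A. \<mu> x * pmf (W x) y))"

lemma ediff_zero [simp]: "ediff A B C W V (\<lambda>x. 0) = 0"
  by (simp add: ediff_def)

text \<open>Relative to sets because words over a finite alphabet form an infinite type; the output
  law has to sum to one over words of the right length.\<close>

definition stochastic_on :: "'x set \<Rightarrow> 'y set \<Rightarrow> ('x \<Rightarrow> 'y pmf) \<Rightarrow> bool" where
  "stochastic_on A B W \<longleftrightarrow> (\<forall>x\<in>A. (\<Sum>y\<in>B. pmf (W x) y) = 1)"

lemma stochastic_on_UNIV: "stochastic_on A UNIV (W :: 'x \<Rightarrow> 'y::finite pmf)"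
  by (simp add: stochastic_on_def sum_pmf_eq_1)

lemma output_mass:
  assumes "stochastic_on A B W" "finite A" "finite B"
  shows "(\<Sum>y\<in>B. \<Sum>x\<in>A. \<mu> x * pmf (W x) y) = (\<Sum>x\<in>A. \<mu> x)"
proof -
  have "(\<Sum>y\<in>B. \<Sum>x\<in>A. \<mu> x * pmf (W x) y) = (\<Sum>x\<in>A. \<mu> x * (\<Sum>y\<in>B. pmf (W x) y))"
    unfolding sum_distrib_left by (rule sum.swap)
  then show ?thesis using assms by (simp add: stochastic_on_def)
qed

text \<open>The correction from \<open>eta_mult\<close> is the input mass times
  \<open>c * ln c\<close> for either channel, so it cancels in the difference.\<close>

lemma ediff_scale:
  assumes "stochastic_on A B W" "stochastic_on A C V" "finite A" "finite B" "finite C"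
    and "c \<ge> 0" "\<And>x. x \<in> A \<Longrightarrow> \<mu> x \<ge> 0"
  shows "ediff A B C W V (\<lambda>x. c * \<mu> x) = c * ediff A B C W V \<mu>"
proof -
  have *: "(\<Sum>y\<in>D. eta (\<Sum>x\<in>A. c * \<mu> x * pmf (K x) y)) =
      c * (\<Sum>y\<in>D. eta (\<Sum>x\<in>A. \<mu> x * pmf (K x) y)) - (\<Sum>x\<in>A. \<mu> x) * (c * ln c)"
    if "stochastic_on A D K" "finite D" for D and K :: "'a \<Rightarrow> 'out pmf"
  proof -
    have "(\<Sum>y\<in>D. eta (\<Sum>x\<in>A. c * \<mu> x * pmf (K x) y)) =
      (\<Sum>y\<in>D. c * eta (\<Sum>x\<in>A. \<mu> x * pmf (K x) y) - (\<Sum>x\<in>A. \<mu> x * pmf (K x) y) * (c * ln c))"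
      using assms by (subst eta_mult[symmetric]) (auto intro!: sum_nonneg sum.cong simp: sum_distrib_left mult_ac)
    also have "\<dots> = c * (\<Sum>y\<in>D. eta (\<Sum>x\<in>A. \<mu> x * pmf (K x) y)) - (\<Sum>x\<in>A. \<mu> x) * (c * ln c)"
      by (simp add: sum_subtractf output_mass[OF that(1) assms(3) that(2)] flip: sum_distrib_left sum_distrib_right)
    finally show ?thesis .
  qed
  show ?thesis unfolding ediff_def using *[OF assms(1,4)] *[OF assms(2,5)] by (simp add: algebra_simps)
qed

text \<open>In nats and over explicit finite index sets, so that one formula serves letters as well
  as words.\<close>

definition mi :: "'k set \<Rightarrow> 'y set \<Rightarrow> ('k \<Rightarrow> 'y \<Rightarrow> real) \<Rightarrow> real" where
  "mi K B r = (\<Sum>k\<in>K. \<Sum>y\<in>B. r k y * ln (r k y / ((\<Sum>y'\<in>B. r k y') * (\<Sum>k'\<in>K. r k' y))))"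

lemma mi_cong:
  assumes "\<And>k y. k \<in> K \<Longrightarrow> y \<in> B \<Longrightarrow> r k y = r' k y"
  shows "mi K B r = mi K B r'"
  using assms by (simp add: mi_def)

text \<open>This is H(K) + H(Y) - H(K,Y). The logarithm splits because a positive entry makes both
  of its marginals positive; zero entries carry weight zero.\<close>

lemma mi_eq_eta:
  assumes "finite K" "finite B" "\<And>k y. k \<in> K \<Longrightarrow> y \<in> B \<Longrightarrow> r k y \<ge> 0"
  shows "mi K B r = (\<Sum>k\<in>K. eta (\<Sum>y\<in>B. r k y)) + (\<Sum>y\<in>B. eta (\<Sum>k\<in>K. r k y))
     - (\<Sum>k\<in>K. \<Sum>y\<in>B. eta (r k y))"
proof -
  have "mi K B r = (\<Sum>k\<in>K. \<Sum>y\<in>B. r k y * ln (r k y) - r k y * ln (\<Sum>y'\<in>B. r k y') - r k y * ln (\<Sum>k'\<in>K. r k' y))"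
    unfolding mi_def
  proof (intro sum.cong refl)
    fix k y assume ky: "k \<in> K" "y \<in> B"
    show "r k y * ln (r k y / ((\<Sum>y'\<in>B. r k y') * (\<Sum>k'\<in>K. r k' y)))
      = r k y * ln (r k y) - r k y * ln (\<Sum>y'\<in>B. r k y') - r k y * ln (\<Sum>k'\<in>K. r k' y)"
    proof (cases "r k y = 0")
      case False
      then have p: "r k y > 0" using assms(3)[OF ky] by simp
      then have "(\<Sum>y'\<in>B. r k y') > 0" "(\<Sum>k'\<in>K. r k' y) > 0"
        using ky assms by (auto intro!: sum_pos2)
      then show ?thesis using p by (simp add: ln_div ln_mult algebra_simps)
    qed simp
  qed
  also have "\<dots> = (\<Sum>k\<in>K. \<Sum>y\<in>B. r k y * ln (r k y)) - (\<Sum>k\<in>K. \<Sum>y\<in>B. r k y * ln (\<Sum>y'\<in>B. r k y'))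
      - (\<Sum>y\<in>B. \<Sum>k\<in>K. r k y * ln (\<Sum>k'\<in>K. r k' y))"
    unfolding sum_subtractf by (subst sum.swap[of _ B]) simp
  finally show ?thesis by (simp add: eta_def sum_negf flip: sum_distrib_right)
qed

text \<open>Either output keeps the mass of each \<open>\<mu> k\<close>, so the entropy of the index
  is the same in both terms and cancels; only output entropies survive.\<close>

lemma mi_diff_eq_ediff:
  assumes "stochastic_on A B W" "stochastic_on A C V" "finite A" "finite B" "finite C" "finite K"
    and nn: "\<And>k x. k \<in> K \<Longrightarrow> x \<in> A \<Longrightarrow> \<mu> k x \<ge> 0"
  shows "mi K B (\<lambda>k y. \<Sum>x\<in>A. \<mu> k x * pmf (W x) y) - mi K C (\<lambda>k z. \<Sum>x\<in>A. \<mu> k x * pmf (V x) z)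
    = (\<Sum>k\<in>K. ediff A B C W V (\<mu> k)) - ediff A B C W V (\<lambda>x. \<Sum>k\<in>K. \<mu> k x)"
proof -
  have sw: "(\<Sum>k\<in>K. \<Sum>x\<in>A. \<mu> k x * pmf (M x) y) = (\<Sum>x\<in>A. (\<Sum>k\<in>K. \<mu> k x) * pmf (M x) y)" for M :: "_ \<Rightarrow> 'out pmf" and y
    unfolding sum_distrib_right by (rule sum.swap)
  show ?thesis
    using assms
    by (subst (1 2) mi_eq_eta) (auto intro!: sum_nonneg simp: sw output_mass ediff_def sum_subtractf)
qed

lemma pmf_map_eq_sum:
  assumes "finite S" "set_pmf p \<subseteq> S"
  shows "pmf (map_pmf f p) y = (\<Sum>x\<in>S. if f x = y then pmf p x else 0)"
proof -
  have "pmf (map_pmf f p) y = measure_pmf.prob p (f -` {y})"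
    by (simp add: pmf_map)
  also have "\<dots> = measure_pmf.prob p (f -` {y} \<inter> S)"
    using assms by (intro measure_prob_cong_0) (auto simp: pmf_eq_0_set_pmf)
  also have "\<dots> = (\<Sum>x\<in>f -` {y} \<inter> S. pmf p x)"
    using assms by (intro measure_measure_pmf_finite) auto
  also have "\<dots> = (\<Sum>x\<in>S. if f x = y then pmf p x else 0)"
    using assms by (simp add: sum.inter_filter[symmetric] vimage_def Int_def conj_commute)
  finally show ?thesis .
qed

text \<open>The bridge from the measure-theoretic notion to finite sums. \<open>K\<close> and
  \<open>B\<close> may exceed the support, since the added terms have weight zero.\<close>

lemma mutual_info_eq_mi:
  fixes X :: "'w \<Rightarrow> 'x::countable" and Y :: "'w \<Rightarrow> 'y::countable"
  assumes "finite K" "finite B"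
    and sub: "set_pmf (map_pmf (\<lambda>w. (X w, Y w)) P) \<subseteq> K \<times> B"
    and r: "\<And>k y. k \<in> K \<Longrightarrow> y \<in> B \<Longrightarrow> pmf (map_pmf (\<lambda>w. (X w, Y w)) P) (k, y) = r k y"
  shows "mutual_info P X Y * ln 2 = mi K B r"
proof -
  let ?Q = "map_pmf (\<lambda>w. (X w, Y w)) P"
  have fin: "finite (set_pmf ?Q)" using assms finite_subset by blast
  have X: "pmf (map_pmf X P) k = (\<Sum>y\<in>B. r k y)" if "k \<in> K" for k
  proof -
    have "map_pmf X P = map_pmf fst ?Q" by (simp add: map_pmf_comp)
    also have "pmf \<dots> k = (\<Sum>z\<in>K \<times> B. if fst z = k then pmf ?Q z else 0)"
      using assms by (intro pmf_map_eq_sum) auto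
    also have "\<dots> = (\<Sum>k'\<in>K. \<Sum>y\<in>B. if k' = k then pmf ?Q (k', y) else 0)"
      unfolding sum.cartesian_product case_prod_unfold by (simp only: prod.collapse)
    also have "\<dots> = (\<Sum>k'\<in>K. if k' = k then (\<Sum>y\<in>B. pmf ?Q (k', y)) else 0)"
      by (intro sum.cong) auto
    also have "\<dots> = (\<Sum>y\<in>B. pmf ?Q (k, y))" using assms that by simp
    finally show ?thesis using r that by simp
  qed
  have Y: "pmf (map_pmf Y P) y = (\<Sum>k\<in>K. r k y)" if "y \<in> B" for y
  proof -
    have "map_pmf Y P = map_pmf snd ?Q" by (simp add: map_pmf_comp)
    also have "pmf \<dots> y = (\<Sum>z\<in>K \<times> B. if snd z = y then pmf ?Q z else 0)"
      using assms by (intro pmf_map_eq_sum) auto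
    also have "\<dots> = (\<Sum>k\<in>K. \<Sum>y'\<in>B. if y' = y then pmf ?Q (k, y') else 0)"
      unfolding sum.cartesian_product case_prod_unfold by (simp only: prod.collapse)
    also have "\<dots> = (\<Sum>k\<in>K. pmf ?Q (k, y))" using assms that by simp
    finally show ?thesis using r that by simp
  qed
  have "mutual_info P X Y * ln 2 = (\<Sum>z\<in>set_pmf ?Q. pmf ?Q z * ln (pmf ?Q z / (pmf (map_pmf X P) (fst z) * pmf (map_pmf Y P) (snd z))))"
    by (simp add: mutual_info_eq_sum[OF fin] log_def sum_distrib_right case_prod_unfold)
  also have "\<dots> = (\<Sum>z\<in>K \<times> B. pmf ?Q z * ln (pmf ?Q z / (pmf (map_pmf X P) (fst z) * pmf (map_pmf Y P) (snd z))))"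
    using assms by (intro sum.mono_neutral_left) (auto simp: pmf_eq_0_set_pmf)
  also have "\<dots> = (\<Sum>k\<in>K. \<Sum>y\<in>B. pmf ?Q (k, y) * ln (pmf ?Q (k, y) / (pmf (map_pmf X P) k * pmf (map_pmf Y P) y)))"
    by (simp add: sum.cartesian_product case_prod_unfold)
  also have "\<dots> = mi K B r"
    unfolding mi_def by (intro sum.cong refl) (simp add: r X Y)
  finally show ?thesis .
qed

text \<open>Pointwise, p - q <= p ln (p / q) by ln x <= x - 1. Only total masses are compared, so
  \<open>q\<close> may be a subprobability, as with the test posterior in Fano's inequality.\<close>

lemma gibbs:
  assumes "finite S" "\<And>x. x \<in> S \<Longrightarrow> p x \<ge> 0" "\<And>x. x \<in> S \<Longrightarrow> q x \<ge> 0"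
    and "\<And>x. x \<in> S \<Longrightarrow> p x > 0 \<Longrightarrow> q x > 0" "sum q S \<le> sum p S"
  shows "(\<Sum>x\<in>S. p x * ln (p x / q x)) \<ge> (0::real)"
proof -
  have "p x - q x \<le> p x * ln (p x / q x)" if "x \<in> S" for x
  proof (cases "p x > 0")
    case True
    then have q: "q x > 0" using assms that by blast
    then have "ln (q x / p x) \<le> q x / p x - 1" using True by (intro ln_le_minus_one) auto
    then have "p x * ln (q x / p x) \<le> p x * (q x / p x - 1)" using True by (intro mult_left_mono) auto
    then show ?thesis using True q by (simp add: ln_div algebra_simps)
  next
    case False
    then have "p x = 0" using assms(2)[OF that] by simp
    then show ?thesis using assms(3)[OF that] by simp
  qed
  then have "(\<Sum>x\<in>S. p x - q x) \<le> (\<Sum>x\<in>S. p x * ln (p x / q x))" by (rule sum_mono)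
  then show ?thesis using assms(5) by (simp add: sum_subtractf)
qed

section \<open>The single-letter expression\<close>

lemma sum_UNIV_prod:
  fixes f :: "'p::finite \<times> 'q::finite \<Rightarrow> real"
  shows "(\<Sum>w\<in>UNIV. f w) = (\<Sum>a\<in>UNIV. \<Sum>b\<in>UNIV. f (a, b))"
  by (simp add: sum.cartesian_product)

lemma sum_if_const: "(\<Sum>x\<in>S. if b then f x else 0) = (if b then \<Sum>x\<in>S. f x else (0::real))"
  by simp

lemma if_conj: "(if a \<and> b then x else y) = (if a then if b then x else y else y)"
  by simp

lemma pmf_map_finite:
  fixes p :: "'x::finite pmf"
  shows "pmf (map_pmf f p) y = (\<Sum>x\<in>UNIV. if f x = y then pmf p x else 0)"
  by (rule pmf_map_eq_sum) auto

lemmas marginal_simps = pmf_map_finite sum_UNIV_prod if_conj sum_if_const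

text \<open>The coupling of the two outputs is unknown, but each output paired with \<open>U\<close>
  is determined: in the Markov identity, sum out the other output and cancel the input
  weight.\<close>

lemma wiretap_laws_joint:
  fixes P :: "('a::finite \<times> 'a \<times> 'b::finite \<times> 'c::finite) pmf"
  assumes "P \<in> wiretap_laws W V"
  defines "\<mu> \<equiv> \<lambda>u x. pmf (map_pmf (\<lambda>(u, x, y, z). (u, x)) P) (u, x)"
  shows "pmf (map_pmf (\<lambda>(u, x, y, z). (u, y)) P) (u, y) = (\<Sum>x\<in>UNIV. \<mu> u x * pmf (W x) y)"
    and "pmf (map_pmf (\<lambda>(u, x, y, z). (u, z)) P) (u, z) = (\<Sum>x\<in>UNIV. \<mu> u x * pmf (V x) z)"
proof -
  define p where "p u x y z = pmf P (u, x, y, z)" for u x y z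
  have pn: "p u x y z \<ge> 0" for u x y z by (simp add: p_def)
  define px where "px x = (\<Sum>u\<in>UNIV. \<Sum>y\<in>UNIV. \<Sum>z\<in>UNIV. p u x y z)" for x
  have \<mu>: "\<mu> u x = (\<Sum>y\<in>UNIV. \<Sum>z\<in>UNIV. p u x y z)" for u x
    by (simp add: \<mu>_def marginal_simps p_def)
  have markov: "p u x y z * px x = \<mu> u x * (\<Sum>u\<in>UNIV. p u x y z)" for u x y z
  proof -
    have "markov_chain P" using assms(1) by (simp add: wiretap_laws_def)
    then have "pmf P (u, x, (y, z)) * pmf (map_pmf (\<lambda>(a, b, c). b) P) x =
        pmf (map_pmf (\<lambda>(a, b, c). (a, b)) P) (u, x) * pmf (map_pmf (\<lambda>(a, b, c). (b, c)) P) (x, (y, z))"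
      unfolding markov_chain_def by blast
    then show ?thesis
      by (simp add: \<mu> px_def marginal_simps p_def)
  qed
  have outW: "(\<Sum>u\<in>UNIV. \<Sum>z\<in>UNIV. p u x y z) = px x * pmf (W x) y" for x y
  proof -
    have "channel_output (map_pmf (\<lambda>(u, x, y, z). (x, y)) P) W" using assms(1) by (simp add: wiretap_laws_def)
    then have "pmf (map_pmf (\<lambda>(u, x, y, z). (x, y)) P) (x, y) =
      pmf (map_pmf fst (map_pmf (\<lambda>(u, x, y, z). (x, y)) P)) x * pmf (W x) y"
      unfolding channel_output_def by blast
    then show ?thesis
      by (simp add: map_pmf_comp case_prod_unfold marginal_simps p_def px_def)
  qed
  have outV: "(\<Sum>u\<in>UNIV. \<Sum>y\<in>UNIV. p u x y z) = px x * pmf (V x) z" for x z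
  proof -
    have "channel_output (map_pmf (\<lambda>(u, x, y, z). (x, z)) P) V" using assms(1) by (simp add: wiretap_laws_def)
    then have "pmf (map_pmf (\<lambda>(u, x, y, z). (x, z)) P) (x, z) =
      pmf (map_pmf fst (map_pmf (\<lambda>(u, x, y, z). (x, z)) P)) x * pmf (V x) z"
      unfolding channel_output_def by blast
    then show ?thesis
      by (simp add: map_pmf_comp case_prod_unfold marginal_simps p_def px_def)
  qed
  \<comment> \<open>An input of weight zero cannot be cancelled; there all entries vanish, and so do
    both sides of \<open>keyW\<close> and \<open>keyV\<close>.\<close>
  have px0: "p u x y z = 0" if "px x = 0" for u x y z
  proof -
    have "p u x y z \<le> (\<Sum>z\<in>UNIV. p u x y z)" by (rule member_le_sum) (auto simp: pn)
    also have "\<dots> \<le> (\<Sum>y\<in>UNIV. \<Sum>z\<in>UNIV. p u x y z)"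
      by (rule member_le_sum[of y UNIV "\<lambda>y. \<Sum>z\<in>UNIV. p u x y z"]) (auto intro!: sum_nonneg pn)
    also have "\<dots> \<le> px x" unfolding px_def
      by (rule member_le_sum[of u UNIV "\<lambda>u. \<Sum>y\<in>UNIV. \<Sum>z\<in>UNIV. p u x y z"]) (auto intro!: sum_nonneg pn)
    finally show ?thesis using that pn[of u x y z] by simp
  qed
  have keyW: "(\<Sum>z\<in>UNIV. p u x y z) = \<mu> u x * pmf (W x) y" for u x y
  proof (cases "px x = 0")
    case False
    have "(\<Sum>z\<in>UNIV. p u x y z) * px x = \<mu> u x * (\<Sum>z\<in>UNIV. \<Sum>u\<in>UNIV. p u x y z)"
      by (simp add: sum_distrib_right sum_distrib_left markov)
    also have "\<dots> = \<mu> u x * (px x * pmf (W x) y)"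
      by (subst sum.swap) (simp add: outW)
    finally show ?thesis using False by simp
  qed (simp add: px0 \<mu>)
  have keyV: "(\<Sum>y\<in>UNIV. p u x y z) = \<mu> u x * pmf (V x) z" for u x z
  proof (cases "px x = 0")
    case False
    have "(\<Sum>y\<in>UNIV. p u x y z) * px x = \<mu> u x * (\<Sum>y\<in>UNIV. \<Sum>u\<in>UNIV. p u x y z)"
      by (simp add: sum_distrib_right sum_distrib_left markov)
    also have "\<dots> = \<mu> u x * (px x * pmf (V x) z)"
      by (subst sum.swap) (simp add: outV)
    finally show ?thesis using False by simp
  qed (simp add: px0 \<mu>)
  show "pmf (map_pmf (\<lambda>(u, x, y, z). (u, y)) P) (u, y) = (\<Sum>x\<in>UNIV. \<mu> u x * pmf (W x) y)"
    by (simp add: marginal_simps flip: keyW p_def)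
  show "pmf (map_pmf (\<lambda>(u, x, y, z). (u, z)) P) (u, z) = (\<Sum>x\<in>UNIV. \<mu> u x * pmf (V x) z)"
    by (simp add: marginal_simps flip: keyV p_def)
qed

text \<open>A joint law of \<open>U\<close> and \<open>X\<close> is encoded as a real matrix in
  order to use the topology of Euclidean space.\<close>

definition joint_gap :: "('a::finite \<Rightarrow> 'b::finite pmf) \<Rightarrow> ('a \<Rightarrow> 'c::finite pmf) \<Rightarrow> real^'a^'a \<Rightarrow> real" where
  "joint_gap W V M = (\<Sum>u\<in>UNIV. ediff UNIV UNIV UNIV W V (\<lambda>x. M $ u $ x))
     - ediff UNIV UNIV UNIV W V (\<lambda>x. \<Sum>u\<in>UNIV. M $ u $ x)"

definition joint_laws :: "(real^'a::finite^'a) set" where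
  "joint_laws = {M. (\<forall>u x. M $ u $ x \<ge> 0) \<and> (\<Sum>u\<in>UNIV. \<Sum>x\<in>UNIV. M $ u $ x) = 1}"

lemma wiretap_value:
  fixes P :: "('a::finite \<times> 'a \<times> 'b::finite \<times> 'c::finite) pmf"
  assumes "P \<in> wiretap_laws W V"
  defines "\<mu> \<equiv> \<lambda>u x. pmf (map_pmf (\<lambda>(u, x, y, z). (u, x)) P) (u, x)"
  shows "mutual_info P (\<lambda>(u, x, y, z). u) (\<lambda>(u, x, y, z). y) * ln 2 =
      mi UNIV UNIV (\<lambda>u y. \<Sum>x\<in>UNIV. \<mu> u x * pmf (W x) y)" (is ?Y)
    and "mutual_info P (\<lambda>(u, x, y, z). u) (\<lambda>(u, x, y, z). z) * ln 2 =
      mi UNIV UNIV (\<lambda>u z. \<Sum>x\<in>UNIV. \<mu> u x * pmf (V x) z)" (is ?Z)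
proof -
  show ?Y using wiretap_laws_joint[OF assms(1)] unfolding \<mu>_def
    by (intro mutual_info_eq_mi) (auto simp: case_prod_unfold)
  show ?Z using wiretap_laws_joint[OF assms(1)] unfolding \<mu>_def
    by (intro mutual_info_eq_mi) (auto simp: case_prod_unfold)
qed

text \<open>The two outputs are taken conditionally independent given the input, which is one
  admissible coupling.\<close>

lemma wiretap_law_exists:
  fixes M :: "real^'a::finite^'a" and W :: "'a \<Rightarrow> 'b::finite pmf" and V :: "'a \<Rightarrow> 'c::finite pmf"
  assumes "M \<in> joint_laws"
  obtains P where "P \<in> wiretap_laws W V"
    and "\<And>u x. pmf (map_pmf (\<lambda>(u, x, y, z). (u, x)) P) (u, x) = M $ u $ x"
proof -
  have M: "M $ u $ x \<ge> 0" "(\<Sum>u\<in>UNIV. \<Sum>x\<in>UNIV. M $ u $ x) = 1" for u x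
    using assms by (auto simp: joint_laws_def)
  define f where "f = (\<lambda>(u, x, y, z). M $ u $ x * pmf (W x) y * pmf (V x) z)"
  have fn: "f w \<ge> 0" for w using M by (auto simp: f_def split: prod.split)
  have 1: "(\<Sum>z\<in>UNIV. pmf (V x) z) = 1" "(\<Sum>y\<in>UNIV. pmf (W x) y) = 1" for x
    by (auto intro!: sum_pmf_eq_1)
  have "(\<Sum>w\<in>UNIV. f w) = 1"
    by (simp add: sum_UNIV_prod f_def 1 M flip: sum_distrib_left)
  then have int: "(\<integral>\<^sup>+w. ennreal (f w) \<partial>count_space UNIV) = 1"
    using fn by (simp add: nn_integral_count_space_finite sum_ennreal)
  define P where "P = embed_pmf f"
  have P: "pmf P (u, x, y, z) = M $ u $ x * pmf (W x) y * pmf (V x) z" for u x y z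
    unfolding P_def using fn int by (subst pmf_embed_pmf) (auto simp: f_def)
  have ux: "pmf (map_pmf (\<lambda>(u, x, y, z). (u, x)) P) (u, x) = M $ u $ x" for u x
    by (simp add: marginal_simps P 1 flip: sum_distrib_left)
  have "P \<in> wiretap_laws W V"
    unfolding wiretap_laws_def
  proof (intro CollectI conjI)
    have "pmf P (u, x, y, z) * pmf (map_pmf (\<lambda>(a, b, c). b) P) x =
        pmf (map_pmf (\<lambda>(a, b, c). (a, b)) P) (u, x) * pmf (map_pmf (\<lambda>(a, b, c). (b, c)) P) (x, (y, z))" for u x y z
      by (simp add: marginal_simps P 1 flip: sum_distrib_left sum_distrib_right)
    then show "markov_chain P" by (auto simp: markov_chain_def)
    show "channel_output (map_pmf (\<lambda>(u, x, y, z). (x, y)) P) W"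
      by (simp add: channel_output_def map_pmf_comp case_prod_unfold marginal_simps P 1 flip: sum_distrib_left sum_distrib_right)
    have "(\<Sum>y\<in>UNIV. M $ u $ x * pmf (W x) y * pmf (V x) z) = M $ u $ x * pmf (V x) z" for u x z
      by (simp add: 1 flip: sum_distrib_left sum_distrib_right)
    then show "channel_output (map_pmf (\<lambda>(u, x, y, z). (x, z)) P) V"
      by (simp add: channel_output_def map_pmf_comp case_prod_unfold marginal_simps P 1 flip: sum_distrib_left sum_distrib_right)
  qed
  then show thesis using that ux by blast
qed

text \<open>A value depends on the law only through its marginal on \<open>U\<close> and
  \<open>X\<close>, and every such marginal occurs. This exhibits the values as a continuous image
  of a compact set.\<close>

lemma secrecy_values_eq:
  fixes W :: "'a::finite \<Rightarrow> 'b::finite pmf" and V :: "'a \<Rightarrow> 'c::finite pmf"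
  shows "secrecy_values W V = (\<lambda>M. joint_gap W V M / ln 2) ` joint_laws"
proof -
  have val: "mutual_info P (\<lambda>(u, x, y, z). u) (\<lambda>(u, x, y, z). y)
        - mutual_info P (\<lambda>(u, x, y, z). u) (\<lambda>(u, x, y, z). z) = joint_gap W V M / ln 2"
    if P: "P \<in> wiretap_laws W V"
      and M: "\<And>u x. pmf (map_pmf (\<lambda>(u, x, y, z). (u, x)) P) (u, x) = M $ u $ x"
    for P and M :: "real^'a^'a"
  proof -
    have Mn: "M $ u $ x \<ge> 0" for u x by (simp flip: M)
    show ?thesis
      using wiretap_value[OF P] mi_diff_eq_ediff[of UNIV UNIV W UNIV V UNIV "\<lambda>u x. M $ u $ x"] Mn
      by (simp add: M joint_gap_def stochastic_on_UNIV field_simps)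
  qed
  show ?thesis
  proof (intro equalityI subsetI)
    fix v assume "v \<in> secrecy_values W V"
    then obtain P where P: "P \<in> wiretap_laws W V"
      and v: "v = mutual_info P (\<lambda>(u, x, y, z). u) (\<lambda>(u, x, y, z). y)
        - mutual_info P (\<lambda>(u, x, y, z). u) (\<lambda>(u, x, y, z). z)"
      by (auto simp: secrecy_values_def)
    define M :: "real^'a^'a" where "M = (\<chi> u x. pmf (map_pmf (\<lambda>(u, x, y, z). (u, x)) P) (u, x))"
    have "(\<Sum>w\<in>UNIV. pmf (map_pmf (\<lambda>(u, x, y, z). (u, x)) P) w) = 1"
      by (intro sum_pmf_eq_1) auto
    then have "M \<in> joint_laws"
      by (simp add: joint_laws_def M_def sum_UNIV_prod)
    moreover have "v = joint_gap W V M / ln 2"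
      using val[OF P] v by (simp add: M_def)
    ultimately show "v \<in> (\<lambda>M. joint_gap W V M / ln 2) ` joint_laws" by blast
  next
    fix v assume "v \<in> (\<lambda>M. joint_gap W V M / ln 2) ` joint_laws"
    then obtain M :: "real^'a^'a" where M: "M \<in> joint_laws" "v = joint_gap W V M / ln 2" by blast
    obtain P where "P \<in> wiretap_laws W V"
      "\<And>u x. pmf (map_pmf (\<lambda>(u, x, y, z). (u, x)) P) (u, x) = M $ u $ x"
      using wiretap_law_exists[OF M(1)] by blast
    then show "v \<in> secrecy_values W V" using val[of P M] M unfolding secrecy_values_def by force
  qed
qed

section \<open>Compactness of the joint laws and attainment of the maximum\<close>

lemma compact_joint_laws: "compact (joint_laws :: (real^'a::finite^'a) set)"
proof -
  have "closed (joint_laws :: (real^'a^'a) set)"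
    unfolding joint_laws_def Collect_conj_eq Collect_all_eq
    by (intro closed_Int closed_INT ballI closed_Collect_le closed_Collect_eq continuous_intros)
  moreover have "bounded (joint_laws :: (real^'a^'a) set)"
  proof (rule boundedI)
    fix M :: "real^'a^'a" assume M: "M \<in> joint_laws"
    have "norm M \<le> (\<Sum>u\<in>UNIV. norm (M $ u))" by (simp add: norm_vec_def L2_set_le_sum)
    also have "\<dots> \<le> (\<Sum>u\<in>UNIV. \<Sum>x\<in>UNIV. \<bar>M $ u $ x\<bar>)" by (intro sum_mono norm_le_l1_cart)
    also have "\<dots> = 1" using M by (simp add: joint_laws_def)
    finally show "norm M \<le> 1" .
  qed
  ultimately show ?thesis by (simp add: compact_eq_bounded_closed)
qed

lemma continuous_on_joint_gap: "continuous_on joint_laws (joint_gap W V)"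
  unfolding joint_gap_def ediff_def
  by (intro continuous_intros continuous_on_compose2[OF continuous_on_eta])
     (auto intro!: sum_nonneg mult_nonneg_nonneg simp: joint_laws_def)

lemma joint_laws_nonempty: "(joint_laws :: (real^'a::finite^'a) set) \<noteq> {}"
proof -
  have "(\<chi> u x. 1 / (real CARD('a) * real CARD('a))) \<in> (joint_laws :: (real^'a^'a) set)"
    by (simp add: joint_laws_def)
  then show ?thesis by blast
qed

lemma secrecy_values_attained:
  "\<exists>m\<in>secrecy_values W V. \<forall>v\<in>secrecy_values W V. v \<le> m"
proof -
  have "continuous_on joint_laws (\<lambda>M. joint_gap W V M / ln 2)"
    by (intro continuous_intros continuous_on_joint_gap) auto
  from continuous_attains_sup[OF compact_joint_laws joint_laws_nonempty this]
  show ?thesis unfolding secrecy_values_eq by auto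
qed

section \<open>Gaps of arbitrary finite families against the single-letter maximum\<close>

text \<open>For \<open>F\<close> = \<open>ediff\<close> the left-hand side is a difference of mutual
  informations. A bound per unit of mass, valid for all finite families, can be applied to the
  conditional families that arise letter by letter.\<close>

definition gap_bound :: "'x set \<Rightarrow> (('x \<Rightarrow> real) \<Rightarrow> real) \<Rightarrow> real \<Rightarrow> bool" where
  "gap_bound A F c \<longleftrightarrow> (\<forall>(K :: nat set) \<mu>. finite K \<longrightarrow> (\<forall>k\<in>K. \<forall>x\<in>A. \<mu> k x \<ge> 0) \<longrightarrow>
     (\<Sum>k\<in>K. F (\<mu> k)) - F (\<lambda>x. \<Sum>k\<in>K. \<mu> k x) \<le> c * (\<Sum>k\<in>K. \<Sum>x\<in>A. \<mu> k x))"

lemma gap_boundD: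
  assumes "gap_bound A F c" "finite (K :: nat set)" "\<And>k x. k \<in> K \<Longrightarrow> x \<in> A \<Longrightarrow> \<mu> k x \<ge> 0"
  shows "(\<Sum>k\<in>K. F (\<mu> k)) - F (\<lambda>x. \<Sum>k\<in>K. \<mu> k x) \<le> c * (\<Sum>k\<in>K. \<Sum>x\<in>A. \<mu> k x)"
  using assms unfolding gap_bound_def by blast

text \<open>More vectors than the dimension are dependent, but dependence of the image set forgets
  multiplicities. Two equal members are therefore treated apart: their difference is the
  relation.\<close>

lemma linear_relation:
  fixes \<mu> :: "'k \<Rightarrow> 'a::finite \<Rightarrow> real"
  assumes "finite K" "card K > CARD('a)"
  obtains c where "\<exists>k\<in>K. c k \<noteq> 0" "\<And>x. (\<Sum>k\<in>K. c k * \<mu> k x) = 0"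
proof -
  define v :: "'k \<Rightarrow> real^'a" where "v k = (\<chi> x. \<mu> k x)" for k
  show thesis
  proof (cases "inj_on v K")
    case True
    then have "card (v ` K) > DIM(real^'a)" using assms by (simp add: card_image)
    then have "dependent (v ` K)" using assms by (intro dependent_biggerset) auto
    then obtain u where u: "\<exists>w\<in>v ` K. u w \<noteq> 0" "(\<Sum>w\<in>v ` K. u w *\<^sub>R w) = 0"
      using assms by (subst (asm) dependent_finite) auto
    have "(\<Sum>k\<in>K. u (v k) *\<^sub>R v k) = 0" using u(2) True by (simp add: sum.reindex)
    then have "(\<Sum>k\<in>K. u (v k) *\<^sub>R v k) $ x = 0" for x by simp
    then have "(\<Sum>k\<in>K. u (v k) * \<mu> k x) = 0" for x by (simp add: v_def)
    then show thesis using that[of "u \<circ> v"] u(1) by auto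
  next
    case False
    then obtain a b where ab: "a \<in> K" "b \<in> K" "a \<noteq> b" "v a = v b" by (auto simp: inj_on_def)
    then have eq: "\<mu> a x = \<mu> b x" for x by (simp add: v_def vec_eq_iff)
    define c :: "'k \<Rightarrow> real" where "c k = (if k = a then 1 else 0) - (if k = b then 1 else 0)" for k
    have "(\<Sum>k\<in>K. c k * \<mu> k x) = 0" for x
    proof -
      have "(\<Sum>k\<in>K. c k * \<mu> k x) = (\<Sum>k\<in>K. if k = a then \<mu> k x else 0) - (\<Sum>k\<in>K. if k = b then \<mu> k x else 0)"
        unfolding sum_subtractf[symmetric] by (intro sum.cong) (auto simp: c_def)
      then show ?thesis using ab assms(1) eq by simp
    qed
    moreover have "\<exists>k\<in>K. c k \<noteq> 0" using ab by (auto simp: c_def)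
    ultimately show thesis using that by blast
  qed
qed

text \<open>A Caratheodory argument: as long as there are more than \<open>CARD('a)\<close> measures, rescaling
  them along a linear relation preserves their sum, does not decrease the sum of the
  values of \<open>F\<close>, and kills one of them.\<close>

lemma reduce_family:
  fixes \<mu> :: "'k \<Rightarrow> 'a::finite \<Rightarrow> real"
  assumes "finite K"
    and F: "\<And>c \<nu>. c \<ge> 0 \<Longrightarrow> (\<And>x. \<nu> x \<ge> 0) \<Longrightarrow> F (\<lambda>x. c * \<nu> x) = c * F \<nu>"
    and "\<And>k x. k \<in> K \<Longrightarrow> \<mu> k x \<ge> 0"
  shows "\<exists>(K' :: 'k set) \<nu>. finite K' \<and> card K' \<le> CARD('a) \<and> (\<forall>k\<in>K'. \<forall>x. \<nu> k x \<ge> 0) \<and>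
    (\<forall>x. (\<Sum>k\<in>K'. \<nu> k x) = (\<Sum>k\<in>K. \<mu> k x)) \<and> (\<Sum>k\<in>K. F (\<mu> k)) \<le> (\<Sum>k\<in>K'. F (\<nu> k :: 'a \<Rightarrow> real) :: real)"
  using assms(1,3)
proof (induction "card K" arbitrary: K \<mu> rule: less_induct)
  case less
  have F0: "F (\<lambda>x. 0) = 0" using F[of 0 "\<lambda>x. 0"] by simp
  \<comment> \<open>Zero measures are removed separately, so that in the third case all members are
    nonzero and nonnegative, which forces a relation to have mixed signs.\<close>
  consider "card K \<le> CARD('a)" | k0 where "k0 \<in> K" "\<And>x. \<mu> k0 x = 0"
    | "card K > CARD('a)" "\<And>k. k \<in> K \<Longrightarrow> \<exists>x. \<mu> k x \<noteq> 0" using not_le_imp_less by blast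
  then show ?case
  proof cases
    case 1
    then show ?thesis using less.prems by (intro exI[of _ K] exI[of _ \<mu>]) simp
  next
    case 2
    have "card (K - {k0}) < card K" using 2 less.prems by (intro psubset_card_mono) auto
    moreover have "\<mu> k0 = (\<lambda>x. 0)" using 2 by auto
    ultimately have "(\<Sum>k\<in>K. F (\<mu> k)) = (\<Sum>k\<in>K - {k0}. F (\<mu> k))"
      "(\<Sum>k\<in>K - {k0}. \<mu> k x) = (\<Sum>k\<in>K. \<mu> k x)" for x
      using less.prems(1) 2 by (simp_all add: sum_diff1 F0)
    moreover have "\<exists>(K' :: 'k set) \<nu>. finite K' \<and> card K' \<le> CARD('a) \<and> (\<forall>k\<in>K'. \<forall>x. \<nu> k x \<ge> 0) \<and>
      (\<forall>x. (\<Sum>k\<in>K'. \<nu> k x) = (\<Sum>k\<in>K - {k0}. \<mu> k x)) \<and> (\<Sum>k\<in>K - {k0}. F (\<mu> k)) \<le> (\<Sum>k\<in>K'. F (\<nu> k))"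
      using less.prems by (intro less.hyps \<open>card (K - {k0}) < card K\<close>) auto
    ultimately show ?thesis by simp
  next
    case 3
    obtain c0 where c0: "\<exists>k\<in>K. c0 k \<noteq> 0" "\<And>x. (\<Sum>k\<in>K. c0 k * \<mu> k x) = 0"
      using linear_relation[OF less.prems(1) 3(1), of \<mu>] by blast
    \<comment> \<open>A relation may be negated; the sign is chosen so that moving along it does not
      lower the sum of the values of \<open>F\<close>.\<close>
    obtain c where c: "\<exists>k\<in>K. c k \<noteq> 0" "\<And>x. (\<Sum>k\<in>K. c k * \<mu> k x) = 0" "(\<Sum>k\<in>K. c k * F (\<mu> k)) \<ge> 0"
    proof (cases "(\<Sum>k\<in>K. c0 k * F (\<mu> k)) \<ge> 0")
      case True
      then show thesis using that[of c0] c0 by blast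
    next
      case False
      then show thesis using that[of "\<lambda>k. - c0 k"] c0 by (simp add: sum_negf)
    qed
    define N where "N = {k\<in>K. c k < 0}"
    have "N \<noteq> {}"
    proof
      assume "N = {}"
      then have cn: "c k \<ge> 0" if "k \<in> K" for k using that by (force simp: N_def not_less)
      obtain k where k: "k \<in> K" "c k > 0" using c(1) cn by (metis less_eq_real_def)
      obtain x where "\<mu> k x > 0" using 3(2)[OF k(1)] less.prems(2)[OF k(1)] by (metis less_eq_real_def)
      then have "(\<Sum>k\<in>K. c k * \<mu> k x) > 0"
        using k cn less.prems by (intro sum_pos2[of K k]) auto
      then show False using c(2) by simp
    qed
    have finN: "finite N" using less.prems by (simp add: N_def)
    \<comment> \<open>The largest step for which all factors \<open>1 + \<tau> * c k\<close> stay
      nonnegative; it is reached at some \<open>k0\<close>, whose measure becomes zero.\<close>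
    define \<tau> where "\<tau> = (MIN k\<in>N. 1 / (- c k))"
    have "\<tau> \<in> (\<lambda>k. 1 / (- c k)) ` N"
      unfolding \<tau>_def using finN \<open>N \<noteq> {}\<close> by (intro Min_in) auto
    then obtain k0 where k0: "k0 \<in> N" "\<tau> = 1 / (- c k0)" by blast
    have \<tau>: "\<tau> > 0" using k0 by (simp add: N_def)
    have nn: "1 + \<tau> * c k \<ge> 0" if "k \<in> K" for k
    proof (cases "k \<in> N")
      case True
      then have "\<tau> \<le> 1 / (- c k)" unfolding \<tau>_def using finN by (intro Min_le) auto
      then show ?thesis using True by (simp add: N_def field_simps)
    next
      case False
      then have "c k \<ge> 0" using that by (simp add: N_def)
      then show ?thesis using \<tau> by simp
    qed
    have k0K: "k0 \<in> K" using k0 by (simp add: N_def)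
    have z: "1 + \<tau> * c k0 = 0" using k0 by (simp add: N_def)
    define \<nu> where "\<nu> k x = (1 + \<tau> * c k) * \<mu> k x" for k x
    have F\<nu>: "F (\<nu> k) = (1 + \<tau> * c k) * F (\<mu> k)" if "k \<in> K" for k
      unfolding \<nu>_def using nn less.prems(2) that by (intro F) auto
    have s: "(\<Sum>k\<in>K. \<nu> k x) = (\<Sum>k\<in>K. \<mu> k x)" for x
      using c(2)[of x] by (simp add: \<nu>_def algebra_simps sum.distrib flip: sum_distrib_left)
    have "(\<Sum>k\<in>K. F (\<nu> k)) = (\<Sum>k\<in>K. F (\<mu> k)) + \<tau> * (\<Sum>k\<in>K. c k * F (\<mu> k))"
      by (simp add: F\<nu> algebra_simps sum.distrib flip: sum_distrib_left)
    then have Fge: "(\<Sum>k\<in>K. F (\<mu> k)) \<le> (\<Sum>k\<in>K. F (\<nu> k))" using c(3) \<tau> by simp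
    have lt: "card (K - {k0}) < card K" using k0K less.prems by (intro psubset_card_mono) auto
    have \<nu>0: "\<nu> k0 = (\<lambda>x. 0)" using z by (auto simp: \<nu>_def)
    have \<nu>n: "\<nu> k x \<ge> 0" if "k \<in> K - {k0}" for k x
      using nn[of k] less.prems(2)[of k x] that by (simp add: \<nu>_def)
    have "\<exists>(K' :: 'k set) \<nu>'. finite K' \<and> card K' \<le> CARD('a) \<and> (\<forall>k\<in>K'. \<forall>x. \<nu>' k x \<ge> 0) \<and>
      (\<forall>x. (\<Sum>k\<in>K'. \<nu>' k x) = (\<Sum>k\<in>K - {k0}. \<nu> k x)) \<and> (\<Sum>k\<in>K - {k0}. F (\<nu> k)) \<le> (\<Sum>k\<in>K'. F (\<nu>' k))"
      using less.prems(1) \<nu>n by (intro less.hyps lt) auto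
    moreover have "(\<Sum>k\<in>K - {k0}. \<nu> k x) = (\<Sum>k\<in>K. \<mu> k x)" for x
      using less.prems(1) k0K \<nu>0 s[of x] by (simp add: sum_diff1)
    moreover have "(\<Sum>k\<in>K - {k0}. F (\<nu> k)) = (\<Sum>k\<in>K. F (\<nu> k))"
      using less.prems(1) k0K \<nu>0 by (simp add: sum_diff1 F0)
    ultimately have "\<exists>(K' :: 'k set) \<nu>'. finite K' \<and> card K' \<le> CARD('a) \<and> (\<forall>k\<in>K'. \<forall>x. \<nu>' k x \<ge> 0) \<and>
      (\<forall>x. (\<Sum>k\<in>K'. \<nu>' k x) = (\<Sum>k\<in>K. \<mu> k x)) \<and> (\<Sum>k\<in>K. F (\<nu> k)) \<le> (\<Sum>k\<in>K'. F (\<nu>' k))"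
      by simp
    then obtain K' :: "'k set" and \<nu>' where "finite K'" "card K' \<le> CARD('a)" "\<forall>k\<in>K'. \<forall>x. \<nu>' k x \<ge> 0"
      "\<forall>x. (\<Sum>k\<in>K'. \<nu>' k x) = (\<Sum>k\<in>K. \<mu> k x)" "(\<Sum>k\<in>K. F (\<nu> k)) \<le> (\<Sum>k\<in>K'. F (\<nu>' k))"
      by (elim exE conjE)
    then show ?thesis using Fge by (intro exI[of _ K'] exI[of _ \<nu>']) simp
  qed
qed

lemma ediff_scale_UNIV:
  fixes W :: "'a::finite \<Rightarrow> 'b::finite pmf" and V :: "'a \<Rightarrow> 'c::finite pmf"
  assumes "c \<ge> 0" "\<And>x. \<mu> x \<ge> 0"
  shows "ediff UNIV UNIV UNIV W V (\<lambda>x. c * \<mu> x) = c * ediff UNIV UNIV UNIV W V \<mu>"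
  using assms by (intro ediff_scale) (auto simp: stochastic_on_UNIV)

text \<open>A thinned-out family has at most \<open>CARD('a)\<close> members, which can be labelled
  by values of \<open>U\<close>; division by the total mass turns it into a joint law.\<close>

lemma gap_bound_single_letter:
  fixes W :: "'a::finite \<Rightarrow> 'b::finite pmf" and V :: "'a \<Rightarrow> 'c::finite pmf"
  assumes m: "\<forall>v\<in>secrecy_values W V. v \<le> m"
  shows "gap_bound UNIV (ediff UNIV UNIV UNIV W V) (m * ln 2)"
  unfolding gap_bound_def
proof (intro allI impI)
  let ?F = "ediff UNIV UNIV UNIV W V"
  fix K :: "nat set" and \<mu> :: "nat \<Rightarrow> 'a \<Rightarrow> real"
  assume K: "finite K" and \<mu>: "\<forall>k\<in>K. \<forall>x\<in>UNIV. \<mu> k x \<ge> 0"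
  have "\<exists>(K' :: nat set) \<nu>. finite K' \<and> card K' \<le> CARD('a) \<and> (\<forall>k\<in>K'. \<forall>x. \<nu> k x \<ge> 0) \<and>
    (\<forall>x. (\<Sum>k\<in>K'. \<nu> k x) = (\<Sum>k\<in>K. \<mu> k x)) \<and> (\<Sum>k\<in>K. ?F (\<mu> k)) \<le> (\<Sum>k\<in>K'. ?F (\<nu> k))"
    using \<mu> by (intro reduce_family K ediff_scale_UNIV) auto
  then obtain K' :: "nat set" and \<nu> where K': "finite K'" "card K' \<le> CARD('a)"
    and \<nu>': "\<forall>k\<in>K'. \<forall>x. \<nu> k x \<ge> 0" and s': "\<forall>x. (\<Sum>k\<in>K'. \<nu> k x) = (\<Sum>k\<in>K. \<mu> k x)"
    and le: "(\<Sum>k\<in>K. ?F (\<mu> k)) \<le> (\<Sum>k\<in>K'. ?F (\<nu> k))"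
    by (elim exE conjE)
  have \<nu>: "\<nu> k x \<ge> 0" if "k \<in> K'" for k x using \<nu>' that by blast
  have s: "(\<Sum>k\<in>K'. \<nu> k x) = (\<Sum>k\<in>K. \<mu> k x)" for x using s' by blast
  obtain g :: "nat \<Rightarrow> 'a" where g: "inj_on g K'"
    using K' by (meson card_le_inj finite_class.finite_UNIV subset_UNIV)
  \<comment> \<open>Labels outside the image of \<open>g\<close> receive the zero measure, which
    adds neither mass nor a value of \<open>ediff\<close>.\<close>
  define \<rho> where "\<rho> u x = (\<Sum>k\<in>K'. if g k = u then \<nu> k x else 0)" for u x
  have \<rho>g: "\<rho> (g k) = \<nu> k" if "k \<in> K'" for k
  proof
    fix x
    have "\<rho> (g k) x = (\<Sum>k'\<in>K'. if k' = k then \<nu> k' x else 0)"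
      unfolding \<rho>_def using g that by (intro sum.cong) (auto simp: inj_on_def)
    then show "\<rho> (g k) x = \<nu> k x" using K' that by simp
  qed
  have \<rho>0: "\<rho> u = (\<lambda>x. 0)" if "u \<notin> g ` K'" for u
    using that by (auto simp: \<rho>_def fun_eq_iff intro!: sum.neutral)
  have \<rho>n: "\<rho> u x \<ge> 0" for u x using \<nu> by (auto simp: \<rho>_def intro!: sum_nonneg)
  have sum\<rho>: "(\<Sum>u\<in>UNIV. h (\<rho> u)) = (\<Sum>k\<in>K'. h (\<nu> k))" if "h (\<lambda>x. 0) = 0" for h :: "('a \<Rightarrow> real) \<Rightarrow> real"
  proof -
    have "(\<Sum>u\<in>UNIV. h (\<rho> u)) = (\<Sum>u\<in>g ` K'. h (\<rho> u))"
      using \<rho>0 that by (intro sum.mono_neutral_right) auto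
    then show ?thesis using g by (simp add: sum.reindex \<rho>g)
  qed
  define S where "S = (\<Sum>k\<in>K. \<Sum>x\<in>UNIV. \<mu> k x)"
  have S': "(\<Sum>u\<in>UNIV. \<Sum>x\<in>UNIV. \<rho> u x) = S"
  proof -
    have "(\<Sum>u\<in>UNIV. \<Sum>x\<in>UNIV. \<rho> u x) = (\<Sum>k\<in>K'. \<Sum>x\<in>UNIV. \<nu> k x)" by (rule sum\<rho>) simp
    also have "\<dots> = (\<Sum>x\<in>UNIV. \<Sum>k\<in>K'. \<nu> k x)" by (rule sum.swap)
    also have "\<dots> = S" unfolding s S_def by (rule sum.swap)
    finally show ?thesis .
  qed
  have F: "(\<Sum>u\<in>UNIV. ?F (\<rho> u)) = (\<Sum>k\<in>K'. ?F (\<nu> k))" by (rule sum\<rho>) simp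
  have out: "(\<lambda>x. \<Sum>u\<in>UNIV. \<rho> u x) = (\<lambda>x. \<Sum>k\<in>K. \<mu> k x)"
    using sum\<rho>[of "\<lambda>f. f _"] by (simp add: s)
  have "(\<Sum>u\<in>UNIV. ?F (\<rho> u)) - ?F (\<lambda>x. \<Sum>u\<in>UNIV. \<rho> u x) \<le> m * ln 2 * S"
  \<comment> \<open>Zero mass cannot be normalised, but then all measures vanish and both sides are
    zero.\<close>
  proof (cases "S = 0")
    case True
    then have "\<rho> u x = 0" for u x
      using S' \<rho>n by (simp add: sum_nonneg_eq_0_iff sum_nonneg)
    then have "\<rho> = (\<lambda>u x. 0)" by (simp add: fun_eq_iff)
    then show ?thesis using True by simp
  next
    case False
    moreover have "S \<ge> 0" unfolding S'[symmetric] using \<rho>n by (intro sum_nonneg)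
    ultimately have S: "S > 0" by simp
    define M :: "real^'a^'a" where "M = (\<chi> u x. 1 / S * \<rho> u x)"
    have "M \<in> joint_laws"
      using S S' \<rho>n by (simp add: joint_laws_def M_def flip: sum_divide_distrib)
    then have "joint_gap W V M / ln 2 \<le> m" using m by (auto simp: secrecy_values_eq)
    then have "joint_gap W V M \<le> m * ln 2" by (simp add: field_simps)
    moreover have "joint_gap W V M = 1 / S * ((\<Sum>u\<in>UNIV. ?F (\<rho> u)) - ?F (\<lambda>x. \<Sum>u\<in>UNIV. \<rho> u x))"
    proof -
      have "joint_gap W V M = (\<Sum>u\<in>UNIV. ?F (\<lambda>x. 1 / S * \<rho> u x)) - ?F (\<lambda>x. 1 / S * (\<Sum>u\<in>UNIV. \<rho> u x))"
        by (simp add: joint_gap_def M_def sum_divide_distrib)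
      also have "\<dots> = (\<Sum>u\<in>UNIV. 1 / S * ?F (\<rho> u)) - 1 / S * ?F (\<lambda>x. \<Sum>u\<in>UNIV. \<rho> u x)"
        using S \<rho>n by (subst (1 2) ediff_scale_UNIV) (auto intro!: sum_nonneg)
      finally show ?thesis by (simp add: right_diff_distrib sum_distrib_left)
    qed
    ultimately show ?thesis using S by (simp add: field_simps)
  qed
  then show "(\<Sum>k\<in>K. ?F (\<mu> k)) - ?F (\<lambda>x. \<Sum>k\<in>K. \<mu> k x) \<le> m * ln 2 * (\<Sum>k\<in>K. \<Sum>x\<in>UNIV. \<mu> k x)"
    using le F unfolding out S_def by simp
qed



section \<open>Words\<close>

lemma words_0 [simp]: "words 0 = {[]}"
  by (auto simp: words_def)

lemma finite_words [simp]: "finite (words n :: 'a::finite list set)"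
  using finite_lists_length_eq[of "UNIV :: 'a set" n] by (simp add: words_def)

lemma words_Suc: "words (Suc n) = (\<lambda>(a, w). a # w) ` (UNIV \<times> words n)"
  by (auto simp: words_def length_Suc_conv)

lemma sum_words_Suc:
  fixes f :: "'a::finite list \<Rightarrow> real"
  shows "(\<Sum>w\<in>words (Suc n). f w) = (\<Sum>a\<in>UNIV. \<Sum>w\<in>words n. f (a # w))"
proof -
  have "inj_on (\<lambda>(a :: 'a, w). a # w) (UNIV \<times> words n)" by (auto simp: inj_on_def)
  then show ?thesis
    by (simp add: words_Suc sum.reindex sum.cartesian_product case_prod_unfold)
qed

lemma pmf_memoryless_Cons:
  "pmf (memoryless W (x # xs)) (y # ys) = pmf (W x) y * pmf (memoryless W xs) ys"
proof -
  have "memoryless W (x # xs) = map_pmf (\<lambda>(a, b). a # b) (pair_pmf (W x) (memoryless W xs))"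
    by (simp add: pair_pmf_def map_bind_pmf)
  moreover have "inj (\<lambda>(a, b). a # b)" by (auto simp: inj_def)
  ultimately show ?thesis
    using pmf_map_inj'[of "\<lambda>(a, b). a # b" "pair_pmf (W x) (memoryless W xs)" "(y, ys)"]
    by (simp add: pmf_pair)
qed

lemma stochastic_on_memoryless:
  fixes W :: "'a \<Rightarrow> 'b::finite pmf"
  shows "stochastic_on (words n) (words n) (memoryless W)"
  unfolding stochastic_on_def
proof
  fix x :: "'a list" assume "x \<in> words n"
  then show "(\<Sum>y\<in>words n. pmf (memoryless W x) y) = 1"
    using set_pmf_memoryless[of W x] by (intro sum_pmf_eq_1 finite_words) (auto simp: words_def)
qed



section \<open>Converse\<close>

text \<open>Gibbs' inequality against the posterior that is half uniform on the messages and half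
  concentrated on the decoded message.\<close>

lemma fano:
  fixes r :: "nat \<Rightarrow> 'y \<Rightarrow> real"
  assumes J: "J \<ge> 1" and B: "finite B" and r: "\<And>j y. j \<in> {1..J} \<Longrightarrow> y \<in> B \<Longrightarrow> r j y \<ge> 0"
    and unif: "\<And>j. j \<in> {1..J} \<Longrightarrow> (\<Sum>y\<in>B. r j y) = 1 / real J"
    and err: "\<And>j. j \<in> {1..J} \<Longrightarrow> (\<Sum>y\<in>B - D j. r j y) \<le> e / real J"
    and D: "disjoint_family_on D {1..J}"
  shows "(1 - e) * ln (real J) - ln 2 \<le> mi {1..J} B r"
proof -
  let ?K = "{1..J}"
  define ry where "ry y = (\<Sum>j\<in>?K. r j y)" for y
  define Q where "Q j y = (if y \<in> D j then 1/2 else 0) + 1 / (2 * real J)" for j y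
  have Jp: "real J > 0" using J by simp
  have Qp: "Q j y > 0" for j y using Jp by (auto simp: Q_def intro!: add_nonneg_pos)
  have ryn: "ry y \<ge> 0" if "y \<in> B" for y using r that by (auto simp: ry_def intro!: sum_nonneg)
  have ryp: "ry y > 0" if "j \<in> ?K" "y \<in> B" "r j y > 0" for j y
    unfolding ry_def using r that by (intro sum_pos2[of ?K j]) auto
  \<comment> \<open>Disjoint decoding sets grant at most one message the extra weight 1/2; the
    uniform half adds exactly 1/2.\<close>
  have Q1: "(\<Sum>j\<in>?K. Q j y) \<le> 1" for y
  proof -
    have "(\<Sum>j\<in>?K. if y \<in> D j then 1/2 else (0::real)) \<le> 1/2"
    proof (cases "\<exists>i\<in>?K. y \<in> D i")
      case True
      then obtain i where i: "i \<in> ?K" "y \<in> D i" by blast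
      have "(\<Sum>j\<in>?K. if y \<in> D j then 1/2 else (0::real)) = (\<Sum>j\<in>?K. if j = i then 1/2 else 0)"
        using i disjoint_family_onD[OF D, of _ i] by (intro sum.cong) auto
      then show ?thesis using i by simp
    next
      case False
      then have "(\<Sum>j\<in>?K. if y \<in> D j then 1/2 else (0::real)) = 0" by (intro sum.neutral) auto
      then show ?thesis by simp
    qed
    then show ?thesis using Jp by (simp add: Q_def sum.distrib)
  qed
  have sq: "(\<Sum>(j, y)\<in>?K \<times> B. ry y * Q j y) \<le> (\<Sum>(j, y)\<in>?K \<times> B. r j y)"
  proof -
    have "(\<Sum>(j, y)\<in>?K \<times> B. ry y * Q j y) = (\<Sum>y\<in>B. ry y * (\<Sum>j\<in>?K. Q j y))"
      by (subst sum.cartesian_product[symmetric], subst sum.swap) (simp add: sum_distrib_left)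
    also have "\<dots> \<le> (\<Sum>y\<in>B. ry y * 1)" using Q1 ryn by (intro sum_mono mult_left_mono) auto
    also have "\<dots> = (\<Sum>(j, y)\<in>?K \<times> B. r j y)"
      by (subst sum.cartesian_product[symmetric], subst sum.swap) (simp add: ry_def)
    finally show ?thesis .
  qed
  have "0 \<le> (\<Sum>(j, y)\<in>?K \<times> B. r j y * ln (r j y / (ry y * Q j y)))"
  proof -
    have "0 \<le> (\<Sum>z\<in>?K \<times> B. (case z of (j, y) \<Rightarrow> r j y) * ln ((case z of (j, y) \<Rightarrow> r j y) / (case z of (j, y) \<Rightarrow> ry y * Q j y)))"
      by (rule gibbs) (use sq B r ryn ryp Qp less_imp_le[OF Qp] in \<open>auto\<close>)
    then show ?thesis by (simp add: case_prod_unfold)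
  qed
  also have "\<dots> = (\<Sum>j\<in>?K. \<Sum>y\<in>B. r j y * ln (r j y / (1 / real J * ry y)) - r j y * ln (real J * Q j y))"
    unfolding sum.cartesian_product
  proof (intro sum.cong refl, clarify)
    fix j y assume jy: "j \<in> ?K" "y \<in> B"
    show "r j y * ln (r j y / (ry y * Q j y)) = r j y * ln (r j y / (1 / real J * ry y)) - r j y * ln (real J * Q j y)"
    proof (cases "r j y = 0")
      case False
      then have p: "r j y > 0" using r jy by force
      with ryp[OF jy] Qp[of j y] Jp show ?thesis by (simp add: ln_div ln_mult algebra_simps)
    qed simp
  qed
  also have "\<dots> = mi ?K B r - (\<Sum>j\<in>?K. \<Sum>y\<in>B. r j y * ln (real J * Q j y))"
    by (simp add: mi_def unif ry_def sum_subtractf)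
  finally have 1: "(\<Sum>j\<in>?K. \<Sum>y\<in>B. r j y * ln (real J * Q j y)) \<le> mi ?K B r" by simp
  have lJ: "ln (real J) \<ge> 0" using J by simp
  \<comment> \<open>On the decoding set \<open>real J * Q j y\<close> is at least J / 2, off it
    equal to 1 / 2, so only the error mass forfeits ln J.\<close>
  have 2: "((1 - e) * ln (real J) - ln 2) / real J \<le> (\<Sum>y\<in>B. r j y * ln (real J * Q j y))" if j: "j \<in> ?K" for j
  proof -
    have "(\<Sum>y\<in>B. r j y * (ln (real J) - ln 2)) - (\<Sum>y\<in>B - D j. r j y * ln (real J))
      = (\<Sum>y\<in>B. r j y * (ln (real J) - ln 2)) - (\<Sum>y\<in>B. if y \<in> D j then 0 else r j y * ln (real J))"
      using B by (simp add: sum.If_cases set_diff_eq Int_def)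
    also have "\<dots> = (\<Sum>y\<in>B. r j y * ((if y \<in> D j then ln (real J) else 0) - ln 2))"
      by (simp add: sum_subtractf[symmetric] if_distrib algebra_simps cong: if_cong)
         (auto intro!: sum.cong simp: algebra_simps)
    also have "\<dots> \<le> (\<Sum>y\<in>B. r j y * ln (real J * Q j y))"
    proof (intro sum_mono mult_left_mono)
      fix y
      have "ln (real J / 2) \<le> ln (real J / 2 + 1 / 2)" using Jp by (intro ln_mono) auto
      then show "(if y \<in> D j then ln (real J) else 0) - ln 2 \<le> ln (real J * Q j y)"
        using Jp by (auto simp: Q_def distrib_left ln_div)
    qed (use r j in auto)
    finally have "(\<Sum>y\<in>B. r j y) * (ln (real J) - ln 2) - (\<Sum>y\<in>B - D j. r j y) * ln (real J)
       \<le> (\<Sum>y\<in>B. r j y * ln (real J * Q j y))" by (simp add: sum_distrib_right)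
    moreover have "(\<Sum>y\<in>B - D j. r j y) * ln (real J) \<le> e / real J * ln (real J)"
      using err[OF j] lJ by (intro mult_right_mono)
    ultimately show ?thesis using unif[OF j] Jp by (simp add: field_simps)
  qed
  have "(1 - e) * ln (real J) - ln 2 = (\<Sum>j\<in>?K. ((1 - e) * ln (real J) - ln 2) / real J)" using Jp by simp
  also have "\<dots> \<le> (\<Sum>j\<in>?K. \<Sum>y\<in>B. r j y * ln (real J * Q j y))" using 2 by (intro sum_mono)
  finally show ?thesis using 1 by simp
qed

text \<open>The mixed output, first letter through \<open>W\<close> and remainder through
  \<open>V\<close>, is added and subtracted: H(Z1,Z') - H(Y1,Y') = (H(Z1,Z') - H(Y1,Z')) + (H(Y1,Z')
  - H(Y1,Y')). The measures on the right are input laws jointly with a fixed output of the other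
  coordinates.\<close>

lemma ediff_words_Suc:
  fixes W :: "'a::finite \<Rightarrow> 'b::finite pmf" and V :: "'a \<Rightarrow> 'c::finite pmf"
  shows "ediff (words (Suc n)) (words (Suc n)) (words (Suc n)) (memoryless W) (memoryless V) \<mu> =
    (\<Sum>z\<in>words n. ediff UNIV UNIV UNIV W V (\<lambda>x. \<Sum>w\<in>words n. \<mu> (x # w) * pmf (memoryless V w) z)) +
    (\<Sum>y\<in>UNIV. ediff (words n) (words n) (words n) (memoryless W) (memoryless V)
       (\<lambda>w. \<Sum>x\<in>UNIV. \<mu> (x # w) * pmf (W x) y))"
proof -
  have 1: "(\<Sum>x\<in>UNIV. (\<Sum>w\<in>words n. \<mu> (x # w) * pmf (memoryless V w) z) * pmf (M x) y)
    = (\<Sum>x\<in>UNIV. \<Sum>w\<in>words n. \<mu> (x # w) * (pmf (M x) y * pmf (memoryless V w) z))" for z y and M :: "'a \<Rightarrow> 'out pmf"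
    by (simp add: sum_distrib_left sum_distrib_right mult_ac)
  have 2: "(\<Sum>w\<in>words n. (\<Sum>x\<in>UNIV. \<mu> (x # w) * pmf (W x) y) * pmf (M w) z)
    = (\<Sum>x\<in>UNIV. \<Sum>w\<in>words n. \<mu> (x # w) * (pmf (W x) y * pmf (M w) z))" for z y and M :: "'a list \<Rightarrow> 'out pmf"
    by (subst sum.swap) (simp add: sum_distrib_left sum_distrib_right mult_ac)
  show ?thesis
    unfolding ediff_def sum_words_Suc pmf_memoryless_Cons 1 2 sum_subtractf
    by (subst (1 4) sum.swap) simp
qed

text \<open>Each conditional family obeys the bound with its own mass, and these masses add up to
  the full mass because the channels are stochastic. So one letter contributes \<open>c\<close>
  times the mass, and the other letters follow by induction.\<close>

lemma gap_bound_memoryless: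
  fixes W :: "'a::finite \<Rightarrow> 'b::finite pmf" and V :: "'a \<Rightarrow> 'c::finite pmf"
  assumes "gap_bound UNIV (ediff UNIV UNIV UNIV W V) c"
  shows "gap_bound (words n) (ediff (words n) (words n) (words n) (memoryless W) (memoryless V)) (real n * c)"
proof (induction n)
  case 0
  have "ediff (words 0) (words 0) (words 0) (memoryless W) (memoryless V) \<mu> = 0" for \<mu>
    by (simp add: ediff_def)
  then show ?case by (simp add: gap_bound_def)
next
  case (Suc n)
  let ?F = "ediff UNIV UNIV UNIV W V"
  let ?G = "\<lambda>n. ediff (words n) (words n) (words n) (memoryless W) (memoryless V)"
  show ?case unfolding gap_bound_def
  proof (intro allI impI)
    fix K :: "nat set" and \<mu> :: "nat \<Rightarrow> 'a list \<Rightarrow> real"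
    assume K: "finite K" and \<mu>: "\<forall>k\<in>K. \<forall>x\<in>words (Suc n). \<mu> k x \<ge> 0"
    have \<mu>n: "\<mu> k (x # w) \<ge> 0" if "k \<in> K" "w \<in> words n" for k x w
      using \<mu> that by (auto simp: words_def)
    define \<alpha> where "\<alpha> z k x = (\<Sum>w\<in>words n. \<mu> k (x # w) * pmf (memoryless V w) z)" for z k x
    define \<beta> where "\<beta> y k w = (\<Sum>x\<in>UNIV. \<mu> k (x # w) * pmf (W x) y)" for y k w
    define S where "S = (\<Sum>k\<in>K. \<Sum>x\<in>words (Suc n). \<mu> k x)"
    have \<alpha>s: "(\<Sum>z\<in>words n. \<Sum>k\<in>K. \<Sum>x\<in>UNIV. \<alpha> z k x) = S"
    proof -
      have "(\<Sum>z\<in>words n. \<Sum>x\<in>UNIV. \<alpha> z k x) = (\<Sum>x\<in>words (Suc n). \<mu> k x)" for k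
        unfolding \<alpha>_def sum_words_Suc
        by (subst sum.swap) (simp add: output_mass stochastic_on_memoryless)
      then show ?thesis unfolding S_def by (subst sum.swap) simp
    qed
    have \<beta>s: "(\<Sum>y\<in>UNIV. \<Sum>k\<in>K. \<Sum>w\<in>words n. \<beta> y k w) = S"
    proof -
      have "(\<Sum>y\<in>UNIV. \<Sum>w\<in>words n. \<beta> y k w) = (\<Sum>x\<in>words (Suc n). \<mu> k x)" for k
        unfolding \<beta>_def sum_words_Suc
        by (subst sum.swap) (simp add: output_mass stochastic_on_UNIV sum.swap[of _ "words n" UNIV])
      then show ?thesis unfolding S_def by (subst sum.swap) simp
    qed
    have G: "?G (Suc n) (\<mu> k) = (\<Sum>z\<in>words n. ?F (\<alpha> z k)) + (\<Sum>y\<in>UNIV. ?G n (\<beta> y k))" for k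
      unfolding ediff_words_Suc \<alpha>_def \<beta>_def by simp
    \<comment> \<open>The conditional measures are linear in the input measure, so the decomposition
      of the summed input involves the sums of the same families.\<close>
    have G': "?G (Suc n) (\<lambda>x. \<Sum>k\<in>K. \<mu> k x) =
       (\<Sum>z\<in>words n. ?F (\<lambda>x. \<Sum>k\<in>K. \<alpha> z k x)) + (\<Sum>y\<in>UNIV. ?G n (\<lambda>w. \<Sum>k\<in>K. \<beta> y k w))"
      unfolding ediff_words_Suc \<alpha>_def \<beta>_def sum_distrib_right
      by (simp add: sum.swap[of _ K])
    have "(\<Sum>k\<in>K. ?G (Suc n) (\<mu> k)) - ?G (Suc n) (\<lambda>x. \<Sum>k\<in>K. \<mu> k x)
      = (\<Sum>z\<in>words n. (\<Sum>k\<in>K. ?F (\<alpha> z k)) - ?F (\<lambda>x. \<Sum>k\<in>K. \<alpha> z k x)) +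
        (\<Sum>y\<in>UNIV. (\<Sum>k\<in>K. ?G n (\<beta> y k)) - ?G n (\<lambda>w. \<Sum>k\<in>K. \<beta> y k w))"
      unfolding G G' sum.distrib sum_subtractf
      by (simp add: sum.swap[of _ K])
    also have "\<dots> \<le> (\<Sum>z\<in>words n. c * (\<Sum>k\<in>K. \<Sum>x\<in>UNIV. \<alpha> z k x)) +
        (\<Sum>y\<in>UNIV. real n * c * (\<Sum>k\<in>K. \<Sum>w\<in>words n. \<beta> y k w))"
      by (intro add_mono sum_mono gap_boundD[OF assms K] gap_boundD[OF Suc K])
         (auto simp: \<alpha>_def \<beta>_def intro!: sum_nonneg mult_nonneg_nonneg \<mu>n)
    also have "\<dots> = c * S + real n * c * S"
      unfolding sum_distrib_left[symmetric] \<alpha>s \<beta>s ..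
    finally show "(\<Sum>k\<in>K. ?G (Suc n) (\<mu> k)) - ?G (Suc n) (\<lambda>x. \<Sum>k\<in>K. \<mu> k x)
        \<le> real (Suc n) * c * (\<Sum>k\<in>K. \<Sum>x\<in>words (Suc n). \<mu> k x)"
      by (simp add: S_def algebra_simps)
  qed
qed



section \<open>Assembly of the converse for codes\<close>

lemma pmf_bind_eq_sum:
  assumes "finite S" "set_pmf p \<subseteq> S"
  shows "pmf (bind_pmf p f) y = (\<Sum>x\<in>S. pmf p x * pmf (f x) y)"
  using assms by (simp add: pmf_bind integral_measure_pmf[of S] subset_iff mult.commute)

lemma pmf_map_Pair: "pmf (map_pmf (Pair j') Q) (j, z) = (if j' = j then pmf Q z else 0)"
proof (cases "j' = j")
  case True
  then show ?thesis using pmf_map_inj'[of "Pair j" Q z] by (simp add: inj_def)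
qed (auto simp: pmf_eq_0_set_pmf)

text \<open>The factor 1 / J is put on the input weights, so that the joint law has the shape
  required by \<open>mi_diff_eq_ediff\<close>.\<close>

lemma mutual_info_message_output:
  fixes V :: "'a::finite \<Rightarrow> 'c::finite pmf"
  assumes J: "J \<ge> 1" and E: "\<And>j. j \<in> {1..J} \<Longrightarrow> set_pmf (E j) \<subseteq> words n"
  shows "mutual_info (message_output V J E) fst snd * ln 2 =
    mi {1..J} (words n) (\<lambda>j z. \<Sum>x\<in>words n. pmf (E j) x / real J * pmf (memoryless V x) z)"
proof (rule mutual_info_eq_mi)
  have eq: "message_output V J E =
    bind_pmf (pmf_of_set {1..J}) (\<lambda>j. map_pmf (Pair j) (bind_pmf (E j) (memoryless V)))"
    by (simp add: message_output_def map_bind_pmf map_pmf_def bind_assoc_pmf bind_return_pmf)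
  have ne: "{1..J} \<noteq> {}" using J by simp
  show "set_pmf (map_pmf (\<lambda>w. (fst w, snd w)) (message_output V J E)) \<subseteq> {1..J} \<times> words n"
    using ne E set_pmf_memoryless[of V] by (fastforce simp: eq words_def)
  show "pmf (map_pmf (\<lambda>w. (fst w, snd w)) (message_output V J E)) (j, z) =
     (\<Sum>x\<in>words n. pmf (E j) x / real J * pmf (memoryless V x) z)" if j: "j \<in> {1..J}" "z \<in> words n" for j z
  proof -
    have "pmf (message_output V J E) (j, z) = (\<Sum>j'\<in>{1..J}. 1 / real J * (if j' = j then pmf (bind_pmf (E j') (memoryless V)) z else 0))"
      unfolding eq using ne by (subst pmf_bind_eq_sum[of "{1..J}"]) (auto simp: pmf_map_Pair)
    also have "\<dots> = 1 / real J * pmf (bind_pmf (E j) (memoryless V)) z"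
      using j by (simp add: sum_distrib_left[symmetric] del: times_divide_eq_left)
    also have "\<dots> = 1 / real J * (\<Sum>x\<in>words n. pmf (E j) x * pmf (memoryless V x) z)"
      using E[OF j(1)] by (simp add: pmf_bind_eq_sum[of "words n"])
    finally show ?thesis by (simp add: sum_divide_distrib)
  qed
qed auto

text \<open>Fano's inequality bounds I(J;Y) from below, the n-letter gap bounds I(J;Y) - I(J;Z) from
  above. A stochastic encoder merely supplies one input measure per message.\<close>

lemma secrecy_converse:
  fixes W :: "'a::finite \<Rightarrow> 'b::finite pmf" and V :: "'a \<Rightarrow> 'c::finite pmf"
  assumes m: "\<forall>v\<in>secrecy_values W V. v \<le> m"
    and J: "J \<ge> 1" and E: "\<And>j. j \<in> {1..J} \<Longrightarrow> set_pmf (E j) \<subseteq> words n"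
    and D: "disjoint_family_on D {1..J}"
    and err: "\<And>j. j \<in> {1..J} \<Longrightarrow>
      (\<Sum>x\<in>words n. pmf (E j) x * measure_pmf.prob (memoryless W x) (words n - D j)) \<le> e"
  shows "(1 - e) * ln (real J) - ln 2 \<le> real n * m * ln 2 + mutual_info (message_output V J E) fst snd * ln 2"
proof -
  let ?K = "{1..J}" and ?X = "words n"
  define \<mu> where "\<mu> j x = pmf (E j) x / real J" for j x
  define r where "r j y = (\<Sum>x\<in>?X. \<mu> j x * pmf (memoryless W x) y)" for j y
  have \<mu>n: "\<mu> j x \<ge> 0" for j x by (simp add: \<mu>_def)
  have mass: "(\<Sum>x\<in>?X. \<mu> j x) = 1 / real J" if "j \<in> ?K" for j
    unfolding \<mu>_def sum_divide_distrib[symmetric]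
    by (subst sum_pmf_eq_1) (use E[OF that] in auto)
  have "(1 - e) * ln (real J) - ln 2 \<le> mi ?K ?X r"
  proof (rule fano[OF J, where D = D])
    show "(\<Sum>y\<in>?X. r j y) = 1 / real J" if "j \<in> ?K" for j
      unfolding r_def by (simp add: output_mass stochastic_on_memoryless mass[OF that])
    show "(\<Sum>y\<in>?X - D j. r j y) \<le> e / real J" if j: "j \<in> ?K" for j
    proof -
      have "(\<Sum>y\<in>?X - D j. r j y) = (\<Sum>x\<in>?X. \<mu> j x * measure_pmf.prob (memoryless W x) (?X - D j))"
        unfolding r_def by (subst sum.swap) (simp add: measure_measure_pmf_finite sum_distrib_left)
      also have "\<dots> = (\<Sum>x\<in>?X. pmf (E j) x * measure_pmf.prob (memoryless W x) (?X - D j)) / real J"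
        by (simp add: \<mu>_def sum_divide_distrib)
      also have "\<dots> \<le> e / real J" using err[OF j] by (intro divide_right_mono) auto
      finally show ?thesis .
    qed
    show "disjoint_family_on D ?K" by (fact D)
  qed (auto simp: r_def \<mu>n intro!: sum_nonneg)
  also have "mi ?K ?X r = mutual_info (message_output V J E) fst snd * ln 2 +
     ((\<Sum>j\<in>?K. ediff ?X ?X ?X (memoryless W) (memoryless V) (\<mu> j))
      - ediff ?X ?X ?X (memoryless W) (memoryless V) (\<lambda>x. \<Sum>j\<in>?K. \<mu> j x))"
  proof -
    have "mutual_info (message_output V J E) fst snd * ln 2 =
      mi ?K ?X (\<lambda>j z. \<Sum>x\<in>?X. \<mu> j x * pmf (memoryless V x) z)"
      unfolding \<mu>_def by (rule mutual_info_message_output[OF J E])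
    then show ?thesis
      using mi_diff_eq_ediff[of ?X ?X "memoryless W" ?X "memoryless V" ?K \<mu>]
      by (simp add: stochastic_on_memoryless \<mu>n r_def[abs_def])
  qed
  also have "\<dots> \<le> mutual_info (message_output V J E) fst snd * ln 2 +
      real n * (m * ln 2) * (\<Sum>j\<in>?K. \<Sum>x\<in>?X. \<mu> j x)"
    using gap_boundD[OF gap_bound_memoryless[OF gap_bound_single_letter[OF m]], of ?K n \<mu>] \<mu>n by auto
  also have "(\<Sum>j\<in>?K. \<Sum>x\<in>?X. \<mu> j x) = 1" using J by (simp add: mass)
  finally show ?thesis by (simp add: algebra_simps)
qed

text \<open>In a fixed state the code is an ordinary wiretap code, so the bound of every state
  applies by itself.\<close>

lemma csi_converse:
  fixes W :: "nat \<Rightarrow> 'a::finite \<Rightarrow> 'b::finite pmf" and V :: "nat \<Rightarrow> 'a \<Rightarrow> 'c::finite pmf"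
  assumes ach: "csi_achievable T W V R" and t: "t \<in> {1..T}"
    and m: "\<forall>v\<in>secrecy_values (W t) (V t). v \<le> m"
  shows "R \<le> m"
proof (rule ccontr)
  assume "\<not> R \<le> m"
  \<comment> \<open>The limit inferior controls the rates only eventually and only strictly below
    \<open>R\<close>, hence the intermediate rate.\<close>
  then obtain R' where R': "m < R'" "R' < R" using dense[of m R] by auto
  obtain J E D where code: "\<And>n. csi_code T n (J n) (E n) (D n)"
    and err: "(\<lambda>n. csi_error T W n (J n) (E n) (D n)) \<longlonglongrightarrow> 0"
    and rate: "liminf (\<lambda>n. ereal (log 2 (real (J n)) / real n)) \<ge> ereal R"
    and leak: "(\<lambda>n. csi_leakage T V (J n) (E n)) \<longlonglongrightarrow> 0"
    using ach unfolding csi_achievable_def by blast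
  define e where "e n = csi_error T W n (J n) (E n) (D n)" for n
  define l where "l n = csi_leakage T V (J n) (E n)" for n
  have main: "(1 - e n) * log 2 (real (J n)) \<le> 1 + real n * m + l n" for n
  proof -
    have J: "J n \<ge> 1" and D: "disjoint_family_on (D n) {1..J n}"
      using code[of n] by (auto simp: csi_code_def)
    have E: "set_pmf (E n t j) \<subseteq> words n" if "j \<in> {1..J n}" for j
      using code[of n] t that unfolding csi_code_def by blast
    have "(1 - e n) * ln (real (J n)) - ln 2 \<le> real n * m * ln 2 +
       mutual_info (message_output (V t) (J n) (E n t)) fst snd * ln 2"
    proof (rule secrecy_converse[OF m J E D])
      fix j assume j: "j \<in> {1..J n}"
      let ?g = "\<lambda>t j. \<Sum>x\<in>words n. pmf (E n t j) x * measure_pmf.prob (memoryless (W t) x) (words n - D n j)"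
      have "?g t j \<le> (MAX j\<in>{1..J n}. ?g t j)" using j by (intro Max_ge) auto
      also have "\<dots> \<le> e n" unfolding e_def csi_error_def using t by (intro Max_ge) auto
      finally show "?g t j \<le> e n" .
    qed
    moreover have leq: "mutual_info (message_output (V t) (J n) (E n t)) fst snd \<le> l n"
      unfolding l_def csi_leakage_def using t by (intro Max_ge) auto
    moreover have "mutual_info (message_output (V t) (J n) (E n t)) fst snd * ln 2 \<le> l n * ln 2"
      using leq by (intro mult_right_mono) auto
    ultimately have "(1 - e n) * ln (real (J n)) - ln 2 \<le> (real n * m + l n) * ln 2"
      unfolding distrib_right by linarith
    then have "((1 - e n) * ln (real (J n))) / ln 2 \<le> ((1 + real n * m + l n) * ln 2) / ln 2"
      by (intro divide_right_mono) (auto simp: algebra_simps)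
    then show ?thesis by (simp add: log_def)
  qed
  have "\<forall>\<^sub>F n in sequentially. ereal R' < ereal (log 2 (real (J n)) / real n)"
  proof (rule less_LiminfD)
    show "ereal R' < liminf (\<lambda>n. ereal (log 2 (real (J n)) / real n))"
      using R'(2) rate by (metis less_ereal.simps(1) order_less_le_trans)
  qed
  \<comment> \<open>So that the inequality for the rate may be multiplied by
    \<open>1 - e n\<close>.\<close>
  moreover have "\<forall>\<^sub>F n in sequentially. e n < 1"
    using err unfolding e_def by (rule order_tendstoD) simp
  ultimately have "\<forall>\<^sub>F n in sequentially. (1 - e n) * R' \<le> (1 + l n) * inverse (real n) + m"
    using eventually_gt_at_top[of 0]
  proof eventually_elim
    case (elim n)
    have "(1 - e n) * R' \<le> (1 - e n) * (log 2 (real (J n)) / real n)"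
      using elim by (intro mult_left_mono) auto
    also have "\<dots> \<le> (1 + real n * m + l n) / real n"
      using main[of n] elim by (simp add: divide_right_mono)
    also have "\<dots> = (1 + l n) * inverse (real n) + m" using elim by (simp add: field_simps)
    finally show ?case .
  qed
  moreover have "(\<lambda>n. (1 - e n) * R') \<longlonglongrightarrow> (1 - 0) * R'"
    using err unfolding e_def by (intro tendsto_intros)
  moreover have "(\<lambda>n. (1 + l n) * inverse (real n) + m) \<longlonglongrightarrow> (1 + 0) * 0 + m"
    using leak unfolding l_def by (intro tendsto_intros lim_inverse_n)
  ultimately have "(1 - 0) * R' \<le> (1 + 0) * 0 + m"
    by (intro tendsto_le[OF trivial_limit_sequentially])
  then show False using R' by simp
qed

section \<open>Random codes\<close>

abbreviation mean :: "'x pmf \<Rightarrow> ('x \<Rightarrow> real) \<Rightarrow> real" where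
  "mean p f \<equiv> measure_pmf.expectation p f"

lemma mean_eq_sum:
  assumes "finite (set_pmf p)"
  shows "mean p f = (\<Sum>x\<in>set_pmf p. pmf p x * f x)"
  using assms by (simp add: integral_measure_pmf[of "set_pmf p"])

lemma mean_mono:
  assumes "finite (set_pmf p)" "\<And>x. x \<in> set_pmf p \<Longrightarrow> f x \<le> g x"
  shows "mean p f \<le> mean p g"
  using assms by (simp add: mean_eq_sum sum_mono mult_left_mono)

lemma mean_add: "finite (set_pmf p) \<Longrightarrow> mean p (\<lambda>x. f x + g x) = mean p f + mean p g"
  by (simp add: integrable_measure_pmf_finite)

lemma mean_sum: "finite (set_pmf p) \<Longrightarrow> mean p (\<lambda>x. \<Sum>i\<in>S. f i x) = (\<Sum>i\<in>S. mean p (f i))"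
  by (simp add: integrable_measure_pmf_finite)

lemma mean_const: "mean p (\<lambda>x. a) = a"
  by simp

text \<open>The probabilistic method: values above \<open>a\<close> on the whole support would push
  the mean above \<open>a\<close>.\<close>

lemma mean_le_imp_exists:
  assumes "finite (set_pmf p)" "mean p f \<le> a"
  shows "\<exists>x\<in>set_pmf p. f x \<le> a"
proof (rule ccontr)
  assume "\<not> ?thesis"
  then have less: "a < f x" if "x \<in> set_pmf p" for x using that by force
  obtain x0 where x0: "x0 \<in> set_pmf p" using set_pmf_not_empty by fast
  have "(\<Sum>x\<in>set_pmf p. pmf p x * a) < (\<Sum>x\<in>set_pmf p. pmf p x * f x)"
    using x0 less assms(1) by (intro sum_strict_mono mult_strict_left_mono) (auto simp: pmf_positive)
  moreover have "(\<Sum>x\<in>set_pmf p. pmf p x * a) = a"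
    using assms(1) by (simp add: sum_pmf_eq_1 flip: sum_distrib_right)
  ultimately show False using assms by (simp add: mean_eq_sum)
qed

section \<open>Independent codebooks: covering and decoding\<close>

lemma finite_set_Pi_pmf:
  assumes "finite I" "\<And>i. i \<in> I \<Longrightarrow> finite (set_pmf (p i))"
  shows "finite (set_pmf (Pi_pmf I d p))"
  using assms by (auto simp: set_Pi_pmf)

text \<open>One codeword is frozen at \<open>u\<close> while the others stay independent. Both the
  covering and the decoding estimate start from this split.\<close>

lemma mean_Pi_split:
  assumes "finite I" "k \<in> I" "\<And>i. i \<in> I \<Longrightarrow> finite (set_pmf (p i))"
  shows "mean (Pi_pmf I d p) f = mean (p k) (\<lambda>u. mean (Pi_pmf (I - {k}) d p) (\<lambda>c. f (c(k := u))))"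
proof -
  let ?R = "Pi_pmf (I - {k}) d p"
  have finR: "finite (set_pmf ?R)" using assms by (intro finite_set_Pi_pmf) auto
  have "Pi_pmf I d p = bind_pmf (p k) (\<lambda>u. map_pmf (\<lambda>c. c(k := u)) ?R)"
    using Pi_pmf_insert'[of "I - {k}" k d p] assms by (simp add: insert_absorb map_pmf_def)
  also have "mean \<dots> f = (\<Sum>u\<in>set_pmf (p k). pmf (p k) u * mean (map_pmf (\<lambda>c. c(k := u)) ?R) f)"
    using assms finR by (subst pmf_expectation_bind[of "set_pmf (p k)"]) auto
  also have "\<dots> = mean (p k) (\<lambda>u. mean ?R (\<lambda>c. f (c(k := u))))"
    using assms by (simp add: mean_eq_sum[of "p k"])
  finally show ?thesis .
qed

lemma mean_Pi_component:
  assumes "finite I" "i \<in> I"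
  shows "mean (Pi_pmf I d p) (\<lambda>c. g (c i)) = mean (p i) g"
proof -
  have "mean (Pi_pmf I d p) (\<lambda>c. g (c i)) = mean (map_pmf (\<lambda>c. c i) (Pi_pmf I d p)) g" by simp
  then show ?thesis using assms by (simp only: Pi_pmf_component) simp
qed

text \<open>Conditionally on one codeword, the logarithm is bounded by its tangent at the
  conditional mean of the output of the remaining codewords.\<close>

lemma soft_covering:
  fixes V :: "'u \<Rightarrow> 'z pmf" and S :: "'i set" and p0 :: "'u pmf"
  defines "Q \<equiv> \<lambda>z. pmf (bind_pmf p0 V) z" and "P \<equiv> \<lambda>c z. (\<Sum>i\<in>S. pmf (V (c i)) z) / real (card S)"
  assumes I: "finite I" "S \<subseteq> I" "S \<noteq> {}" and fin: "\<And>i. i \<in> I \<Longrightarrow> finite (set_pmf (p i))"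
    and p: "\<And>i. i \<in> S \<Longrightarrow> p i = p0"
  shows "mean (Pi_pmf I d p) (\<lambda>c. \<Sum>z\<in>C. P c z * ln (P c z / Q z))
    \<le> mean p0 (\<lambda>u. \<Sum>z\<in>C. pmf (V u) z * ln (1 + pmf (V u) z / (real (card S) * Q z)))"
proof -
  let ?M = "Pi_pmf I d p" and ?L = "real (card S)"
  have finS: "finite S" using I finite_subset by blast
  have L: "?L > 0" using finS I by (simp add: card_gt_0_iff)
  have finp0: "finite (set_pmf p0)" using I p fin by (metis ex_in_conv subsetD)
  have finM: "finite (set_pmf ?M)" using I fin by (intro finite_set_Pi_pmf)
  have Q: "Q z = mean p0 (\<lambda>u. pmf (V u) z)" for z by (simp add: Q_def pmf_bind)
  have key: "mean ?M (\<lambda>c. pmf (V (c i)) z * ln (P c z / Q z))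
      \<le> mean p0 (\<lambda>u. pmf (V u) z * ln (1 + pmf (V u) z / (?L * Q z)))" if i: "i \<in> S" for i z
  proof -
    let ?R = "Pi_pmf (I - {i}) d p"
    have finR: "finite (set_pmf ?R)" using I fin by (intro finite_set_Pi_pmf) auto
    have "mean ?M (\<lambda>c. pmf (V (c i)) z * ln (P c z / Q z))
        = mean p0 (\<lambda>u. mean ?R (\<lambda>c. pmf (V u) z * ln (P (c(i := u)) z / Q z)))"
      using i I fin p[OF i] by (subst mean_Pi_split[of I i]) auto
    also have "\<dots> \<le> mean p0 (\<lambda>u. pmf (V u) z * ln (1 + pmf (V u) z / (?L * Q z)))"
    proof (rule mean_mono[OF finp0])
      fix u assume u: "u \<in> set_pmf p0"
      show "mean ?R (\<lambda>c. pmf (V u) z * ln (P (c(i := u)) z / Q z))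
        \<le> pmf (V u) z * ln (1 + pmf (V u) z / (?L * Q z))"
      proof (cases "pmf (V u) z = 0")
        case False
        then have v: "pmf (V u) z > 0" by (simp add: pmf_positive_iff pmf_eq_0_set_pmf)
        then have "z \<in> set_pmf (bind_pmf p0 V)" using u by (auto simp: pmf_positive_iff)
        then have Qp: "Q z > 0" by (simp add: Q_def pmf_positive_iff)
        define a where "a = pmf (V u) z / (?L * Q z)"
        define s where "s c = (\<Sum>j\<in>S - {i}. pmf (V (c j)) z) / (?L * Q z)" for c
        have a: "a > 0" using v L Qp by (simp add: a_def)
        have P: "P (c(i := u)) z / Q z = a + s c" for c
          using finS i by (simp add: P_def a_def s_def sum.remove[of S i] add_divide_distrib)
        \<comment> \<open>Each of the other L - 1 codewords has mean output \<open>Q z\<close>,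
          which amounts to (L - 1) / L in this scaling.\<close>
        have Es: "mean ?R s \<le> 1"
        proof -
          have "mean ?R s = (\<Sum>j\<in>S - {i}. mean ?R (\<lambda>c. pmf (V (c j)) z)) / (?L * Q z)"
            using finR by (simp add: s_def[abs_def] mean_sum)
          also have "(\<Sum>j\<in>S - {i}. mean ?R (\<lambda>c. pmf (V (c j)) z)) = (\<Sum>j\<in>S - {i}. Q z)"
            using I p by (intro sum.cong refl) (subst mean_Pi_component, auto simp: Q)
          also have "\<dots> / (?L * Q z) = real (card (S - {i})) / ?L" using Qp by simp
          also have "\<dots> \<le> 1" using L finS by (simp add: card_Diff1_le)
          finally show ?thesis .
        qed
        \<comment> \<open>The tangent of ln at \<open>1 + a\<close>; its slope times the mean of
          \<open>s\<close> is absorbed by the constant \<open>- 1 / (1 + a)\<close>.\<close>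
        have "mean ?R (\<lambda>c. ln (P (c(i := u)) z / Q z)) \<le> mean ?R (\<lambda>c. (ln (1 + a) - 1 / (1 + a)) + s c * (1 / (1 + a)))"
        proof (rule mean_mono[OF finR])
          fix c
          have s: "s c \<ge> 0" using L Qp by (simp add: s_def sum_nonneg)
          have "ln ((a + s c) / (1 + a)) \<le> (a + s c) / (1 + a) - 1"
            using a s by (intro ln_le_minus_one divide_pos_pos) auto
          moreover have "ln ((a + s c) / (1 + a)) = ln (a + s c) - ln (1 + a)"
            using a s by (simp add: ln_div)
          moreover have "(a + s c) / (1 + a) - 1 = s c * (1 / (1 + a)) - 1 / (1 + a)"
            using a by (simp add: divide_simps)
          ultimately show "ln (P (c(i := u)) z / Q z) \<le> (ln (1 + a) - 1 / (1 + a)) + s c * (1 / (1 + a))"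
            unfolding P by linarith
        qed
        also have "\<dots> = (ln (1 + a) - 1 / (1 + a)) + mean ?R s * (1 / (1 + a))"
          using finR by (subst mean_add) (simp_all only: mean_const integral_mult_left_zero)
        also have "\<dots> \<le> ln (1 + a)"
          using mult_right_mono[OF Es, of "1 / (1 + a)"] a by simp
        finally show ?thesis using v by (simp add: a_def mult_left_mono)
      qed simp
    qed
    finally show ?thesis .
  qed
  have "mean ?M (\<lambda>c. \<Sum>z\<in>C. P c z * ln (P c z / Q z))
      = (\<Sum>z\<in>C. \<Sum>i\<in>S. mean ?M (\<lambda>c. pmf (V (c i)) z * ln (P c z / Q z)) / ?L)"
  proof -
    have "P c z * ln (P c z / Q z) = (\<Sum>i\<in>S. pmf (V (c i)) z * ln (P c z / Q z) / ?L)" for c z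
      by (simp add: P_def sum_divide_distrib sum_distrib_right)
    then show ?thesis using finM by (simp add: mean_sum)
  qed
  also have "\<dots> \<le> (\<Sum>z\<in>C. \<Sum>i\<in>S. mean p0 (\<lambda>u. pmf (V u) z * ln (1 + pmf (V u) z / (?L * Q z))) / ?L)"
    using key L by (intro sum_mono divide_right_mono) auto
  also have "\<dots> = mean p0 (\<lambda>u. \<Sum>z\<in>C. pmf (V u) z * ln (1 + pmf (V u) z / (?L * Q z)))"
    using L finp0 by (simp add: mean_sum)
  finally show ?thesis .
qed

text \<open>Given the sent codeword and the output, a competitor is independent of both, its score
  has mean at most one, and Markov's inequality bounds the chance of passing by
  \<open>1 / \<gamma> i\<close>. \<open>W\<close> only generates the output and may be unrelated to
  the competitors' scores, as a receiver ignorant of the state requires. \<open>K\<close> can omit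
  codewords of the sent message.\<close>

lemma threshold_decoding:
  fixes W :: "'u \<Rightarrow> 'y pmf" and s :: "'i \<Rightarrow> 'u \<Rightarrow> 'y \<Rightarrow> real"
  assumes I: "finite I" "k \<in> I" "K \<subseteq> I - {k}" and fin: "\<And>i. i \<in> I \<Longrightarrow> finite (set_pmf (p i))"
    and B: "finite B" and s0: "\<And>i u y. s i u y \<ge> 0" and \<gamma>: "\<And>i. \<gamma> i > 0"
    and s1: "\<And>i y. i \<in> K \<Longrightarrow> mean (p i) (\<lambda>u. s i u y) \<le> 1"
  shows "mean (Pi_pmf I d p) (\<lambda>c. \<Sum>y\<in>B. pmf (W (c k)) y *
        of_bool (s k (c k) y < \<gamma> k \<or> (\<exists>i\<in>K. s i (c i) y \<ge> \<gamma> i)))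
    \<le> mean (p k) (\<lambda>u. \<Sum>y\<in>B. pmf (W u) y * of_bool (s k u y < \<gamma> k)) + (\<Sum>i\<in>K. 1 / \<gamma> i)"
proof -
  let ?R = "Pi_pmf (I - {k}) d p"
  have finR: "finite (set_pmf ?R)" using I fin by (intro finite_set_Pi_pmf) auto
  have finK: "finite K" using I finite_subset by blast
  have kK: "k \<notin> K" using I by blast
  have G: "(\<Sum>i\<in>K. 1 / \<gamma> i) \<ge> 0" using \<gamma> by (simp add: sum_nonneg less_imp_le)
  have "mean (Pi_pmf I d p) (\<lambda>c. \<Sum>y\<in>B. pmf (W (c k)) y *
        of_bool (s k (c k) y < \<gamma> k \<or> (\<exists>i\<in>K. s i (c i) y \<ge> \<gamma> i)))
    = mean (p k) (\<lambda>u. mean ?R (\<lambda>c. \<Sum>y\<in>B. pmf (W u) y *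
        of_bool (s k u y < \<gamma> k \<or> (\<exists>i\<in>K. s i ((c(k := u)) i) y \<ge> \<gamma> i))))"
    using I fin by (subst mean_Pi_split[of I k]) auto
  also have "\<dots> \<le> mean (p k) (\<lambda>u. (\<Sum>y\<in>B. pmf (W u) y * of_bool (s k u y < \<gamma> k)) + (\<Sum>i\<in>K. 1 / \<gamma> i))"
  proof (rule mean_mono)
    fix u
    have "mean ?R (\<lambda>c. \<Sum>y\<in>B. pmf (W u) y *
        of_bool (s k u y < \<gamma> k \<or> (\<exists>i\<in>K. s i ((c(k := u)) i) y \<ge> \<gamma> i)))
      \<le> mean ?R (\<lambda>c. \<Sum>y\<in>B. pmf (W u) y * of_bool (s k u y < \<gamma> k) + (\<Sum>i\<in>K. pmf (W u) y * (s i (c i) y / \<gamma> i)))"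
    proof (intro mean_mono finR sum_mono)
      fix c y
      \<comment> \<open>Union bound and Markov's inequality at once: the indicator of passing is at
        most the score over its threshold.\<close>
      have "of_bool (s k u y < \<gamma> k \<or> (\<exists>i\<in>K. s i ((c(k := u)) i) y \<ge> \<gamma> i))
        \<le> of_bool (s k u y < \<gamma> k) + (\<Sum>i\<in>K. s i (c i) y / \<gamma> i)"
      proof (cases "\<exists>i\<in>K. s i ((c(k := u)) i) y \<ge> \<gamma> i")
        case True
        then obtain i where i: "i \<in> K" "s i (c i) y \<ge> \<gamma> i" using kK by (metis fun_upd_other)
        then have "1 \<le> s i (c i) y / \<gamma> i" using \<gamma>[of i] by simp
        also have "\<dots> \<le> (\<Sum>i\<in>K. s i (c i) y / \<gamma> i)"
          using i finK s0 less_imp_le[OF \<gamma>] by (intro member_le_sum) auto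
        finally show ?thesis by (simp add: of_bool_def)
      next
        case False
        have "0 \<le> (\<Sum>i\<in>K. s i (c i) y / \<gamma> i)"
          using s0 less_imp_le[OF \<gamma>] by (intro sum_nonneg) auto
        then show ?thesis using False by simp
      qed
      from mult_left_mono[OF this pmf_nonneg[of "W u" y]]
      show "pmf (W u) y * of_bool (s k u y < \<gamma> k \<or> (\<exists>i\<in>K. s i ((c(k := u)) i) y \<ge> \<gamma> i))
        \<le> pmf (W u) y * of_bool (s k u y < \<gamma> k) + (\<Sum>i\<in>K. pmf (W u) y * (s i (c i) y / \<gamma> i))"
        by (simp add: distrib_left sum_distrib_left)
    qed
    also have "\<dots> = (\<Sum>y\<in>B. pmf (W u) y * of_bool (s k u y < \<gamma> k) +
        (\<Sum>i\<in>K. pmf (W u) y * (mean ?R (\<lambda>c. s i (c i) y) / \<gamma> i)))"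
      using finR by (simp add: mean_sum mean_add)
    also have "\<dots> \<le> (\<Sum>y\<in>B. pmf (W u) y * of_bool (s k u y < \<gamma> k) + (\<Sum>i\<in>K. pmf (W u) y * (1 / \<gamma> i)))"
    proof (intro sum_mono add_left_mono mult_left_mono divide_right_mono)
      fix i y assume i: "i \<in> K"
      have "mean ?R (\<lambda>c. s i (c i) y) = mean (p i) (\<lambda>u. s i u y)"
        using I i by (intro mean_Pi_component) auto
      then show "mean ?R (\<lambda>c. s i (c i) y) \<le> 1" using s1[OF i] by simp
    qed (auto simp: less_imp_le[OF \<gamma>])
    also have "\<dots> = (\<Sum>y\<in>B. pmf (W u) y * of_bool (s k u y < \<gamma> k)) + (\<Sum>y\<in>B. pmf (W u) y) * (\<Sum>i\<in>K. 1 / \<gamma> i)"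
      by (simp only: sum.distrib sum_distrib_left[symmetric] sum_distrib_right[symmetric])
    also have "(\<Sum>y\<in>B. pmf (W u) y) * (\<Sum>i\<in>K. 1 / \<gamma> i) \<le> 1 * (\<Sum>i\<in>K. 1 / \<gamma> i)"
      using G B by (intro mult_right_mono) (auto simp flip: measure_measure_pmf_finite)
    finally show "mean ?R (\<lambda>c. \<Sum>y\<in>B. pmf (W u) y *
        of_bool (s k u y < \<gamma> k \<or> (\<exists>i\<in>K. s i ((c(k := u)) i) y \<ge> \<gamma> i)))
      \<le> (\<Sum>y\<in>B. pmf (W u) y * of_bool (s k u y < \<gamma> k)) + (\<Sum>i\<in>K. 1 / \<gamma> i)" by simp
  qed (use I fin in auto)
  also have "\<dots> = mean (p k) (\<lambda>u. \<Sum>y\<in>B. pmf (W u) y * of_bool (s k u y < \<gamma> k)) + (\<Sum>i\<in>K. 1 / \<gamma> i)"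
    using I fin by (subst mean_add) auto
  finally show ?thesis .
qed

text \<open>Markov's inequality for counting: at most half of the values exceed twice the bound on
  the average. \<open>g\<close> enumerates survivors.\<close>

lemma select_half:
  fixes F :: "nat \<Rightarrow> real"
  assumes F: "\<And>j. j \<in> {1..2 * J} \<Longrightarrow> F j \<ge> 0" and sum: "(\<Sum>j\<in>{1..2 * J}. F j) \<le> real (2 * J) * e" and e: "e > 0"
  obtains g where "inj_on g {1..J}" "\<And>j. j \<in> {1..J} \<Longrightarrow> g j \<in> {1..2 * J} \<and> F (g j) \<le> 2 * e"
proof -
  define G where "G = {j \<in> {1..2 * J}. F j \<le> 2 * e}"
  have "real (card ({1..2 * J} - G)) * (2 * e) = (\<Sum>j\<in>{1..2 * J} - G. 2 * e)" by simp
  also have "\<dots> \<le> (\<Sum>j\<in>{1..2 * J} - G. F j)" by (rule sum_mono) (auto simp: G_def)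
  also have "\<dots> \<le> (\<Sum>j\<in>{1..2 * J}. F j)" using F by (intro sum_mono2) auto
  also have "\<dots> \<le> real J * (2 * e)" using sum by simp
  finally have "card ({1..2 * J} - G) \<le> J" using e by simp
  moreover have "card ({1..2 * J} - G) = 2 * J - card G"
    by (subst card_Diff_subset) (auto simp: G_def)
  ultimately have "card {1..J} \<le> card G" by simp
  then obtain g where "inj_on g {1..J}" "g ` {1..J} \<subseteq> G"
    using card_le_inj[of "{1..J}" G] by (auto simp: G_def)
  then show thesis using that[of g] unfolding G_def by blast
qed


text \<open>Errors and divergences of all states are collected in one cost per message, with mean at
  most \<open>e\<close>. This yields a single codebook good for all states at once, and since the
  summands are nonnegative, each of them is at most \<open>2 * e\<close> for the surviving
  messages.\<close>

lemma one_shot_code: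
  fixes W :: "nat \<Rightarrow> 'u \<Rightarrow> 'y pmf" and V :: "nat \<Rightarrow> 'u \<Rightarrow> 'z pmf" and p :: "nat \<Rightarrow> 'u pmf"
    and L :: "nat \<Rightarrow> nat"
  defines "q \<equiv> \<lambda>t. pmf (bind_pmf (p t) (W t))" and "Q \<equiv> \<lambda>t. pmf (bind_pmf (p t) (V t))"
  assumes \<Theta>: "finite \<Theta>" and fin: "\<And>t. t \<in> \<Theta> \<Longrightarrow> finite (set_pmf (p t))" and B: "finite B" and C: "finite C"
    and V: "\<And>t u. t \<in> \<Theta> \<Longrightarrow> u \<in> set_pmf (p t) \<Longrightarrow> (\<Sum>z\<in>C. pmf (V t u) z) = 1"
    and L: "\<And>t. L t \<ge> 1" and \<gamma>: "\<And>t. \<gamma> t > 0" and e: "e > 0"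
    and bound: "(\<Sum>t\<in>\<Theta>. mean (p t) (\<lambda>u. \<Sum>y\<in>B. pmf (W t u) y * of_bool (pmf (W t u) y / q t y < \<gamma> t))
        + (\<Sum>t'\<in>\<Theta>. real (2 * J * L t') / \<gamma> t')
        + mean (p t) (\<lambda>u. \<Sum>z\<in>C. pmf (V t u) z * ln (1 + pmf (V t u) z / (real (L t) * Q t z)))) \<le> e"
  obtains c D where "\<And>t j l. t \<in> \<Theta> \<Longrightarrow> j \<in> {1..J} \<Longrightarrow> l \<in> {1..L t} \<Longrightarrow> c t j l \<in> set_pmf (p t)"
    and "\<And>j. D j \<subseteq> B" and "disjoint_family_on D {1..J}"
    and "\<And>t j. t \<in> \<Theta> \<Longrightarrow> j \<in> {1..J} \<Longrightarrow>
        (\<Sum>l\<in>{1..L t}. \<Sum>y\<in>B - D j. pmf (W t (c t j l)) y) / real (L t) \<le> 2 * e"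
    and "\<And>t j. t \<in> \<Theta> \<Longrightarrow> j \<in> {1..J} \<Longrightarrow>
        (\<Sum>z\<in>C. (\<Sum>l\<in>{1..L t}. pmf (V t (c t j l)) z) / real (L t) *
          ln ((\<Sum>l\<in>{1..L t}. pmf (V t (c t j l)) z) / real (L t) / Q t z)) \<le> 2 * e"
proof -
  \<comment> \<open>Indices are state, message and randomisation; twice the final number of messages
    is drawn, in view of the later halving.\<close>
  define I where "I = (SIGMA t:\<Theta>. {1..2 * J} \<times> {1..L t})"
  have finI: "finite I" using \<Theta> by (simp add: I_def)
  define M where "M = Pi_pmf I undefined (\<lambda>k. p (fst k))"
  have finM: "finite (set_pmf M)" unfolding M_def using finI fin by (intro finite_set_Pi_pmf) (auto simp: I_def)
  define s :: "nat \<times> nat \<times> nat \<Rightarrow> 'u \<Rightarrow> 'y \<Rightarrow> real"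
    where "s = (\<lambda>k u y. pmf (W (fst k) u) y / q (fst k) y)"
  let ?g = "\<lambda>k :: nat \<times> nat \<times> nat. \<gamma> (fst k)"
  define K where "K j = {k \<in> I. fst (snd k) \<noteq> j}" for j
  define err where "err c t j l = (\<Sum>y\<in>B. pmf (W t (c (t, j, l))) y *
      of_bool (s (t, j, l) (c (t, j, l)) y < \<gamma> t \<or> (\<exists>i\<in>K j. s i (c i) y \<ge> ?g i)))" for c t l and j :: nat
  define P where "P c t j z = (\<Sum>l\<in>{1..L t}. pmf (V t (c (t, j, l))) z) / real (L t)" for c t z and j :: nat
  define dv where "dv c t j = (\<Sum>z\<in>C. P c t j z * ln (P c t j z / Q t z))" for c t and j :: nat
  define F where "F c j = (\<Sum>t\<in>\<Theta>. (\<Sum>l\<in>{1..L t}. err c t j l) / real (L t) + dv c t j)" for c j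
  define A1 where "A1 t = mean (p t) (\<lambda>u. \<Sum>y\<in>B. pmf (W t u) y * of_bool (pmf (W t u) y / q t y < \<gamma> t))" for t
  define A2 where "A2 = (\<Sum>t'\<in>\<Theta>. real (2 * J * L t') / \<gamma> t')"
  define A3 where "A3 t = mean (p t) (\<lambda>u. \<Sum>z\<in>C. pmf (V t u) z * ln (1 + pmf (V t u) z / (real (L t) * Q t z)))" for t
  have Lp: "real (L t) > 0" for t using L[of t] by simp
  have Eerr: "mean M (\<lambda>c. err c t j l) \<le> A1 t + A2" if tjl: "t \<in> \<Theta>" "j \<in> {1..2 * J}" "l \<in> {1..L t}" for t j l
  proof -
    let ?k = "(t, j, l)"
    have "mean M (\<lambda>c. err c t j l) \<le> mean (p t) (\<lambda>u. \<Sum>y\<in>B. pmf (W t u) y * of_bool (s ?k u y < \<gamma> t))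
        + (\<Sum>i\<in>K j. 1 / ?g i)"
      unfolding M_def err_def
    proof (rule threshold_decoding[where \<gamma> = ?g and k = ?k and p = "\<lambda>k. p (fst k)" and s = s and W = "W t" and K = "K j", unfolded fst_conv])
      fix i y
      \<comment> \<open>The quotient is 1, or 0 by the convention for division when \<open>y\<close>
        has output probability zero.\<close>
      have "mean (p (fst i)) (\<lambda>u. s i u y) = q (fst i) y / q (fst i) y"
        by (simp add: s_def q_def pmf_bind)
      then show "mean (p (fst i)) (\<lambda>u. s i u y) \<le> 1" by simp
    qed (use finI fin B \<gamma> tjl in \<open>auto simp: I_def K_def s_def q_def\<close>)
    also have "mean (p t) (\<lambda>u. \<Sum>y\<in>B. pmf (W t u) y * of_bool (s ?k u y < \<gamma> t)) = A1 t"
      by (simp add: A1_def s_def)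
    also have "(\<Sum>i\<in>K j. 1 / ?g i) \<le> (\<Sum>i\<in>I. 1 / ?g i)"
      using finI less_imp_le[OF \<gamma>] by (intro sum_mono2) (auto simp: K_def)
    also have "\<dots> = A2"
    proof -
      have "(\<Sum>i\<in>I. 1 / ?g i) = (\<Sum>(t', w)\<in>I. 1 / \<gamma> t')" by (simp add: case_prod_unfold)
      also have "\<dots> = (\<Sum>t'\<in>\<Theta>. \<Sum>w\<in>{1..2 * J} \<times> {1..L t'}. 1 / \<gamma> t')"
        unfolding I_def using \<Theta> by (subst sum.Sigma) auto
      finally show ?thesis by (simp add: A2_def card_cartesian_product)
    qed
    finally show ?thesis by simp
  qed
  have Edv: "mean M (\<lambda>c. dv c t j) \<le> A3 t" if tj: "t \<in> \<Theta>" "j \<in> {1..2 * J}" for t j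
  proof -
    let ?S = "(\<lambda>l. (t, j, l)) ` {1..L t}"
    have inj: "inj_on (\<lambda>l. (t, j, l)) {1..L t}" by (simp add: inj_on_def)
    then have card: "card ?S = L t" by (simp add: card_image)
    have P: "P c t j z = (\<Sum>i\<in>?S. pmf (V t (c i)) z) / real (card ?S)" for c z
      unfolding card P_def using inj by (simp add: sum.reindex)
    have ne: "?S \<noteq> {}" using L[of t] by auto
    have sub: "?S \<subseteq> I" using tj by (auto simp: I_def)
    have "mean M (\<lambda>c. dv c t j) \<le> mean (p t) (\<lambda>u. \<Sum>z\<in>C. pmf (V t u) z * ln (1 + pmf (V t u) z / (real (card ?S) * Q t z)))"
      unfolding M_def dv_def P Q_def
      by (rule soft_covering[OF finI sub ne]) (use fin in \<open>auto simp: I_def\<close>)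
    then show ?thesis unfolding card A3_def .
  qed
  have EF: "mean M (\<lambda>c. F c j) \<le> e" if j: "j \<in> {1..2 * J}" for j
  proof -
    have "mean M (\<lambda>c. F c j) = (\<Sum>t\<in>\<Theta>. (\<Sum>l\<in>{1..L t}. mean M (\<lambda>c. err c t j l)) / real (L t) + mean M (\<lambda>c. dv c t j))"
      using finM by (simp add: F_def mean_sum mean_add)
    also have "\<dots> \<le> (\<Sum>t\<in>\<Theta>. (\<Sum>l\<in>{1..L t}. A1 t + A2) / real (L t) + A3 t)"
      using j Lp by (intro sum_mono add_mono divide_right_mono Eerr Edv) (auto simp: less_imp_le)
    also have "\<dots> = (\<Sum>t\<in>\<Theta>. A1 t + A2 + A3 t)"
      using Lp by (intro sum.cong refl) (simp add: less_imp_neq[THEN not_sym])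
    also have "\<dots> \<le> e" using bound unfolding A1_def A2_def A3_def .
    finally show ?thesis .
  qed
  have "mean M (\<lambda>c. \<Sum>j\<in>{1..2 * J}. F c j) \<le> (\<Sum>j\<in>{1..2 * J}. e)"
    unfolding mean_sum[OF finM] using EF by (intro sum_mono)
  then have "\<exists>c\<in>set_pmf M. (\<Sum>j\<in>{1..2 * J}. F c j) \<le> (\<Sum>j\<in>{1..2 * J}. e)"
    by (rule mean_le_imp_exists[OF finM])
  then obtain c where c: "c \<in> set_pmf M" "(\<Sum>j\<in>{1..2 * J}. F c j) \<le> real (2 * J) * e" by auto
  have cp: "c (t, j, l) \<in> set_pmf (p t)" if "t \<in> \<Theta>" "j \<in> {1..2 * J}" "l \<in> {1..L t}" for t j l
  proof -
    have "(t, j, l) \<in> I" using that by (simp add: I_def)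
    then show ?thesis using c(1) finI by (auto simp: M_def set_Pi_pmf PiE_dflt_def)
  qed
  have err0: "err c t j l \<ge> 0" for t j l by (auto simp: err_def intro!: sum_nonneg)
  have errL0: "(\<Sum>l\<in>{1..L t}. err c t j l) / real (L t) \<ge> 0" for t j
    using err0 by (intro divide_nonneg_nonneg sum_nonneg) auto
  \<comment> \<open>Nonnegativity of the divergence is what lets a single summand be bounded by the
    total cost.\<close>
  have dv0: "dv c t j \<ge> 0" if tj: "t \<in> \<Theta>" "j \<in> {1..2 * J}" for t j
    unfolding dv_def
  proof (rule gibbs[OF C])
    show "P c t j z \<ge> 0" for z by (simp add: P_def sum_nonneg)
    show "Q t z \<ge> 0" for z by (simp add: Q_def)
    show "Q t z > 0" if "P c t j z > 0" for z
    proof -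
      have "\<exists>l\<in>{1..L t}. pmf (V t (c (t, j, l))) z \<noteq> 0"
      proof (rule ccontr)
        assume "\<not> ?thesis"
        then have "P c t j z = 0" by (simp add: P_def)
        then show False using that by simp
      qed
      then obtain l where "l \<in> {1..L t}" "z \<in> set_pmf (V t (c (t, j, l)))" by (auto simp: set_pmf_iff)
      then have "z \<in> set_pmf (bind_pmf (p t) (V t))" using cp[OF tj] by auto
      then show ?thesis by (simp add: Q_def pmf_positive)
    qed
    have "sum (Q t) C \<le> 1"
      unfolding Q_def using C by (simp flip: measure_measure_pmf_finite)
    also have "1 = sum (P c t j) C"
    proof -
      have "sum (P c t j) C = (\<Sum>l\<in>{1..L t}. \<Sum>z\<in>C. pmf (V t (c (t, j, l))) z) / real (L t)"
        unfolding P_def[abs_def] sum_divide_distrib[symmetric] by (subst sum.swap) simp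
      also have "\<dots> = 1" using V[OF tj(1)] cp[OF tj] L[of t] by simp
      finally show ?thesis ..
    qed
    finally show "sum (Q t) C \<le> sum (P c t j) C" .
  qed
  have F0: "F c j \<ge> 0" if "j \<in> {1..2 * J}" for j
    unfolding F_def using errL0 dv0 that by (intro sum_nonneg add_nonneg_nonneg)
  obtain g where g: "inj_on g {1..J}" "\<And>j. j \<in> {1..J} \<Longrightarrow> g j \<in> {1..2 * J} \<and> F c (g j) \<le> 2 * e"
    using select_half[OF F0 c(2) e] by blast
  have le: "(\<Sum>l\<in>{1..L t}. err c t (g j) l) / real (L t) \<le> 2 * e" "dv c t (g j) \<le> 2 * e"
    if tj: "t \<in> \<Theta>" "j \<in> {1..J}" for t j
  proof -
    have gj: "g j \<in> {1..2 * J}" using g(2) tj by blast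
    have "(\<Sum>l\<in>{1..L t}. err c t (g j) l) / real (L t) + dv c t (g j) \<le> F c (g j)"
      unfolding F_def using tj(1) gj \<Theta> errL0 dv0
      by (intro member_le_sum[where f = "\<lambda>t. (\<Sum>l\<in>{1..L t}. err c t (g j) l) / real (L t) + dv c t (g j)"]) auto
    then have "(\<Sum>l\<in>{1..L t}. err c t (g j) l) / real (L t) + dv c t (g j) \<le> 2 * e" using g(2)[OF tj(2)] by linarith
    then show "(\<Sum>l\<in>{1..L t}. err c t (g j) l) / real (L t) \<le> 2 * e" "dv c t (g j) \<le> 2 * e"
      using errL0[of t "g j"] dv0[OF tj(1) gj] by linarith+
  qed
  \<comment> \<open>Codewords of all states are tested, so the sets do not depend on the state.
    Discarded messages remain competitors, so \<open>err\<close> still dominates the error;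
    rejecting outputs on which another message passes makes the sets disjoint.\<close>
  define D where "D j = {y \<in> B. (\<exists>k\<in>I. fst (snd k) = g j \<and> s k (c k) y \<ge> ?g k) \<and> (\<forall>k\<in>K (g j). s k (c k) y < ?g k)}" for j
  show thesis
  proof (rule that[of "\<lambda>t j l. c (t, g j, l)" D])
    show "c (t, g j, l) \<in> set_pmf (p t)" if "t \<in> \<Theta>" "j \<in> {1..J}" "l \<in> {1..L t}" for t j l
      using cp g(2) that by blast
    show "D j \<subseteq> B" for j by (auto simp: D_def)
    show "disjoint_family_on D {1..J}"
      unfolding disjoint_family_on_def
    proof (intro ballI impI)
      fix m n assume mn: "m \<in> {1..J}" "n \<in> {1..J}" "m \<noteq> n"
      then have "g m \<noteq> g n" using inj_onD[OF g(1), of m n] by blast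
      show "D m \<inter> D n = {}"
      proof (rule equals0I)
        fix y assume y: "y \<in> D m \<inter> D n"
        then obtain k where k: "k \<in> I" "fst (snd k) = g m" "s k (c k) y \<ge> ?g k" by (auto simp: D_def)
        then have "k \<in> K (g n)" using \<open>g m \<noteq> g n\<close> by (simp add: K_def)
        then have "s k (c k) y < ?g k" using y by (simp add: D_def)
        then show False using k(3) by simp
      qed
    qed
    show "(\<Sum>l\<in>{1..L t}. \<Sum>y\<in>B - D j. pmf (W t (c (t, g j, l))) y) / real (L t) \<le> 2 * e"
      if tj: "t \<in> \<Theta>" "j \<in> {1..J}" for t j
    proof -
      have "(\<Sum>y\<in>B - D j. pmf (W t (c (t, g j, l))) y) \<le> err c t (g j) l" if l: "l \<in> {1..L t}" for l
      proof -
        have kI: "(t, g j, l) \<in> I" using tj l g(2) by (simp add: I_def)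
        have "s (t, g j, l) (c (t, g j, l)) y < \<gamma> t \<or> (\<exists>i\<in>K (g j). s i (c i) y \<ge> ?g i)" if "y \<in> B - D j" for y
        proof (rule ccontr)
          assume n: "\<not> ?thesis"
          have "\<exists>k\<in>I. fst (snd k) = g j \<and> s k (c k) y \<ge> ?g k"
            using n kI by (intro bexI[of _ "(t, g j, l)"]) auto
          moreover have "\<forall>k\<in>K (g j). s k (c k) y < ?g k" using n by force
          ultimately have "y \<in> D j" using that by (simp add: D_def)
          then show False using that by simp
        qed
        then have "(\<Sum>y\<in>B - D j. pmf (W t (c (t, g j, l))) y) = (\<Sum>y\<in>B - D j. pmf (W t (c (t, g j, l))) y *
            of_bool (s (t, g j, l) (c (t, g j, l)) y < \<gamma> t \<or> (\<exists>i\<in>K (g j). s i (c i) y \<ge> ?g i)))"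
          by (intro sum.cong refl) simp
        also have "\<dots> \<le> err c t (g j) l"
          unfolding err_def using B by (intro sum_mono2) auto
        finally show ?thesis .
      qed
      then have "(\<Sum>l\<in>{1..L t}. \<Sum>y\<in>B - D j. pmf (W t (c (t, g j, l))) y) / real (L t) \<le> (\<Sum>l\<in>{1..L t}. err c t (g j) l) / real (L t)"
        by (intro divide_right_mono sum_mono) auto
      then show ?thesis using le(1)[OF tj] by linarith
    qed
    show "(\<Sum>z\<in>C. (\<Sum>l\<in>{1..L t}. pmf (V t (c (t, g j, l))) z) / real (L t) *
          ln ((\<Sum>l\<in>{1..L t}. pmf (V t (c (t, g j, l))) z) / real (L t) / Q t z)) \<le> 2 * e"
      if "t \<in> \<Theta>" "j \<in> {1..J}" for t j
      using le(2)[OF that] unfolding dv_def P_def .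
  qed
qed

section \<open>Exponents for memoryless channels\<close>

text \<open>At s = 0 the mean of exp (s (x - a)) is 1 and its derivative, the mean of x minus a, is
  negative. The cap s <= 1 is there for \<open>ln_add_one_le_powr\<close>.\<close>

lemma chernoff_exponent:
  fixes w x :: "'i \<Rightarrow> real"
  assumes "(\<Sum>i\<in>S. w i) = 1" "(\<Sum>i\<in>S. w i * x i) < a"
  obtains s where "0 < s" "s \<le> 1" "(\<Sum>i\<in>S. w i * exp (s * (x i - a))) < 1"
proof -
  let ?f = "\<lambda>s. \<Sum>i\<in>S. w i * exp (s * (x i - a))"
  have "(?f has_real_derivative (\<Sum>i\<in>S. w i * (x i - a))) (at 0)"
    by (auto intro!: derivative_eq_intros sum.cong)
  moreover have "(\<Sum>i\<in>S. w i * (x i - a)) < 0"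
    using assms by (simp add: right_diff_distrib sum_subtractf flip: sum_distrib_right)
  ultimately obtain d where d: "d > 0" "\<And>h. 0 < h \<Longrightarrow> h < d \<Longrightarrow> ?f (0 + h) < ?f 0"
    using DERIV_neg_dec_right by blast
  show thesis
    using d(2)[of "min (d / 2) 1"] d(1) assms(1) by (intro that[of "min (d / 2) 1"]) auto
qed

section \<open>Product structure of words, channels and i.i.d. inputs\<close>

lemma sum_words_prod:
  fixes f :: "'a::finite \<Rightarrow> 'b::finite \<Rightarrow> real"
  shows "(\<Sum>u\<in>words n. \<Sum>y\<in>words n. \<Prod>i<n. f (u ! i) (y ! i)) = (\<Sum>a\<in>UNIV. \<Sum>b\<in>UNIV. f a b) ^ n"
proof (induction n)
  case (Suc n)
  have "(\<Sum>u\<in>words (Suc n). \<Sum>y\<in>words (Suc n). \<Prod>i<Suc n. f (u ! i) (y ! i))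
    = (\<Sum>a\<in>UNIV. \<Sum>u\<in>words n. \<Sum>b\<in>UNIV. \<Sum>y\<in>words n. f a b * (\<Prod>i<n. f (u ! i) (y ! i)))"
    unfolding sum_words_Suc prod.lessThan_Suc_shift by simp
  also have "\<dots> = (\<Sum>a\<in>UNIV. \<Sum>b\<in>UNIV. f a b * (\<Sum>u\<in>words n. \<Sum>y\<in>words n. \<Prod>i<n. f (u ! i) (y ! i)))"
    by (simp add: sum_distrib_left sum.swap[of _ UNIV "words n"])
  finally show ?case by (simp only: Suc sum_distrib_right[symmetric] power_Suc)
qed simp

text \<open>Absorbs a prefix channel into the physical channel, and gives the output law of an
  i.i.d. input.\<close>

lemma memoryless_bind:
  "bind_pmf (memoryless A xs) (memoryless B) = memoryless (\<lambda>x. bind_pmf (A x) B) xs"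
proof (induction xs)
  case (Cons x xs)
  have "bind_pmf (memoryless A (x # xs)) (memoryless B) =
    bind_pmf (A x) (\<lambda>y. bind_pmf (memoryless A xs) (\<lambda>ys. bind_pmf (B y) (\<lambda>z. bind_pmf (memoryless B ys) (\<lambda>zs. return_pmf (z # zs)))))"
    by (simp add: bind_assoc_pmf bind_return_pmf)
  \<comment> \<open>Independent draws are exchanged, so that the first letter passes both channels
    before the rest is drawn.\<close>
  also have "\<dots> = bind_pmf (A x) (\<lambda>y. bind_pmf (B y) (\<lambda>z. bind_pmf (memoryless A xs) (\<lambda>ys. bind_pmf (memoryless B ys) (\<lambda>zs. return_pmf (z # zs)))))"
    by (subst bind_commute_pmf) (rule refl)
  also have "\<dots> = memoryless (\<lambda>x. bind_pmf (A x) B) (x # xs)"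
    by (simp add: bind_assoc_pmf flip: Cons)
  finally show ?case .
qed (simp add: bind_return_pmf)

text \<open>Encoded as a memoryless channel with trivial input, so that facts such as
  \<open>memoryless_bind\<close> apply directly.\<close>

definition iid :: "'x pmf \<Rightarrow> nat \<Rightarrow> 'x list pmf" where
  "iid p n = memoryless (\<lambda>_. p) (replicate n ())"

lemma set_pmf_iid: "set_pmf (iid p n) \<subseteq> words n"
  using set_pmf_memoryless[of "\<lambda>_. p" "replicate n ()"] by (simp add: iid_def)

lemma finite_set_pmf_iid: "finite (set_pmf (iid (p :: 'x::finite pmf) n))"
  using set_pmf_iid finite_words by (rule finite_subset)

lemma pmf_iid: "u \<in> words n \<Longrightarrow> pmf (iid p n) u = (\<Prod>i<n. pmf p (u ! i))"
  by (simp add: iid_def pmf_memoryless words_def)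

lemma bind_iid: "bind_pmf (iid p n) (memoryless W) = iid (bind_pmf p W) n"
  by (simp add: iid_def memoryless_bind)

definition info_density :: "'a pmf \<Rightarrow> ('a \<Rightarrow> 'b pmf) \<Rightarrow> 'a \<Rightarrow> 'b \<Rightarrow> real" where
  "info_density p W u y = ln (pmf (W u) y / pmf (bind_pmf p W) y)"

definition info :: "'a::finite pmf \<Rightarrow> ('a \<Rightarrow> 'b::finite pmf) \<Rightarrow> real" where
  "info p W = (\<Sum>u\<in>UNIV. \<Sum>y\<in>UNIV. pmf p u * pmf (W u) y * info_density p W u y)"

lemma pmf_bind_pos:
  assumes "pmf p u \<noteq> 0" "pmf (W u) y \<noteq> 0"
  shows "pmf (bind_pmf p W) y > 0"
  using assms by (intro pmf_positive) (auto simp: set_pmf_iff)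

text \<open>An i.i.d. input has an i.i.d. output, so the likelihood ratio is a product. The nonzero
  weights make all its factors positive, which allows the logarithm to split.\<close>

lemma info_density_words:
  assumes "u \<in> words n" "y \<in> words n" and nz: "pmf (iid p n) u \<noteq> 0" "pmf (memoryless W u) y \<noteq> 0"
  shows "ln (pmf (memoryless W u) y / pmf (bind_pmf (iid p n) (memoryless W)) y)
    = (\<Sum>i<n. info_density p W (u ! i) (y ! i))"
proof -
  have W: "pmf (memoryless W u) y = (\<Prod>i<n. pmf (W (u ! i)) (y ! i))"
    using assms by (simp add: pmf_memoryless words_def)
  have "pmf p (u ! i) \<noteq> 0" "pmf (W (u ! i)) (y ! i) \<noteq> 0" if "i < n" for i
    using nz that assms(1) by (auto simp: W pmf_iid)
  then have pos: "pmf (W (u ! i)) (y ! i) / pmf (bind_pmf p W) (y ! i) > 0" if "i < n" for i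
    using that pmf_bind_pos[of p "u ! i" W "y ! i"] by (simp add: pmf_positive_iff set_pmf_iff)
  have "ln (\<Prod>i<n. pmf (W (u ! i)) (y ! i) / pmf (bind_pmf p W) (y ! i)) = (\<Sum>i<n. info_density p W (u ! i) (y ! i))"
    unfolding info_density_def by (rule ln_prod) (simp, metis pos lessThan_iff less_irrefl)
  then show ?thesis
    using assms(2) by (simp add: W bind_iid pmf_iid prod_dividef)
qed

text \<open>Exponential moments of a sum of independent terms factorise. \<open>\<sigma>\<close>
  will be negative for the lower tail and positive for the upper one.\<close>

lemma tilted_mean:
  fixes p :: "'a::finite pmf" and W :: "'a \<Rightarrow> 'b::finite pmf"
  shows "(\<Sum>u\<in>words n. \<Sum>y\<in>words n. pmf (iid p n) u * pmf (memoryless W u) y *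
      exp (\<sigma> * (\<Sum>i<n. info_density p W (u ! i) (y ! i)) - real n * b))
    = (\<Sum>u\<in>UNIV. \<Sum>y\<in>UNIV. pmf p u * pmf (W u) y * exp (\<sigma> * info_density p W u y - b)) ^ n"
proof -
  have "pmf (iid p n) u * pmf (memoryless W u) y * exp (\<sigma> * (\<Sum>i<n. info_density p W (u ! i) (y ! i)) - real n * b)
    = (\<Prod>i<n. pmf p (u ! i) * pmf (W (u ! i)) (y ! i) * exp (\<sigma> * info_density p W (u ! i) (y ! i) - b))"
    if "u \<in> words n" "y \<in> words n" for u y
  proof -
    have "exp (\<sigma> * (\<Sum>i<n. info_density p W (u ! i) (y ! i)) - real n * b)
      = exp (\<Sum>i<n. \<sigma> * info_density p W (u ! i) (y ! i) - b)"
      by (simp add: sum_subtractf sum_distrib_left)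
    then show ?thesis
      using that by (simp add: exp_sum prod.distrib pmf_iid pmf_memoryless words_def)
  qed
  then show ?thesis by (simp add: sum_words_prod[symmetric])
qed

lemma mean_iid:
  fixes p :: "'a::finite pmf"
  shows "mean (iid p n) f = (\<Sum>u\<in>words n. pmf (iid p n) u * f u)"
  using set_pmf_iid[of p n] by (subst integral_measure_pmf[of "words n"]) auto

lemma sum_info_weights:
  fixes p :: "'a::finite pmf" and W :: "'a \<Rightarrow> 'b::finite pmf"
  shows "(\<Sum>(u, y)\<in>UNIV. pmf p u * pmf (W u) y) = 1"
proof -
  have 1: "(\<Sum>y\<in>UNIV. pmf (W u) y) = 1" "(\<Sum>u\<in>UNIV. pmf p u) = 1" for u
    by (auto intro!: sum_pmf_eq_1)
  show ?thesis by (simp add: sum_UNIV_prod 1 flip: sum_distrib_left)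
qed

section \<open>Geometric bounds for the two tails of the information density\<close>

lemma threshold_exponent:
  fixes p :: "'a::finite pmf" and W :: "'a \<Rightarrow> 'b::finite pmf"
  assumes a: "a < info p W"
  obtains \<rho> where "0 \<le> \<rho>" "\<rho> < 1" "\<And>n. mean (iid p n) (\<lambda>u. \<Sum>y\<in>words n. pmf (memoryless W u) y *
      of_bool (pmf (memoryless W u) y / pmf (bind_pmf (iid p n) (memoryless W)) y < exp (real n * a))) \<le> \<rho> ^ n"
proof -
  \<comment> \<open>The sign is reversed to turn the lower tail into the upper tail handled by
    \<open>chernoff_exponent\<close>.\<close>
  have "(\<Sum>(u, y)\<in>UNIV. pmf p u * pmf (W u) y * (- info_density p W u y)) < - a"
    using a by (simp add: sum_UNIV_prod info_def sum_negf)
  then obtain s where s: "0 < s" "(\<Sum>(u, y)\<in>UNIV. pmf p u * pmf (W u) y * exp (s * (- info_density p W u y - - a))) < 1"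
    using chernoff_exponent[where S = UNIV and w = "\<lambda>(u, y). pmf p u * pmf (W u) y" and
        x = "\<lambda>(u, y). - info_density p W u y" and a = "- a"] sum_info_weights[of p W]
    by (auto simp: case_prod_unfold)
  define \<rho> where "\<rho> = (\<Sum>u\<in>UNIV. \<Sum>y\<in>UNIV. pmf p u * pmf (W u) y * exp (- s * info_density p W u y - - s * a))"
  have "\<rho> < 1" using s(2) by (simp add: \<rho>_def sum_UNIV_prod algebra_simps)
  moreover have "\<rho> \<ge> 0" by (auto simp: \<rho>_def intro!: sum_nonneg)
  moreover have "mean (iid p n) (\<lambda>u. \<Sum>y\<in>words n. pmf (memoryless W u) y *
      of_bool (pmf (memoryless W u) y / pmf (bind_pmf (iid p n) (memoryless W)) y < exp (real n * a))) \<le> \<rho> ^ n" for n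
  proof -
    have "mean (iid p n) (\<lambda>u. \<Sum>y\<in>words n. pmf (memoryless W u) y *
      of_bool (pmf (memoryless W u) y / pmf (bind_pmf (iid p n) (memoryless W)) y < exp (real n * a)))
      = (\<Sum>u\<in>words n. \<Sum>y\<in>words n. pmf (iid p n) u * pmf (memoryless W u) y *
      of_bool (pmf (memoryless W u) y / pmf (bind_pmf (iid p n) (memoryless W)) y < exp (real n * a)))"
      by (simp only: mean_iid sum_distrib_left mult.assoc)
    also have "\<dots> \<le> (\<Sum>u\<in>words n. \<Sum>y\<in>words n. pmf (iid p n) u * pmf (memoryless W u) y *
      exp (- s * (\<Sum>i<n. info_density p W (u ! i) (y ! i)) - real n * (- s * a)))"
    proof (intro sum_mono)
      fix u :: "'a list" and y :: "'b list" assume uy: "u \<in> words n" "y \<in> words n"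
      let ?r = "pmf (memoryless W u) y / pmf (bind_pmf (iid p n) (memoryless W)) y"
      show "pmf (iid p n) u * pmf (memoryless W u) y * of_bool (?r < exp (real n * a))
        \<le> pmf (iid p n) u * pmf (memoryless W u) y * exp (- s * (\<Sum>i<n. info_density p W (u ! i) (y ! i)) - real n * (- s * a))"
      proof (cases "pmf (iid p n) u = 0 \<or> pmf (memoryless W u) y = 0")
        case False
        then have nz: "pmf (iid p n) u \<noteq> 0" "pmf (memoryless W u) y \<noteq> 0" by auto
        have rp: "?r > 0" using pmf_bind_pos[of "iid p n" u "memoryless W" y, OF nz] nz by (simp add: pmf_positive_iff set_pmf_iff)
        have "of_bool (?r < exp (real n * a)) \<le> exp (s * (real n * a - ln ?r))"
        proof (cases "?r < exp (real n * a)")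
          case True
          then have "ln ?r < real n * a" using rp by (metis ln_exp ln_less_cancel_iff exp_gt_zero)
          then show ?thesis using s(1) by simp
        qed simp
        also have "\<dots> = exp (- s * (\<Sum>i<n. info_density p W (u ! i) (y ! i)) - real n * (- s * a))"
          unfolding info_density_words[OF uy nz] by (simp add: algebra_simps)
        finally show ?thesis by (intro mult_left_mono) auto
      qed auto
    qed
    also have "\<dots> = \<rho> ^ n" unfolding tilted_mean \<rho>_def ..
    finally show ?thesis .
  qed
  ultimately show thesis using that by blast
qed

text \<open>For x <= 1, ln (1 + x) <= x <= x^s; for x > 1, ln (1 + x) <= 1 + ln x and 1 + s ln x <=
  x^s. This power bound replaces a split into typical and atypical outputs.\<close>

lemma ln_add_one_le_powr:
  fixes s x :: real
  assumes "0 < s" "s \<le> 1" "0 < x"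
  shows "ln (1 + x) \<le> 2 / s * exp (s * ln x)"
proof (cases "x \<le> 1")
  case True
  have "ln (1 + x) \<le> x" using assms by (intro ln_add_one_self_le_self) auto
  also have "x = exp (ln x)" using assms by simp
  also have "\<dots> \<le> exp (s * ln x)"
    unfolding exp_le_cancel_iff using assms True mult_right_mono_neg[of s 1 "ln x"] by simp
  also have "\<dots> \<le> 2 / s * exp (s * ln x)" using assms by (simp add: field_simps)
  finally show ?thesis .
next
  case False
  have "ln (1 + x) \<le> ln (2 * x)" using False by (intro ln_mono) auto
  also have "\<dots> = ln 2 + ln x" using assms by (simp add: ln_mult)
  also have "\<dots> \<le> 1 + ln x" using ln_add_one_self_le_self[of "1::real"] by simp
  finally have "s * ln (1 + x) \<le> s * (1 + ln x)" using assms by simp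
  also have "\<dots> \<le> 1 + s * ln x" using assms by (simp add: distrib_left)
  also have "\<dots> \<le> exp (s * ln x)" by (rule exp_ge_add_one_self)
  also have "\<dots> \<le> 2 * exp (s * ln x)" by simp
  finally show ?thesis using assms by (simp add: field_simps)
qed

text \<open>The power bound on ln (1 + x) turns the covering error into an exponential moment of the
  density, tilted by \<open>s\<close>. It decays because \<open>a\<close> exceeds the mean
  \<open>info p V\<close>.\<close>

lemma resolvability_exponent:
  fixes p :: "'a::finite pmf" and V :: "'a \<Rightarrow> 'c::finite pmf"
  assumes a: "info p V < a"
  obtains \<rho> C where "0 \<le> \<rho>" "\<rho> < 1" "0 \<le> C" "\<And>n L. exp (real n * a) \<le> L \<Longrightarrow>
    mean (iid p n) (\<lambda>u. \<Sum>z\<in>words n. pmf (memoryless V u) z *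
      ln (1 + pmf (memoryless V u) z / (L * pmf (bind_pmf (iid p n) (memoryless V)) z))) \<le> C * \<rho> ^ n"
proof -
  have "(\<Sum>(u, y)\<in>UNIV. pmf p u * pmf (V u) y * info_density p V u y) < a"
    using a by (simp add: sum_UNIV_prod info_def)
  then obtain s where s: "0 < s" "s \<le> 1" "(\<Sum>(u, y)\<in>UNIV. pmf p u * pmf (V u) y * exp (s * (info_density p V u y - a))) < 1"
    using chernoff_exponent[where S = UNIV and w = "\<lambda>(u, y). pmf p u * pmf (V u) y" and
        x = "\<lambda>(u, y). info_density p V u y" and a = a] sum_info_weights[of p V]
    by (auto simp: case_prod_unfold)
  define \<rho> where "\<rho> = (\<Sum>u\<in>UNIV. \<Sum>y\<in>UNIV. pmf p u * pmf (V u) y * exp (s * info_density p V u y - s * a))"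
  have "\<rho> < 1" using s(3) by (simp add: \<rho>_def sum_UNIV_prod algebra_simps)
  moreover have "\<rho> \<ge> 0" by (auto simp: \<rho>_def intro!: sum_nonneg)
  moreover have "mean (iid p n) (\<lambda>u. \<Sum>z\<in>words n. pmf (memoryless V u) z *
      ln (1 + pmf (memoryless V u) z / (L * pmf (bind_pmf (iid p n) (memoryless V)) z))) \<le> 2 / s * \<rho> ^ n"
    if L: "exp (real n * a) \<le> L" for n L
  proof -
    have Lp: "L > 0" using L exp_gt_zero[of "real n * a"] by linarith
    have lnL: "real n * a \<le> ln L" using L Lp by (simp add: ln_ge_iff)
    have "mean (iid p n) (\<lambda>u. \<Sum>z\<in>words n. pmf (memoryless V u) z *
      ln (1 + pmf (memoryless V u) z / (L * pmf (bind_pmf (iid p n) (memoryless V)) z)))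
      = (\<Sum>u\<in>words n. \<Sum>z\<in>words n. pmf (iid p n) u * pmf (memoryless V u) z *
      ln (1 + pmf (memoryless V u) z / (L * pmf (bind_pmf (iid p n) (memoryless V)) z)))"
      by (simp only: mean_iid sum_distrib_left mult.assoc)
    also have "\<dots> \<le> (\<Sum>u\<in>words n. \<Sum>z\<in>words n. pmf (iid p n) u * pmf (memoryless V u) z *
      (2 / s * exp (s * (\<Sum>i<n. info_density p V (u ! i) (z ! i)) - real n * (s * a))))"
    proof (intro sum_mono)
      fix u :: "'a list" and z :: "'c list" assume uz: "u \<in> words n" "z \<in> words n"
      let ?q = "pmf (bind_pmf (iid p n) (memoryless V)) z"
      let ?x = "pmf (memoryless V u) z / (L * ?q)"
      show "pmf (iid p n) u * pmf (memoryless V u) z * ln (1 + ?x) \<le>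
        pmf (iid p n) u * pmf (memoryless V u) z *
          (2 / s * exp (s * (\<Sum>i<n. info_density p V (u ! i) (z ! i)) - real n * (s * a)))"
      proof (cases "pmf (iid p n) u = 0 \<or> pmf (memoryless V u) z = 0")
        case False
        then have nz: "pmf (iid p n) u \<noteq> 0" "pmf (memoryless V u) z \<noteq> 0" by auto
        have pos: "pmf (memoryless V u) z > 0" "?q > 0"
          using pmf_bind_pos[of "iid p n" u "memoryless V" z, OF nz] nz by (auto simp: pmf_positive_iff set_pmf_iff)
        have "ln (1 + ?x) \<le> 2 / s * exp (s * ln ?x)"
          using s pos Lp by (intro ln_add_one_le_powr) auto
        also have "ln ?x = ln (pmf (memoryless V u) z / ?q) - ln L"
          using pos Lp by (simp add: ln_div ln_mult)
        also have "2 / s * exp (s * (ln (pmf (memoryless V u) z / ?q) - ln L))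
            \<le> 2 / s * exp (s * (ln (pmf (memoryless V u) z / ?q) - real n * a))"
          using s lnL by (intro mult_left_mono) auto
        also have "s * (ln (pmf (memoryless V u) z / ?q) - real n * a)
            = s * (\<Sum>i<n. info_density p V (u ! i) (z ! i)) - real n * (s * a)"
          unfolding info_density_words[OF uz nz] by (simp add: algebra_simps)
        finally show ?thesis by (intro mult_left_mono) auto
      qed auto
    qed
    also have "\<dots> = 2 / s * \<rho> ^ n"
      unfolding \<rho>_def tilted_mean[symmetric] by (simp add: sum_distrib_left mult_ac)
    finally show ?thesis .
  qed
  moreover have "0 \<le> 2 / s" using s by simp
  ultimately show thesis using that by blast
qed

section \<open>Achievability\<close>

text \<open>Gibbs' inequality against the product of the marginals.\<close>

lemma mi_nonneg:
  assumes fin: "finite K" "finite B" and r: "\<And>k y. k \<in> K \<Longrightarrow> y \<in> B \<Longrightarrow> r k y \<ge> 0"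
    and 1: "(\<Sum>k\<in>K. \<Sum>y\<in>B. r k y) = 1"
  shows "mi K B r \<ge> 0"
proof -
  define rk where "rk k = (\<Sum>y\<in>B. r k y)" for k
  define ry where "ry y = (\<Sum>k\<in>K. r k y)" for y
  have "(\<Sum>(k, y)\<in>K \<times> B. rk k * ry y) = (\<Sum>k\<in>K. rk k) * (\<Sum>y\<in>B. ry y)"
    by (simp add: sum_product sum.cartesian_product)
  also have "(\<Sum>k\<in>K. rk k) = 1" using 1 by (simp add: rk_def)
  also have "(\<Sum>y\<in>B. ry y) = 1" unfolding ry_def using 1 by (subst sum.swap) simp
  finally have q: "(\<Sum>(k, y)\<in>K \<times> B. rk k * ry y) = 1" by simp
  have p: "(\<Sum>(k, y)\<in>K \<times> B. r k y) = 1"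
    using 1 by (simp add: sum.cartesian_product)
  have pos: "rk k > 0" "ry y > 0" if "k \<in> K" "y \<in> B" "r k y > 0" for k y
    unfolding rk_def ry_def using that fin r by (auto intro!: sum_pos2)
  have "0 \<le> (\<Sum>z\<in>K \<times> B. (case z of (k, y) \<Rightarrow> r k y) * ln ((case z of (k, y) \<Rightarrow> r k y) / (case z of (k, y) \<Rightarrow> rk k * ry y)))"
  proof (rule gibbs)
    show "finite (K \<times> B)" using fin by simp
    show "(\<Sum>z\<in>K \<times> B. case z of (k, y) \<Rightarrow> rk k * ry y) \<le> (\<Sum>z\<in>K \<times> B. case z of (k, y) \<Rightarrow> r k y)"
      using p q by simp
  qed (use r pos in \<open>auto simp: rk_def ry_def intro!: sum_nonneg mult_nonneg_nonneg\<close>)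
  also have "\<dots> = mi K B r"
    by (simp add: mi_def sum.cartesian_product case_prod_unfold rk_def ry_def)
  finally show ?thesis .
qed

text \<open>The mutual information is the average of D(P j || Q) minus D(R || Q), where
  \<open>R\<close> is the average output. The subtracted divergence is nonnegative, so every fixed
  reference \<open>Q\<close> gives an upper bound.\<close>

lemma mi_le_divergence:
  fixes P :: "nat \<Rightarrow> 'z \<Rightarrow> real"
  assumes J: "J \<ge> 1" and C: "finite C" and P: "\<And>j z. j \<in> {1..J} \<Longrightarrow> z \<in> C \<Longrightarrow> P j z \<ge> 0"
    and P1: "\<And>j. j \<in> {1..J} \<Longrightarrow> (\<Sum>z\<in>C. P j z) = 1"
    and Q: "\<And>z. z \<in> C \<Longrightarrow> Q z \<ge> 0" "(\<Sum>z\<in>C. Q z) \<le> 1"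
    and PQ: "\<And>j z. j \<in> {1..J} \<Longrightarrow> z \<in> C \<Longrightarrow> P j z > 0 \<Longrightarrow> Q z > 0"
    and d: "\<And>j. j \<in> {1..J} \<Longrightarrow> (\<Sum>z\<in>C. P j z * ln (P j z / Q z)) \<le> d"
  shows "mi {1..J} C (\<lambda>j z. P j z / real J) \<le> d"
proof -
  let ?K = "{1..J}"
  define R where "R z = (\<Sum>j\<in>?K. P j z / real J)" for z
  have Jp: "real J > 0" using J by simp
  have Rn: "R z \<ge> 0" if "z \<in> C" for z using P that by (auto simp: R_def intro!: sum_nonneg)
  have Rpos: "R z > 0" if "j \<in> ?K" "z \<in> C" "P j z > 0" for j z
    unfolding R_def using that P Jp by (intro sum_pos2[of ?K j]) auto
  have RQ: "Q z > 0" if z: "z \<in> C" and R: "R z > 0" for z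
  proof -
    have "\<exists>j\<in>?K. P j z \<noteq> 0"
    proof (rule ccontr)
      assume "\<not> ?thesis"
      then have "R z = 0" by (simp add: R_def)
      then show False using R by simp
    qed
    then obtain j where "j \<in> ?K" "P j z \<noteq> 0" by blast
    then show ?thesis using PQ P z by (metis less_eq_real_def)
  qed
  have R1: "(\<Sum>z\<in>C. R z) = 1"
    unfolding R_def using J by (subst sum.swap) (simp add: P1 flip: sum_divide_distrib)
  have g: "0 \<le> (\<Sum>z\<in>C. R z * ln (R z / Q z))"
    using C Rn Q RQ R1 by (intro gibbs) auto
  have "mi ?K C (\<lambda>j z. P j z / real J) = (\<Sum>j\<in>?K. \<Sum>z\<in>C. P j z / real J * ln (P j z / Q z) - P j z / real J * ln (R z / Q z))"
    unfolding mi_def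
  proof (intro sum.cong refl)
    fix j z assume jz: "j \<in> ?K" "z \<in> C"
    have s: "(\<Sum>y'\<in>C. P j y' / real J) = 1 / real J"
      using P1[OF jz(1)] by (simp flip: sum_divide_distrib)
    show "P j z / real J * ln (P j z / real J / ((\<Sum>y'\<in>C. P j y' / real J) * (\<Sum>k'\<in>?K. P k' z / real J)))
      = P j z / real J * ln (P j z / Q z) - P j z / real J * ln (R z / Q z)"
    proof (cases "P j z = 0")
      case False
      then have p: "P j z > 0" using P[OF jz] by simp
      have "P j z / real J / (1 / real J * R z) = P j z / R z" using Jp by simp
      then have "ln (P j z / real J / (1 / real J * R z)) = ln (P j z / Q z) - ln (R z / Q z)"
        using p Rpos[OF jz p] PQ[OF jz p] by (simp add: ln_div)
      then show ?thesis unfolding s R_def[symmetric] by (simp add: right_diff_distrib)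
    qed simp
  qed
  also have "\<dots> = (\<Sum>j\<in>?K. (\<Sum>z\<in>C. P j z * ln (P j z / Q z)) / real J) - (\<Sum>z\<in>C. \<Sum>j\<in>?K. P j z / real J * ln (R z / Q z))"
    unfolding sum_subtractf by (subst sum.swap[of _ C]) (simp add: sum_divide_distrib)
  also have "(\<Sum>z\<in>C. \<Sum>j\<in>?K. P j z / real J * ln (R z / Q z)) = (\<Sum>z\<in>C. R z * ln (R z / Q z))"
    by (simp add: R_def sum_distrib_right)
  also have "(\<Sum>j\<in>?K. (\<Sum>z\<in>C. P j z * ln (P j z / Q z)) / real J) \<le> (\<Sum>j\<in>?K. d / real J)"
    using d Jp by (intro sum_mono divide_right_mono) auto
  finally show ?thesis using g Jp by simp
qed

section \<open>Auxiliary variables as prefix channels\<close>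

lemma info_eq_mi:
  fixes p :: "'a::finite pmf" and W :: "'a \<Rightarrow> 'b::finite pmf"
  shows "info p W = mi UNIV UNIV (\<lambda>u y. pmf p u * pmf (W u) y)"
  unfolding info_def mi_def
proof (intro sum.cong refl)
  fix u y
  have "(\<Sum>y\<in>UNIV. pmf (W u) y) = 1" by (auto intro!: sum_pmf_eq_1)
  then have 1: "(\<Sum>y'\<in>UNIV. pmf p u * pmf (W u) y') = pmf p u" by (simp flip: sum_distrib_left)
  have 2: "(\<Sum>u'\<in>UNIV. pmf p u' * pmf (W u') y) = pmf (bind_pmf p W) y"
    by (simp add: pmf_bind_eq_sum[of UNIV])
  show "pmf p u * pmf (W u) y * info_density p W u y = pmf p u * pmf (W u) y *
      ln (pmf p u * pmf (W u) y / ((\<Sum>y'\<in>UNIV. pmf p u * pmf (W u) y') * (\<Sum>k'\<in>UNIV. pmf p k' * pmf (W k') y)))"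
    unfolding 1 2 info_density_def by (cases "pmf p u = 0") auto
qed

lemma info_nonneg: "info (p :: 'a::finite pmf) (W :: 'a \<Rightarrow> 'b::finite pmf) \<ge> 0"
  unfolding info_eq_mi using sum_info_weights[of p W] by (intro mi_nonneg) (auto simp: sum_UNIV_prod)

text \<open>Conditional laws; a value \<open>u\<close> of weight zero may be given any row.\<close>

lemma channel_from_joint:
  fixes G :: "('u::finite \<times> 'x::finite) pmf"
  shows "\<exists>K. \<forall>u x. pmf G (u, x) = pmf (map_pmf fst G) u * pmf (K u) x"
proof -
  have "\<exists>k. \<forall>x. pmf G (u, x) = pmf (map_pmf fst G) u * pmf k x" for u
  proof -
    have pu: "pmf (map_pmf fst G) u = (\<Sum>x\<in>UNIV. pmf G (u, x))"
      by (simp add: marginal_simps)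
    show ?thesis
    proof (cases "pmf (map_pmf fst G) u = 0")
      case True
      then have "\<forall>x\<in>UNIV. pmf G (u, x) = 0"
        unfolding pu by (subst (asm) sum_nonneg_eq_0_iff) auto
      then show ?thesis using True by simp
    next
      case False
      let ?f = "\<lambda>x. pmf G (u, x) / pmf (map_pmf fst G) u"
      have "(\<Sum>x\<in>UNIV. ?f x) = 1" using False by (simp add: pu flip: sum_divide_distrib)
      then have "(\<integral>\<^sup>+x. ennreal (?f x) \<partial>count_space UNIV) = 1"
        by (simp add: nn_integral_count_space_finite sum_ennreal)
      then have "pmf (embed_pmf ?f) x = ?f x" for x by (intro pmf_embed_pmf) auto
      then show ?thesis using False by (intro exI[of _ "embed_pmf ?f"]) simp
    qed
  qed
  then show ?thesis by metis
qed

text \<open>The passage from \<open>U\<close> to \<open>X\<close> becomes a prefix channel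
  \<open>K\<close>, so codewords can be drawn in \<open>U\<close> and sent through
  \<open>K\<close>.\<close>

lemma secrecy_value_info:
  fixes W :: "'a::finite \<Rightarrow> 'b::finite pmf" and V :: "'a \<Rightarrow> 'c::finite pmf"
  assumes "m \<in> secrecy_values W V"
  obtains p K where "m * ln 2 = info p (\<lambda>u :: 'a. bind_pmf (K u) W) - info p (\<lambda>u. bind_pmf (K u) V)"
proof -
  obtain P where P: "P \<in> wiretap_laws W V"
    and m: "m = mutual_info P (\<lambda>(u, x, y, z). u) (\<lambda>(u, x, y, z). y)
        - mutual_info P (\<lambda>(u, x, y, z). u) (\<lambda>(u, x, y, z). z)"
    using assms by (auto simp: secrecy_values_def)
  define G where "G = map_pmf (\<lambda>(u, x, y, z). (u, x)) P"
  obtain K where K: "\<And>u x. pmf G (u, x) = pmf (map_pmf fst G) u * pmf (K u) x"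
    using channel_from_joint[of G] by blast
  have out: "(\<Sum>x\<in>UNIV. pmf G (u, x) * pmf (M x) y) = pmf (map_pmf fst G) u * pmf (bind_pmf (K u) M) y"
    for u y and M :: "'a \<Rightarrow> 'out pmf"
    by (simp add: K pmf_bind_eq_sum[of UNIV "K u"] sum_distrib_left mult.assoc)
  have "m * ln 2 = info (map_pmf fst G) (\<lambda>u. bind_pmf (K u) W) - info (map_pmf fst G) (\<lambda>u. bind_pmf (K u) V)"
    unfolding info_eq_mi out[symmetric] m left_diff_distrib wiretap_value[OF P, folded G_def] ..
  then show thesis using that by blast
qed

section \<open>From codebooks to codes with CSI\<close>

lemma Max_image_between:
  fixes g :: "'i \<Rightarrow> real"
  assumes "finite S" "S \<noteq> {}" "\<And>t. t \<in> S \<Longrightarrow> lo \<le> g t \<and> g t \<le> hi"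
  shows "lo \<le> (MAX t\<in>S. g t) \<and> (MAX t\<in>S. g t) \<le> hi"
proof
  obtain t where t: "t \<in> S" using assms by blast
  have "lo \<le> g t" using assms t by blast
  also have "g t \<le> (MAX t\<in>S. g t)" using assms t by (intro Max_ge) auto
  finally show "lo \<le> (MAX t\<in>S. g t)" .
  show "(MAX t\<in>S. g t) \<le> hi" using assms by (intro Max.boundedI) auto
qed

text \<open>The encoder sends a uniformly drawn codeword of the message through the prefix channel,
  so the outputs are those of \<open>W'\<close> and \<open>V'\<close>. A divergence bound for each
  message dominates the leakage; division by \<open>ln 2\<close> converts it to bits.\<close>

lemma csi_code_bounds:
  fixes W :: "nat \<Rightarrow> 'a::finite \<Rightarrow> 'b::finite pmf" and V :: "nat \<Rightarrow> 'a \<Rightarrow> 'c::finite pmf"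
    and K :: "nat \<Rightarrow> 'a \<Rightarrow> 'a pmf" and p :: "nat \<Rightarrow> 'a pmf" and L :: "nat \<Rightarrow> nat"
  defines "W' \<equiv> \<lambda>t u. bind_pmf (K t u) (W t)" and "V' \<equiv> \<lambda>t u. bind_pmf (K t u) (V t)"
  assumes T: "T \<ge> 1" and J: "J \<ge> 1" and L: "\<And>t. L t \<ge> 1"
    and c: "\<And>t j l. t \<in> {1..T} \<Longrightarrow> j \<in> {1..J} \<Longrightarrow> l \<in> {1..L t} \<Longrightarrow> c t j l \<in> set_pmf (iid (p t) n)"
    and D: "\<And>j. D j \<subseteq> words n" and disj: "disjoint_family_on D {1..J}"
    and err: "\<And>t j. t \<in> {1..T} \<Longrightarrow> j \<in> {1..J} \<Longrightarrow>
        (\<Sum>l\<in>{1..L t}. \<Sum>y\<in>words n - D j. pmf (memoryless (W' t) (c t j l)) y) / real (L t) \<le> e"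
    and div: "\<And>t j. t \<in> {1..T} \<Longrightarrow> j \<in> {1..J} \<Longrightarrow>
        (\<Sum>z\<in>words n. (\<Sum>l\<in>{1..L t}. pmf (memoryless (V' t) (c t j l)) z) / real (L t) *
          ln ((\<Sum>l\<in>{1..L t}. pmf (memoryless (V' t) (c t j l)) z) / real (L t) /
            pmf (bind_pmf (iid (p t) n) (memoryless (V' t))) z)) \<le> e"
  defines "E \<equiv> \<lambda>t j. bind_pmf (pmf_of_set {1..L t}) (\<lambda>l. memoryless (K t) (c t j l))"
  shows "csi_code T n J E D"
    and "0 \<le> csi_error T W n J E D \<and> csi_error T W n J E D \<le> e"
    and "0 \<le> csi_leakage T V J E \<and> csi_leakage T V J E \<le> e / ln 2"
proof -
  have Lne: "{1..L t} \<noteq> {}" for t using L[of t] by simp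
  have Lp: "real (L t) > 0" for t using L[of t] by simp
  have cw: "c t j l \<in> words n" if "t \<in> {1..T}" "j \<in> {1..J}" "l \<in> {1..L t}" for t j l
    using c[OF that] set_pmf_iid by blast
  have E: "set_pmf (E t j) \<subseteq> words n" if tj: "t \<in> {1..T}" "j \<in> {1..J}" for t j
  proof
    fix x assume "x \<in> set_pmf (E t j)"
    then obtain l where l: "l \<in> {1..L t}" "x \<in> set_pmf (memoryless (K t) (c t j l))"
      using Lne[of t] by (auto simp: E_def)
    then show "x \<in> words n" using set_pmf_memoryless[of "K t" "c t j l"] cw[OF tj l(1)] by (auto simp: words_def)
  qed
  have out: "pmf (bind_pmf (E t j) (memoryless M)) y
      = (\<Sum>l\<in>{1..L t}. pmf (memoryless (\<lambda>u. bind_pmf (K t u) M) (c t j l)) y) / real (L t)"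
    for t j y and M :: "'a \<Rightarrow> 'out pmf"
    unfolding E_def bind_assoc_pmf memoryless_bind using Lne[of t] by (subst pmf_bind_pmf_of_set) auto
  show "csi_code T n J E D"
    using J E D disj by (simp add: csi_code_def)
  show "0 \<le> csi_error T W n J E D \<and> csi_error T W n J E D \<le> e"
    unfolding csi_error_def
  proof (intro Max_image_between)
    fix t j assume tj: "t \<in> {1..T}" "j \<in> {1..J}"
    let ?s = "\<Sum>x\<in>words n. pmf (E t j) x * measure_pmf.prob (memoryless (W t) x) (words n - D j)"
    have "?s = (\<Sum>x\<in>words n. \<Sum>y\<in>words n - D j. pmf (E t j) x * pmf (memoryless (W t) x) y)"
      by (simp add: measure_measure_pmf_finite sum_distrib_left)
    also have "\<dots> = (\<Sum>y\<in>words n - D j. pmf (bind_pmf (E t j) (memoryless (W t))) y)"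
      using E[OF tj] by (subst sum.swap) (simp add: pmf_bind_eq_sum[of "words n"])
    also have "\<dots> = (\<Sum>l\<in>{1..L t}. \<Sum>y\<in>words n - D j. pmf (memoryless (W' t) (c t j l)) y) / real (L t)"
      unfolding out W'_def sum_divide_distrib[symmetric] by (subst sum.swap) (rule refl)
    also have "\<dots> \<le> e" by (rule err[OF tj])
    finally show "0 \<le> ?s \<and> ?s \<le> e" by (simp add: sum_nonneg)
  qed (use T J in auto)
  show "0 \<le> csi_leakage T V J E \<and> csi_leakage T V J E \<le> e / ln 2"
    unfolding csi_leakage_def
  proof (intro Max_image_between)
    fix t assume t: "t \<in> {1..T}"
    let ?I = "mutual_info (message_output (V t) J (E t)) fst snd"
    define P where "P j z = pmf (bind_pmf (E t j) (memoryless (V t))) z" for j z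
    define Q where "Q z = pmf (bind_pmf (iid (p t) n) (memoryless (V' t))) z" for z
    have PL: "P j z = (\<Sum>l\<in>{1..L t}. pmf (memoryless (V' t) (c t j l)) z) / real (L t)" for j z
      unfolding P_def out V'_def ..
    have "?I * ln 2 = mi {1..J} (words n) (\<lambda>j z. \<Sum>x\<in>words n. pmf (E t j) x / real J * pmf (memoryless (V t) x) z)"
      by (rule mutual_info_message_output[OF J E[OF t]])
    also have "\<dots> = mi {1..J} (words n) (\<lambda>j z. P j z / real J)"
      using E[OF t] by (intro mi_cong) (simp add: P_def pmf_bind_eq_sum[of "words n"] sum_divide_distrib)
    finally have I: "?I * ln 2 = mi {1..J} (words n) (\<lambda>j z. P j z / real J)" .
    have P1: "(\<Sum>z\<in>words n. P j z) = 1" if "j \<in> {1..J}" for j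
      unfolding P_def using E[OF t that] set_pmf_memoryless[of "V t"]
      by (intro sum_pmf_eq_1 finite_words) (fastforce simp: words_def)
    have "mi {1..J} (words n) (\<lambda>j z. P j z / real J) \<le> e"
    proof (rule mi_le_divergence[OF J finite_words _ P1])
      show "(\<Sum>z\<in>words n. Q z) \<le> 1"
        unfolding Q_def by (simp flip: measure_measure_pmf_finite)
      \<comment> \<open>A positive output weight stems from a codeword in the support of the i.i.d.
        law, so the reference law charges the same output.\<close>
      show "Q z > 0" if j: "j \<in> {1..J}" and "P j z > 0" for j z
      proof -
        have "\<exists>l\<in>{1..L t}. pmf (memoryless (V' t) (c t j l)) z \<noteq> 0"
        proof (rule ccontr)
          assume "\<not> ?thesis"
          then have "P j z = 0" by (simp add: PL)
          then show False using that by simp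
        qed
        then obtain l where l: "l \<in> {1..L t}" "pmf (memoryless (V' t) (c t j l)) z \<noteq> 0" by blast
        have "pmf (iid (p t) n) (c t j l) \<noteq> 0" using c[OF t j l(1)] by (simp add: set_pmf_iff)
        then show ?thesis unfolding Q_def using l(2) by (rule pmf_bind_pos)
      qed
      show "(\<Sum>z\<in>words n. P j z * ln (P j z / Q z)) \<le> e" if "j \<in> {1..J}" for j
        unfolding PL Q_def by (rule div[OF t that])
    qed (auto simp: P_def Q_def)
    moreover have "mi {1..J} (words n) (\<lambda>j z. P j z / real J) \<ge> 0"
      using P1 J by (intro mi_nonneg) (auto simp: P_def simp flip: sum_divide_distrib)
    ultimately show "0 \<le> ?I \<and> ?I \<le> e / ln 2"
      unfolding I[symmetric] by (simp add: zero_le_mult_iff pos_le_divide_eq)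
  qed (use T in auto)
qed

text \<open>A single message, sent as a fixed word and decoded from every output, causes no error
  and leaks nothing. It makes the capacity nonnegative, as the random code covers only positive
  rates.\<close>

lemma csi_achievable_zero:
  fixes W :: "nat \<Rightarrow> 'a::finite \<Rightarrow> 'b::finite pmf" and V :: "nat \<Rightarrow> 'a \<Rightarrow> 'c::finite pmf"
  assumes T: "T \<ge> 1"
  shows "csi_achievable T W V 0"
proof -
  define E :: "nat \<Rightarrow> nat \<Rightarrow> nat \<Rightarrow> 'a list pmf" where "E n t j = return_pmf (replicate n undefined)" for n t j
  define D :: "nat \<Rightarrow> nat \<Rightarrow> 'b list set" where "D n j = words n" for n j
  have E: "set_pmf (E n t j) \<subseteq> words n" for n t j by (simp add: E_def words_def)
  have "csi_code T n 1 (E n) (D n)" for n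
    using E by (simp add: csi_code_def D_def disjoint_family_on_def)
  moreover have "csi_error T W n 1 (E n) (D n) = 0" for n
    using T by (simp add: csi_error_def D_def)
  moreover have "csi_leakage T V 1 (E n) = 0" for n
  proof -
    have "mutual_info (message_output (V t) 1 (E n t)) fst snd = 0" for t
    proof -
      define r where "r z = (\<Sum>x\<in>words n. pmf (E n t 1) x * pmf (memoryless (V t) x) z)" for z
      have "r z = pmf (bind_pmf (E n t 1) (memoryless (V t))) z" for z
        using E by (simp add: r_def pmf_bind_eq_sum[of "words n"])
      then have "(\<Sum>z\<in>words n. r z) = 1"
        using set_pmf_memoryless[of "V t" "replicate n undefined"]
        by (simp add: E_def bind_return_pmf sum_pmf_eq_1)
      then have "r z * ln (r z / (sum r (words n) * r z)) = 0" for z by simp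
      moreover have "mutual_info (message_output (V t) 1 (E n t)) fst snd * ln 2
          = (\<Sum>z\<in>words n. r z * ln (r z / (sum r (words n) * r z)))"
        using E by (subst mutual_info_message_output[of 1 "E n t" n]) (auto simp: mi_def r_def[abs_def])
      ultimately have "mutual_info (message_output (V t) 1 (E n t)) fst snd * ln 2 = 0"
        by (simp only: sum.neutral_const)
      then show ?thesis by simp
    qed
    then show ?thesis using T by (simp add: csi_leakage_def)
  qed
  ultimately show ?thesis
    unfolding csi_achievable_def
    by (intro conjI exI[of _ "\<lambda>_. 1"] exI[of _ E] exI[of _ D]) (simp_all add: Liminf_const flip: zero_ereal_def)
qed

lemma ceiling_exp_bounds:
  assumes "x \<ge> (0::real)"
  shows "exp x \<le> real (nat \<lceil>exp x\<rceil>)" "real (nat \<lceil>exp x\<rceil>) \<le> 2 * exp x"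
proof -
  show "exp x \<le> real (nat \<lceil>exp x\<rceil>)" by linarith
  have "real (nat \<lceil>exp x\<rceil>) \<le> exp x + 1"
    using exp_gt_zero[of x] by linarith
  also have "1 \<le> exp x" using assms by simp
  finally show "real (nat \<lceil>exp x\<rceil>) \<le> 2 * exp x" by simp
qed

text \<open>The slack of each state is split into three equal margins: for the receiver's threshold,
  for the covering rate, and for the decay of the number of codewords over the threshold.\<close>

lemma csi_achievable_below:
  fixes W :: "nat \<Rightarrow> 'a::finite \<Rightarrow> 'b::finite pmf" and V :: "nat \<Rightarrow> 'a \<Rightarrow> 'c::finite pmf"
    and K :: "nat \<Rightarrow> 'a \<Rightarrow> 'a pmf" and p :: "nat \<Rightarrow> 'a pmf"
  defines "W' \<equiv> \<lambda>t u. bind_pmf (K t u) (W t)" and "V' \<equiv> \<lambda>t u. bind_pmf (K t u) (V t)"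
  assumes T: "T \<ge> 1" and R: "R > 0"
    and gap: "\<And>t. t \<in> {1..T} \<Longrightarrow> R * ln 2 < info (p t) (W' t) - info (p t) (V' t)"
  shows "csi_achievable T W V R"
proof -
  let ?\<Theta> = "{1..T}"
  define d where "d t = (info (p t) (W' t) - info (p t) (V' t) - R * ln 2) / 3" for t
  define a where "a t = info (p t) (W' t) - d t" for t
  \<comment> \<open>The absolute value keeps \<open>b\<close> nonnegative also at indices that are
    not states, where \<open>d\<close> may be negative; the rounding bounds on \<open>L\<close> rely
    on it.\<close>
  define b where "b t = info (p t) (V' t) + \<bar>d t\<bar>" for t
  have d: "d t > 0" if "t \<in> ?\<Theta>" for t using gap[OF that] by (simp add: d_def)
  have b0: "b t \<ge> 0" for t unfolding b_def using info_nonneg[of "p t" "V' t"] by simp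
  have abd: "R * ln 2 + b t - a t = - d t" if "t \<in> ?\<Theta>" for t
    using d[OF that] by (simp add: a_def b_def) (simp add: d_def field_simps)
  let ?A = "\<lambda>t n. mean (iid (p t) n) (\<lambda>u. \<Sum>y\<in>words n. pmf (memoryless (W' t) u) y *
      of_bool (pmf (memoryless (W' t) u) y / pmf (bind_pmf (iid (p t) n) (memoryless (W' t))) y < exp (real n * a t)))"
  let ?B = "\<lambda>t n L. mean (iid (p t) n) (\<lambda>u. \<Sum>z\<in>words n. pmf (memoryless (V' t) u) z *
      ln (1 + pmf (memoryless (V' t) u) z / (L * pmf (bind_pmf (iid (p t) n) (memoryless (V' t))) z)))"
  have "\<exists>\<rho>. 0 \<le> \<rho> \<and> \<rho> < 1 \<and> (\<forall>n. ?A t n \<le> \<rho> ^ n)" if "t \<in> ?\<Theta>" for t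
  proof -
    have "a t < info (p t) (W' t)" using d[OF that] by (simp add: a_def)
    then show ?thesis by (rule threshold_exponent) blast
  qed
  then have "\<forall>t\<in>?\<Theta>. \<exists>\<rho>. 0 \<le> \<rho> \<and> \<rho> < 1 \<and> (\<forall>n. ?A t n \<le> \<rho> ^ n)" by blast
  from bchoice[OF this] obtain \<alpha> where \<alpha>: "\<And>t. t \<in> ?\<Theta> \<Longrightarrow> 0 \<le> \<alpha> t" "\<And>t. t \<in> ?\<Theta> \<Longrightarrow> \<alpha> t < 1"
    and A: "\<And>t n. t \<in> ?\<Theta> \<Longrightarrow> ?A t n \<le> \<alpha> t ^ n" by blast
  have "\<exists>\<rho>C. 0 \<le> fst \<rho>C \<and> fst \<rho>C < 1 \<and> 0 \<le> snd \<rho>C \<and> (\<forall>n L. exp (real n * b t) \<le> L \<longrightarrow> ?B t n L \<le> snd \<rho>C * fst \<rho>C ^ n)"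
    if "t \<in> ?\<Theta>" for t
  proof -
    have "info (p t) (V' t) < b t" using d[OF that] by (simp add: b_def)
    then obtain \<rho> C where "0 \<le> \<rho>" "\<rho> < 1" "0 \<le> C" "\<And>n L. exp (real n * b t) \<le> L \<Longrightarrow> ?B t n L \<le> C * \<rho> ^ n"
      by (rule resolvability_exponent) blast
    then show ?thesis by (intro exI[of _ "(\<rho>, C)"]) simp
  qed
  then have "\<forall>t\<in>?\<Theta>. \<exists>\<rho>C. 0 \<le> fst \<rho>C \<and> fst \<rho>C < 1 \<and> 0 \<le> snd \<rho>C \<and> (\<forall>n L. exp (real n * b t) \<le> L \<longrightarrow> ?B t n L \<le> snd \<rho>C * fst \<rho>C ^ n)"
    by blast
  from bchoice[OF this] obtain \<beta> where \<beta>: "\<And>t. t \<in> ?\<Theta> \<Longrightarrow> 0 \<le> fst (\<beta> t)" "\<And>t. t \<in> ?\<Theta> \<Longrightarrow> fst (\<beta> t) < 1"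
    "\<And>t. t \<in> ?\<Theta> \<Longrightarrow> 0 \<le> snd (\<beta> t)"
    and B: "\<And>t n L. t \<in> ?\<Theta> \<Longrightarrow> exp (real n * b t) \<le> L \<Longrightarrow> ?B t n L \<le> snd (\<beta> t) * fst (\<beta> t) ^ n" by blast
  \<comment> \<open>The geometric bounds on the error sources, plus 1 / (n + 1) to guarantee
    positivity, as the choice of the better half of the messages demands.\<close>
  define e where "e n = (\<Sum>t\<in>?\<Theta>. \<alpha> t ^ n + (\<Sum>t'\<in>?\<Theta>. 8 * exp (- d t') ^ n) + snd (\<beta> t) * fst (\<beta> t) ^ n) + inverse (real (Suc n))" for n
  have e_pos: "e n > 0" for n
    unfolding e_def using \<alpha> \<beta> by (intro add_nonneg_pos sum_nonneg add_nonneg_nonneg mult_nonneg_nonneg zero_le_power) auto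
  have "e \<longlonglongrightarrow> (\<Sum>t\<in>?\<Theta>. 0 + (\<Sum>t'\<in>?\<Theta>. 8 * 0) + snd (\<beta> t) * 0) + 0"
    unfolding e_def[abs_def]
    using \<alpha> \<beta> d by (intro tendsto_add tendsto_sum tendsto_mult tendsto_const LIMSEQ_power_zero LIMSEQ_inverse_real_of_nat) auto
  then have e_lim: "e \<longlonglongrightarrow> 0" by simp
  define J where "J n = nat \<lceil>exp (real n * (R * ln 2))\<rceil>" for n
  define L where "L n t = nat \<lceil>exp (real n * b t)\<rceil>" for n t
  have Jb: "exp (real n * (R * ln 2)) \<le> real (J n)" "real (J n) \<le> 2 * exp (real n * (R * ln 2))" for n
    unfolding J_def using R by (intro ceiling_exp_bounds; simp)+
  have Lb: "exp (real n * b t) \<le> real (L n t)" "real (L n t) \<le> 2 * exp (real n * b t)" for n t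
    unfolding L_def using b0 by (intro ceiling_exp_bounds; simp)+
  have J1: "J n \<ge> 1" for n using Jb(1)[of n] exp_gt_zero[of "real n * (R * ln 2)"] by (cases "J n") auto
  have L1: "L n t \<ge> 1" for n t using Lb(1)[of n t] exp_gt_zero[of "real n * b t"] by (cases "L n t") auto
  have "\<exists>E D. csi_code T n (J n) E D \<and> (0 \<le> csi_error T W n (J n) E D \<and> csi_error T W n (J n) E D \<le> 2 * e n) \<and>
      (0 \<le> csi_leakage T V (J n) E \<and> csi_leakage T V (J n) E \<le> 2 * e n / ln 2)" for n
  proof -
    have bound: "(\<Sum>t\<in>?\<Theta>. ?A t n + (\<Sum>t'\<in>?\<Theta>. real (2 * J n * L n t') / exp (real n * a t')) + ?B t n (real (L n t))) \<le> e n"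
    proof -
      \<comment> \<open>The 8 is made of the doubled number of messages and of the roundings in
        \<open>J\<close> and \<open>L\<close>, each costing at most a factor 2.\<close>
      have "real (2 * J n * L n t') / exp (real n * a t') \<le> 8 * exp (- d t') ^ n" if t': "t' \<in> ?\<Theta>" for t'
      proof -
        have "real (J n) * real (L n t') \<le> (2 * exp (real n * (R * ln 2))) * (2 * exp (real n * b t'))"
          by (intro mult_mono Jb Lb) auto
        then have "real (2 * J n * L n t') / exp (real n * a t') \<le> 8 * (exp (real n * (R * ln 2)) * exp (real n * b t')) / exp (real n * a t')"
          by (intro divide_right_mono) (auto simp: mult_ac)
        also have "\<dots> = 8 * exp (real n * (R * ln 2 + b t' - a t'))"
          by (simp add: right_diff_distrib distrib_left exp_add exp_diff)
        also have "\<dots> = 8 * exp (- d t') ^ n" unfolding abd[OF t'] by (simp only: exp_of_nat_mult)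
        finally show ?thesis .
      qed
      then have "(\<Sum>t\<in>?\<Theta>. ?A t n + (\<Sum>t'\<in>?\<Theta>. real (2 * J n * L n t') / exp (real n * a t')) + ?B t n (real (L n t)))
        \<le> (\<Sum>t\<in>?\<Theta>. \<alpha> t ^ n + (\<Sum>t'\<in>?\<Theta>. 8 * exp (- d t') ^ n) + snd (\<beta> t) * fst (\<beta> t) ^ n)"
        by (intro sum_mono add_mono A B Lb) auto
      also have "\<dots> \<le> e n" by (simp add: e_def)
      finally show ?thesis .
    qed
    obtain c D where "\<And>t j l. t \<in> ?\<Theta> \<Longrightarrow> j \<in> {1..J n} \<Longrightarrow> l \<in> {1..L n t} \<Longrightarrow> c t j l \<in> set_pmf (iid (p t) n)"
      and "\<And>j. D j \<subseteq> words n" and "disjoint_family_on D {1..J n}"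
      and "\<And>t j. t \<in> ?\<Theta> \<Longrightarrow> j \<in> {1..J n} \<Longrightarrow>
        (\<Sum>l\<in>{1..L n t}. \<Sum>y\<in>words n - D j. pmf (memoryless (W' t) (c t j l)) y) / real (L n t) \<le> 2 * e n"
      and "\<And>t j. t \<in> ?\<Theta> \<Longrightarrow> j \<in> {1..J n} \<Longrightarrow>
        (\<Sum>z\<in>words n. (\<Sum>l\<in>{1..L n t}. pmf (memoryless (V' t) (c t j l)) z) / real (L n t) *
          ln ((\<Sum>l\<in>{1..L n t}. pmf (memoryless (V' t) (c t j l)) z) / real (L n t) /
            pmf (bind_pmf (iid (p t) n) (memoryless (V' t))) z)) \<le> 2 * e n"
    proof (rule one_shot_code[of ?\<Theta> "\<lambda>t. iid (p t) n" "words n" "words n" "\<lambda>t. memoryless (V' t)" "L n"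
          "\<lambda>t. exp (real n * a t)" "e n" "\<lambda>t. memoryless (W' t)" "J n"])
      show "(\<Sum>z\<in>words n. pmf (memoryless (V' t) u) z) = 1" if "u \<in> set_pmf (iid (p t) n)" for t u
        using that set_pmf_iid[of "p t" n] stochastic_on_memoryless[of n "V' t"] by (auto simp: stochastic_on_def)
    qed (use bound L1 e_pos finite_set_pmf_iid in auto)
    from csi_code_bounds[where K = K and W = W and V = V and p = p, OF T J1 L1 this[unfolded W'_def V'_def]]
    show ?thesis by blast
  qed
  then have "\<forall>n. \<exists>ED. csi_code T n (J n) (fst ED) (snd ED) \<and>
      (0 \<le> csi_error T W n (J n) (fst ED) (snd ED) \<and> csi_error T W n (J n) (fst ED) (snd ED) \<le> 2 * e n) \<and>
      (0 \<le> csi_leakage T V (J n) (fst ED) \<and> csi_leakage T V (J n) (fst ED) \<le> 2 * e n / ln 2)"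
    by simp
  from choice[OF this] obtain F where F: "\<And>n. csi_code T n (J n) (fst (F n)) (snd (F n))"
    "\<And>n. 0 \<le> csi_error T W n (J n) (fst (F n)) (snd (F n))" "\<And>n. csi_error T W n (J n) (fst (F n)) (snd (F n)) \<le> 2 * e n"
    "\<And>n. 0 \<le> csi_leakage T V (J n) (fst (F n))" "\<And>n. csi_leakage T V (J n) (fst (F n)) \<le> 2 * e n / ln 2"
    by blast
  have e2: "(\<lambda>n. 2 * e n) \<longlonglongrightarrow> 0" using tendsto_mult_right_zero[OF e_lim, of 2] by simp
  have "(\<lambda>n. csi_error T W n (J n) (fst (F n)) (snd (F n))) \<longlonglongrightarrow> 0"
    by (rule tendsto_sandwich[OF _ _ tendsto_const e2]) (simp_all add: F)
  moreover have "(\<lambda>n. csi_leakage T V (J n) (fst (F n))) \<longlonglongrightarrow> 0"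
    by (rule tendsto_sandwich[OF _ _ tendsto_const tendsto_divide_zero[OF e2, of "ln 2"]]) (simp_all add: F)
  moreover have "liminf (\<lambda>n. ereal (log 2 (real (J n)) / real n)) \<ge> ereal R"
  proof (rule Liminf_bounded)
    show "\<forall>\<^sub>F n in sequentially. ereal R \<le> ereal (log 2 (real (J n)) / real n)"
      using eventually_gt_at_top[of 0]
    proof eventually_elim
      case (elim n)
      have "real n * (R * ln 2) \<le> ln (real (J n))"
        using Jb(1)[of n] J1[of n] by (simp add: ln_ge_iff)
      then have "R \<le> log 2 (real (J n)) / real n" using elim by (simp add: log_def field_simps)
      then show ?case by simp
    qed
  qed
  ultimately show ?thesis
    unfolding csi_achievable_def using R F(1)
    by (intro conjI exI[of _ J] exI[of _ "\<lambda>n. fst (F n)"] exI[of _ "\<lambda>n. snd (F n)"]) auto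
qed

text \<open>Attainment is stated with the formula because \<open>GREATEST\<close> is meaningful only
  when a greatest value exists.\<close>

theorem theorem3p5:
  fixes T :: nat
    and W :: "nat \<Rightarrow> 'a::finite \<Rightarrow> 'b::finite pmf"
    and V :: "nat \<Rightarrow> 'a \<Rightarrow> 'c::finite pmf"
  assumes "T \<ge> 1"
  shows "(\<forall>t\<in>{1..T}. \<exists>m\<in>secrecy_values (W t) (V t). \<forall>v\<in>secrecy_values (W t) (V t). v \<le> m) \<and>
    csi_secrecy_capacity T W V =
      ereal (MIN t\<in>{1..T}. GREATEST v. v \<in> secrecy_values (W t) (V t))"
proof
  show "\<forall>t\<in>{1..T}. \<exists>m\<in>secrecy_values (W t) (V t). \<forall>v\<in>secrecy_values (W t) (V t). v \<le> m"
    using secrecy_values_attained by blast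
  define m where "m t = (GREATEST v. v \<in> secrecy_values (W t) (V t))" for t
  have m: "m t \<in> secrecy_values (W t) (V t) \<and> (\<forall>v\<in>secrecy_values (W t) (V t). v \<le> m t)" for t
  proof -
    obtain v where "v \<in> secrecy_values (W t) (V t)" "\<forall>w\<in>secrecy_values (W t) (V t). w \<le> v"
      using secrecy_values_attained by blast
    moreover from this have "m t = v" unfolding m_def by (intro Greatest_equality) auto
    ultimately show ?thesis by simp
  qed
  define mm where "mm = (MIN t\<in>{1..T}. m t)"
  have le: "mm \<le> m t" if "t \<in> {1..T}" for t unfolding mm_def using that by (intro Min_le) auto
  obtain t0 where t0: "t0 \<in> {1..T}" "mm = m t0"
    using Min_in[of "m ` {1..T}"] assms unfolding mm_def by fastforce
  have "csi_secrecy_capacity T W V = ereal mm"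
  proof (rule antisym)
    show "csi_secrecy_capacity T W V \<le> ereal mm"
      unfolding csi_secrecy_capacity_def
    proof (rule SUP_least)
      fix R assume "R \<in> {R. csi_achievable T W V R}"
      then show "ereal R \<le> ereal mm"
        using csi_converse[of T W V R t0 "m t0"] t0 m[of t0] by simp
    qed
    show "ereal mm \<le> csi_secrecy_capacity T W V"
    proof (rule ccontr)
      assume "\<not> ?thesis"
      then have "csi_secrecy_capacity T W V < ereal mm" by simp
      then obtain R where R: "csi_secrecy_capacity T W V < ereal R" "R < mm"
        using ereal_dense2 by force
      have sup: "ereal R' \<le> csi_secrecy_capacity T W V" if "csi_achievable T W V R'" for R'
        unfolding csi_secrecy_capacity_def using that by (intro SUP_upper) auto
      \<comment> \<open>Rate 0 is always achievable, so a rate above the capacity is positive and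
        the random code applies to it.\<close>
      have "ereal 0 < ereal R" using sup[OF csi_achievable_zero[OF assms]] R(1) by (rule le_less_trans)
      then have R0: "R > 0" by simp
      have "\<forall>t. \<exists>pK :: 'a pmf \<times> ('a \<Rightarrow> 'a pmf). m t * ln 2 =
          info (fst pK) (\<lambda>u. bind_pmf (snd pK u) (W t)) - info (fst pK) (\<lambda>u. bind_pmf (snd pK u) (V t))"
      proof
        fix t
        obtain p :: "'a pmf" and K :: "'a \<Rightarrow> 'a pmf"
          where "m t * ln 2 = info p (\<lambda>u. bind_pmf (K u) (W t)) - info p (\<lambda>u. bind_pmf (K u) (V t))"
          by (rule secrecy_value_info[OF conjunct1[OF m[of t]]])
        then show "\<exists>pK :: 'a pmf \<times> ('a \<Rightarrow> 'a pmf). m t * ln 2 =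
          info (fst pK) (\<lambda>u. bind_pmf (snd pK u) (W t)) - info (fst pK) (\<lambda>u. bind_pmf (snd pK u) (V t))"
          by (intro exI[of _ "(p, K)"]) simp
      qed
      from choice[OF this] obtain pK :: "nat \<Rightarrow> 'a pmf \<times> ('a \<Rightarrow> 'a pmf)" 
        where pK: "\<And>t. m t * ln 2 = info (fst (pK t)) (\<lambda>u. bind_pmf (snd (pK t) u) (W t))
          - info (fst (pK t)) (\<lambda>u. bind_pmf (snd (pK t) u) (V t))" by blast
      have "csi_achievable T W V R"
      proof (rule csi_achievable_below[OF assms R0, where p = "\<lambda>t. fst (pK t)" and K = "\<lambda>t. snd (pK t)"])
        fix t assume "t \<in> {1..T}"
        then have "R < m t" using le R(2) by fastforce
        then have "R * ln 2 < m t * ln 2" by simp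
        then show "R * ln 2 < info (fst (pK t)) (\<lambda>u. bind_pmf (snd (pK t) u) (W t))
          - info (fst (pK t)) (\<lambda>u. bind_pmf (snd (pK t) u) (V t))" unfolding pK .
      qed
      then show False using sup R(1) by fastforce
    qed
  qed
  then show "csi_secrecy_capacity T W V = ereal (MIN t\<in>{1..T}. GREATEST v. v \<in> secrecy_values (W t) (V t))"
    unfolding mm_def m_def .
qed

end
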